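(* Let $m\ge1$, let $A=(A(1),\dots,A(m))$ be a tuple of non-negative real numbers, and suppose that $D:=m+\sum_{i=1}^m A(i)>1$. For $\psi\in G\Psi(1,D)$ define $$\zeta_\psi(q)=C\!\left(\frac{Dq}{D+q}\right)\psi\!\left(\frac{Dq}{D+q}\right),\qquad q\in\left(\frac{D}{D-1},\infty\right),$$ where $C(p)$ is the exact constant in the monomial Sobolev inequality. Then for every $\psi\in G\Psi(1,D)$ and every $u\in\bigcap_{p\in(1,D)}W^1_p(\mathbb{R}^m;\mu_A)$ with $\|\nabla u\|_{G(\psi;\mu_A)}<\infty$, $$\|u\|_{G(\zeta_\psi;\mu_A)}\le 1\cdot\|\nabla u\|_{G(\psi;\mu_A)},$$ and the constant $1$ in this inequality is the best possible (there is no $c<1$ such that $\|u\|_{G(\zeta_\psi;\mu_A)}\le c\,\|\nabla u\|_{G(\psi;\mu_A)}$ holds for all such $\psi$ and $u$).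
   Context: Monomial weight: $|x|^A:=\prod_{i=1}^m|x_i|^{A(i)}$ for $x\in\mathbb{R}^m$, and $\mu_A$ is the measure $d\mu_A=|x|^A\,dx$ on $\mathbb{R}^m$. Write $|f|_{p,\mu_A}=\left(\int_{\mathbb{R}^m}|f|^p\,d\mu_A\right)^{1/p}$; for the gradient, $|\nabla u|$ denotes its Euclidean norm. $C(p)$: for $1<p<D$ and $q=Dp/(D-p)$, $C(p)$ denotes the exact (smallest) constant in the monomial Sobolev inequality $$\left(\int_{\mathbb{R}^m}|x|^A|u(x)|^q\,dx\right)^{1/q}\le C(p)\left(\int_{\mathbb{R}^m}|x|^A|\nabla u(x)|^p\,dx\right)^{1/p},\qquad u\in C_0^\infty(\mathbb{R}^m);$$ it is known that $C(p)<\infty$. The relation $q=Dp/(D-p)$ is equivalent to $p=Dq/(D+q)$, and $1<p<D$ corresponds to $D/(D-1)<q<\infty$. $W^1_p(\mathbb{R}^m;\mu_A)$ is the closure of the compactly supported continuously differentiable functions on $\mathbb{R}^m$ in the norm $|u|_{p,\mu_A}+|\nabla u|_{p,\mu_A}$. Grand Lebesgue Spaces: for $1\le a<b\le\infty$, $G\Psi(a,b)$ is the set of continuous positive functions $\psi$ on the open interval $(a,b)$ with $\inf_{p\in(a,b)}\psi(p)>0$. For $\psi$ on $(a,b)$, $$\|f\|_{G(\psi;\mu_A)}:=\sup_{p\in(a,b)}\frac{|f|_{p,\mu_A}}{\psi(p)},$$ and $\|\nabla u\|_{G(\psi;\mu_A)}$ means the norm of the scalar function $|\nabla u|$. For $\zeta_\psi$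 the interval is $(D/(D-1),\infty)$. *)

theory Defs
  imports "HOL-Analysis.Analysis"
begin

text \<open>
  The case distinction is needed because \<open>0 powr 0 = 0\<close> in HOL, whereas the factor
  \<open>\<bar>x\<^sub>i\<bar>\<^sup>0\<close> is meant to be \<open>1\<close> everywhere.
\<close>

definition monomial_weight :: "real^'n \<Rightarrow> real^'n \<Rightarrow> real" where
  "monomial_weight A x = (\<Prod>i\<in>UNIV. if A $ i = 0 then 1 else \<bar>x $ i\<bar> powr (A $ i))"

definition monomial_measure :: "real^'n \<Rightarrow> (real^'n) measure" where
  "monomial_measure A = density lebesgue (\<lambda>x. ennreal (monomial_weight A x))"

definition hom_dim :: "real^'n \<Rightarrow> real" where
  "hom_dim A = real CARD('n) + (\<Sum>i\<in>UNIV. A $ i)"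

text \<open>\<open>lp_norm M p f\<close> is used for \<open>0 < p < \<infinity>\<close> only; it is \<open>\<infinity>\<close> if the integral diverges.\<close>

definition lp_norm :: "'a measure \<Rightarrow> real \<Rightarrow> ('a \<Rightarrow> real) \<Rightarrow> ennreal" where
  "lp_norm M p f =
     (let I = (\<integral>\<^sup>+x. ennreal (\<bar>f x\<bar> powr p) \<partial>M)
      in if I = \<infinity> then \<infinity> else ennreal (enn2real I powr (1 / p)))"

text \<open>
  In what follows \<open>I\<close> is the open interval of exponents; values of \<open>\<psi>\<close> outside \<open>I\<close> are irrelevant.
\<close>

definition GPsi :: "real set \<Rightarrow> (real \<Rightarrow> real) set" where
  "GPsi I = {\<psi>. continuous_on I \<psi> \<and> (\<forall>p\<in>I. 0 < \<psi> p) \<and> 0 < (INF p\<in>I. \<psi> p)}"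

text \<open>
  The weight is extended real valued, so that the norm also makes sense for the functions
  \<open>\<zeta>\<^sub>\<psi>\<close> below without first knowing that the Sobolev constants are finite.
\<close>

definition gls_norm :: "'a measure \<Rightarrow> real set \<Rightarrow> (real \<Rightarrow> ennreal) \<Rightarrow> ('a \<Rightarrow> real) \<Rightarrow> ennreal" where
  "gls_norm M I \<psi> f = (SUP p\<in>I. lp_norm M p f / \<psi> p)"

definition grad :: "(real^'n \<Rightarrow> real) \<Rightarrow> real^'n \<Rightarrow> real^'n" where
  "grad f x = (\<chi> i. frechet_derivative f (at x) (axis i 1))"

primrec Ck :: "nat \<Rightarrow> (real^'n \<Rightarrow> real) \<Rightarrow> bool" where
  "Ck 0 f \<longleftrightarrow> continuous_on UNIV f"
| "Ck (Suc k) f \<longleftrightarrow> (\<forall>x. f differentiable (at x)) \<and> (\<forall>i. Ck k (\<lambda>x. grad f x $ i))"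

definition compactly_supported :: "(real^'n \<Rightarrow> real) \<Rightarrow> bool" where
  "compactly_supported f \<longleftrightarrow> compact (closure {x. f x \<noteq> 0})"

definition C1_c :: "(real^'n \<Rightarrow> real) set" where
  "C1_c = {f. Ck 1 f \<and> compactly_supported f}"

definition Cinf_c :: "(real^'n \<Rightarrow> real) set" where
  "Cinf_c = {f. (\<forall>k. Ck k f) \<and> compactly_supported f}"

definition sobolev_const :: "real^'n \<Rightarrow> real \<Rightarrow> ennreal" where
  "sobolev_const A p =
     Inf {c. \<forall>u\<in>Cinf_c.
            lp_norm (monomial_measure A) (hom_dim A * p / (hom_dim A - p)) u
              \<le> c * lp_norm (monomial_measure A) p (\<lambda>x. norm (grad u x))}"

text \<open>
  An element of the closure of \<open>C1_c\<close> is represented by a function \<open>u\<close> together with the limit \<open>g\<close>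
  of the gradients of an approximating sequence.
\<close>

definition has_sobolev_grad ::
    "real^'n \<Rightarrow> real \<Rightarrow> (real^'n \<Rightarrow> real) \<Rightarrow> (real^'n \<Rightarrow> real^'n) \<Rightarrow> bool" where
  "has_sobolev_grad A p u g \<longleftrightarrow>
     u \<in> borel_measurable (monomial_measure A) \<and> g \<in> borel_measurable (monomial_measure A) \<and>
     (\<exists>v. (\<forall>n::nat. v n \<in> C1_c) \<and>
          (\<lambda>n. lp_norm (monomial_measure A) p (\<lambda>x. v n x - u x) +
               lp_norm (monomial_measure A) p (\<lambda>x. norm (grad (v n) x - g x))) \<longlonglongrightarrow> 0)"

definition W1 :: "real^'n \<Rightarrow> real \<Rightarrow> (real^'n \<Rightarrow> real) set" where
  "W1 A p = {u. \<exists>g. has_sobolev_grad A p u g}"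

text \<open>
  For \<open>A \<ge> 0\<close> and \<open>p \<ge> 1\<close> the limit \<open>g\<close> is the weak gradient of \<open>u\<close> off the coordinate hyperplanes
  (locally there, the weight is bounded above and away from zero). Hence it is unique almost
  everywhere and independent of \<open>p\<close>, and the following choice is immaterial.
\<close>

definition sobolev_grad :: "real^'n \<Rightarrow> (real^'n \<Rightarrow> real) \<Rightarrow> real^'n \<Rightarrow> real^'n" where
  "sobolev_grad A u = (SOME g. \<exists>p\<ge>1. has_sobolev_grad A p u g)"

definition zeta :: "real^'n \<Rightarrow> (real \<Rightarrow> real) \<Rightarrow> real \<Rightarrow> ennreal" where
  "zeta A \<psi> q =
     (let p = hom_dim A * q / (hom_dim A + q) in sobolev_const A p * ennreal (\<psi> p))"

end

theory Submission
  imports Defs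
begin

text \<open>
  With \<open>q = D p / (D - p)\<close>, equivalently \<open>p = D q / (D + q)\<close>, the Sobolev inequality at the exponent
  \<open>p\<close>, divided by \<open>C(p) \<psi>(p)\<close>, bounds the quotient at \<open>q\<close> in the norm of \<open>u\<close> by the quotient at
  \<open>p\<close> in the norm of its gradient. Taking suprema gives the inequality with the constant \<open>1\<close>
  (\<open>gls_norm_sobolev\<close>). Two points need an argument. The constant \<open>C(p)\<close> is determined by smooth test
  functions, so the inequality has to be carried over to the closure: mollification reaches the
  functions in \<open>C1_c\<close>, and almost everywhere convergence of a subsequence together with Fatou's lemma
  reaches the closure (\<open>sobolev_inequality_C1_c\<close>, \<open>sobolev_inequality_W1\<close>). And a single
  function has to serve as the gradient of \<open>u\<close> for all \<open>p\<close> at once: this holds because the gradient is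
  a weak gradient off the coordinate hyperplanes (\<open>sobolev_grad_unique\<close>).

  For the optimality, take for \<open>\<psi>(p)\<close> the norm of \<open>\<nabla>w\<close> with exponent \<open>p\<close>, where \<open>w\<close> is a
  smooth test function. The gradient of \<open>w\<close> then has norm \<open>1\<close>, and an
  inequality with the constant \<open>c\<close> says that \<open>c C(p)\<close> is an admissible constant in the Sobolev
  inequality for \<open>w\<close> (\<open>gls_constant_transfers\<close>). As \<open>C(p)\<close> is the smallest such constant,
  \<open>C(p) \<le> c C(p)\<close>, and this excludes \<open>c < 1\<close> once \<open>0 < C(p) < \<infinity>\<close>.

  The finiteness of \<open>C(p)\<close> is the monomial Sobolev inequality, the analytic core of the
  proof. From a point \<open>x\<close> of an orthant one moves away from all the coordinate hyperplanes, along the rays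
  \<open>x + t z\<close> with \<open>z\<close> in a cube of the same orthant that does not touch them. On such a ray the weight is at least its
  value at \<open>x\<close> and at least a power of \<open>t\<close>. Integrating \<open>\<bar>\<nabla>u\<bar>\<close> along the rays and
  averaging over \<open>z\<close> bounds \<open>\<bar>u(x)\<bar>\<close>. The part with \<open>t \<le> r\<close> is controlled in the
  mean, the part with \<open>t \<ge> r\<close> pointwise by a multiple of \<open>r\<close> to the power \<open>1 - D\<close>. The best \<open>r\<close> gives a bound for the measure of
  the sets \<open>{\<bar>u\<bar> \<ge> l}\<close>, the weak-type inequality for \<open>p = 1\<close> (\<open>weak_type_sobolev\<close>). Applied to the
  slices of \<open>u\<close> between the levels \<open>s\<close> and \<open>2 s\<close>, it yields the inequality between norms for
  \<open>p = 1\<close> (\<open>strong_sobolev_L1\<close>). That inequality for a power of \<open>\<bar>u\<bar>\<close>, combined with Hoelder's inequality, is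
  the one for \<open>p > 1\<close> (\<open>monomial_sobolev_C1_c\<close>).
\<close>

section \<open>Gradients and iterated differentiability\<close>

text \<open>
  The vector of partial derivatives represents the derivative in the sense of \<open>GDERIV\<close>. From here on
  gradients are computed with the calculus of \<open>GDERIV\<close>, and \<open>grad_eqI\<close> leads back to \<open>grad\<close>.
\<close>

lemma gderiv_grad:
  assumes "f differentiable (at x)"
  shows "GDERIV f x :> grad f x"
proof -
  define L where "L = frechet_derivative f (at x)"
  have d: "(f has_derivative L) (at x)"
    using assms frechet_derivative_works L_def by auto
  have lin: "linear L" by (rule has_derivative_linear[OF d])
  have "L h = inner h (grad f x)" for h
  proof -
    have "L h = L (\<Sum>i\<in>UNIV. (h $ i) *\<^sub>R axis i 1)"
      using basis_expansion[of h] by (simp add: scalar_mult_eq_scaleR)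
    also have "\<dots> = (\<Sum>i\<in>UNIV. h $ i * L (axis i 1))"
      by (simp add: linear_sum[OF lin] linear_scale[OF lin])
    also have "\<dots> = inner h (grad f x)"
      by (simp add: inner_vec_def grad_def L_def)
    finally show ?thesis .
  qed
  then have "L = (\<lambda>h. inner h (grad f x))" by auto
  with d show ?thesis by (simp add: gderiv_def)
qed

lemma grad_eqI:
  assumes "GDERIV f x :> D"
  shows "grad f x = D"
proof -
  have "frechet_derivative f (at x) = (\<lambda>h. inner h D)"
    using assms frechet_derivative_at unfolding gderiv_def by metis
  then show ?thesis
    by (simp add: grad_def vec_eq_iff inner_axis')
qed

lemma gderiv_differentiable: "GDERIV f x :> D \<Longrightarrow> f differentiable (at x)"
  unfolding gderiv_def differentiable_def by blast

lemma gderiv_continuous: "(\<And>x. GDERIV f x :> D x) \<Longrightarrow> continuous_on S f"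
  unfolding gderiv_def
  by (meson continuous_at_imp_continuous_on has_derivative_continuous)

lemma Ck_1_iff: "Ck 1 f \<longleftrightarrow> (\<forall>x. GDERIV f x :> grad f x) \<and> continuous_on UNIV (grad f)"
proof -
  have "continuous_on UNIV (grad f)" if *: "\<forall>i. continuous_on UNIV (\<lambda>x. grad f x $ i)"
  proof -
    have "continuous_on UNIV (\<lambda>x. \<chi> i. grad f x $ i)"
      using * by (intro continuous_on_vec_lambda) auto
    then show ?thesis by simp
  qed
  moreover have "\<forall>i. continuous_on UNIV (\<lambda>x. grad f x $ i)" if "continuous_on UNIV (grad f)"
    using that by (intro allI continuous_on_component)
  ultimately show ?thesis
    unfolding One_nat_def Ck.simps using gderiv_grad gderiv_differentiable by metis
qed

lemma Ck_1I:
  assumes "\<And>x. GDERIV f x :> g x" "continuous_on UNIV g"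
  shows "Ck 1 f" "grad f = g"
proof -
  show "grad f = g" using assms(1) grad_eqI by blast
  with assms show "Ck 1 f" unfolding Ck_1_iff by simp
qed

lemma Ck_Suc_imp_Ck: "Ck (Suc k) f \<Longrightarrow> Ck k f"
proof (induction k arbitrary: f)
  case 0
  then show ?case
    using gderiv_continuous[of f "grad f"] gderiv_grad by auto
next
  case (Suc k)
  then show ?case by simp
qed

lemma Ck_mono: "k \<le> l \<Longrightarrow> Ck l f \<Longrightarrow> Ck k f"
  by (induction rule: inc_induct) (auto intro: Ck_Suc_imp_Ck simp del: Ck.simps)

lemma Ck_SucI:
  assumes "\<And>x. GDERIV f x :> g x" "\<And>i. Ck k (\<lambda>x. g x $ i)"
  shows "Ck (Suc k) f"
proof -
  have "grad f = g" using assms(1) grad_eqI by blast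
  moreover have "f differentiable (at x)" for x
    using assms(1) by (rule gderiv_differentiable)
  ultimately show ?thesis using assms(2) by simp
qed

lemma Ck_SucD: "Ck (Suc k) f \<Longrightarrow> GDERIV f x :> grad f x"
  using gderiv_grad by auto

lemma Ck_const: "Ck k (\<lambda>x. c)"
proof (induction k arbitrary: c)
  case (Suc k)
  show ?case
    by (rule Ck_SucI[where g = "\<lambda>x. 0"]) (use Suc in \<open>auto intro: GDERIV_const\<close>)
qed simp

lemma Ck_add: "Ck k f \<Longrightarrow> Ck k g \<Longrightarrow> Ck k (\<lambda>x. f x + g x)"
proof (induction k arbitrary: f g)
  case 0
  then show ?case by (auto intro: continuous_intros)
next
  case (Suc k)
  show ?case
    by (rule Ck_SucI[OF GDERIV_add[OF Ck_SucD[OF Suc.prems(1)] Ck_SucD[OF Suc.prems(2)]]])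
       (use Suc in auto)
qed

lemma Ck_mult: "Ck k f \<Longrightarrow> Ck k g \<Longrightarrow> Ck k (\<lambda>x. f x * g x)"
proof (induction k arbitrary: f g)
  case 0
  then show ?case by (auto intro: continuous_intros)
next
  case (Suc k)
  show ?case
  proof (rule Ck_SucI[OF GDERIV_mult[OF Ck_SucD[OF Suc.prems(1)] Ck_SucD[OF Suc.prems(2)]]])
    fix i
    have "Ck k (\<lambda>x. f x * grad g x $ i + g x * grad f x $ i)"
      by (intro Ck_add Suc.IH) (use Suc.prems Ck_Suc_imp_Ck in auto)
    then show "Ck k (\<lambda>x. (f x *\<^sub>R grad g x + g x *\<^sub>R grad f x) $ i)" by simp
  qed
qed

lemma Ck_prod: "finite I \<Longrightarrow> (\<And>i. i \<in> I \<Longrightarrow> Ck k (f i)) \<Longrightarrow> Ck k (\<lambda>x. \<Prod>i\<in>I. f i x)"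
  by (induction rule: finite_induct) (auto intro: Ck_const Ck_mult)

lemma gderiv_component: "GDERIV (\<lambda>x::real^'n. x $ i) x :> axis i 1"
proof -
  have "((\<lambda>x::real^'n. x $ i) has_derivative (\<lambda>h. h $ i)) (at x)"
    by (rule bounded_linear_imp_has_derivative) (rule bounded_linear_vec_nth)
  then show ?thesis by (simp add: gderiv_def inner_axis)
qed

text \<open>
  A function \<open>h 0\<close> of one variable with derivatives \<open>h 1, h 2, \<dots>\<close> is smooth as a function of one
  coordinate. The whole sequence appears, as the induction on \<open>k\<close> replaces \<open>h j\<close> by \<open>h (Suc j)\<close>.
\<close>

lemma Ck_component:
  assumes h: "\<And>j t. DERIV (h j) t :> h (Suc j) t"
  shows "Ck k (\<lambda>x::real^'n. h j (x $ i))"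
proof (induction k arbitrary: j)
  case 0
  have "continuous_on UNIV (h j)"
    using h by (meson DERIV_continuous continuous_at_imp_continuous_on)
  then show ?case
    by (auto intro!: continuous_intros continuous_on_compose2[of UNIV "h j"])
next
  case (Suc k)
  show ?case
  proof (rule Ck_SucI[OF GDERIV_DERIV_compose[OF gderiv_component h]])
    fix i'
    have "(\<lambda>x::real^'n. (h (Suc j) (x $ i) *\<^sub>R axis i 1) $ i')
        = (if i' = i then (\<lambda>x. h (Suc j) (x $ i)) else (\<lambda>x. 0))"
      by (auto simp: axis_def)
    then show "Ck k (\<lambda>x::real^'n. (h (Suc j) (x $ i) *\<^sub>R axis i 1) $ i')"
      using Suc[of "Suc j"] Ck_const[of k 0] by (auto split: if_split)
  qed
qed

section \<open>Smooth bump functions\<close>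

text \<open>
  For the polynomial \<open>1\<close> this is the standard smooth function \<open>exp (- 1 / t)\<close> that vanishes to
  infinite order at \<open>0\<close>. Admitting all polynomials makes the family closed under differentiation.
\<close>

definition flat :: "real poly \<Rightarrow> real \<Rightarrow> real" where
  "flat P t = (if 0 < t then poly P (1 / t) * exp (- (1 / t)) else 0)"

lemma poly_over_exp_tendsto_0: "((\<lambda>s. poly P s * exp (- s)) \<longlongrightarrow> 0) at_top" for P :: "real poly"
proof -
  have "((\<lambda>s. \<Sum>i\<le>degree P. coeff P i * (s ^ i / exp s)) \<longlongrightarrow> (\<Sum>i\<le>degree P. coeff P i * 0)) at_top"
    by (intro tendsto_sum tendsto_mult tendsto_const tendsto_power_div_exp_0)
  moreover have "(\<lambda>s. poly P s * exp (- s)) = (\<lambda>s. \<Sum>i\<le>degree P. coeff P i * (s ^ i / exp s))"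
    by (simp add: poly_altdef exp_minus sum_distrib_right divide_inverse mult.assoc)
  ultimately show ?thesis by simp
qed

text \<open>
  For \<open>t > 0\<close> the product rule gives \<open>(P - P')(1/t) exp (- 1/t) / t^2\<close>, and the factor \<open>1 / t^2\<close> is
  absorbed by two multiplications of the polynomial with its variable. At \<open>0\<close> the difference quotient
  tends to \<open>0\<close> as the exponential beats every polynomial in \<open>1 / t\<close>.
\<close>

lemma flat_deriv: "DERIV (flat P) t :> flat (pCons 0 (pCons 0 (P - pderiv P))) t"
proof -
  consider "t > 0" | "t < 0" | "t = 0" by linarith
  then show ?thesis
  proof cases
    case 1
    have "DERIV (\<lambda>t. poly P (1 / t) * exp (- (1 / t))) t
        :> flat (pCons 0 (pCons 0 (P - pderiv P))) t"
      using 1 by (auto intro!: derivative_eq_intros DERIV_chain2[OF poly_DERIV]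
          simp: flat_def field_simps power2_eq_square)
    then show ?thesis
    proof (rule has_field_derivative_transform_within_open)
      show "open {0::real<..}" "t \<in> {0<..}" using 1 by auto
    qed (auto simp: flat_def)
  next
    case 2
    have "DERIV (\<lambda>t. 0) t :> flat (pCons 0 (pCons 0 (P - pderiv P))) t"
      using 2 by (simp add: flat_def)
    then show ?thesis
    proof (rule has_field_derivative_transform_within_open)
      show "open {..<(0::real)}" "t \<in> {..<0}" using 2 by auto
    qed (auto simp: flat_def)
  next
    case 3
    have "((\<lambda>h. poly (pCons 0 P) (inverse h) * exp (- inverse h)) \<longlongrightarrow> 0) (at_right (0::real))"
      using poly_over_exp_tendsto_0[of "pCons 0 P"] filterlim_inverse_at_top_right
      by (rule filterlim_compose)
    then have R: "((\<lambda>h. flat P h / h) \<longlongrightarrow> 0) (at_right 0)"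
      by (rule Lim_transform_eventually)
         (auto simp: flat_def eventually_at_filter field_simps)
    have L: "((\<lambda>h. flat P h / h) \<longlongrightarrow> 0) (at_left 0)"
      by (rule Lim_transform_eventually[of "\<lambda>_. 0"]) (auto simp: flat_def eventually_at_filter)
    have "((\<lambda>h. flat P h / h) \<longlongrightarrow> 0) (at 0)"
      using filterlim_split_at[OF L R] .
    with 3 show ?thesis
      by (simp add: DERIV_def flat_def)
  qed
qed

definition flat_deriv_poly :: "nat \<Rightarrow> real poly" where
  "flat_deriv_poly j = ((\<lambda>P. pCons 0 (pCons 0 (P - pderiv P))) ^^ j) 1"

lemma flat_iterated_deriv: "DERIV (flat (flat_deriv_poly j)) t :> flat (flat_deriv_poly (Suc j)) t"
  unfolding flat_deriv_poly_def funpow.simps o_apply by (rule flat_deriv)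

definition bump :: "real^'n \<Rightarrow> real^'n \<Rightarrow> real^'n \<Rightarrow> real" where
  "bump a b x = (\<Prod>i\<in>UNIV. flat 1 (x $ i - a $ i) * flat 1 (b $ i - x $ i))"

lemma flat_1_nonneg: "0 \<le> flat 1 t" and flat_1_pos_iff: "0 < flat 1 t \<longleftrightarrow> 0 < t"
  by (auto simp: flat_def)

lemma bump_nonneg: "0 \<le> bump a b x"
  unfolding bump_def by (intro prod_nonneg mult_nonneg_nonneg flat_1_nonneg ballI)

lemma bump_pos_iff: "0 < bump a b x \<longleftrightarrow> x \<in> box a b"
proof
  assume "x \<in> box a b"
  then show "0 < bump a b x"
    unfolding bump_def mem_box_cart
    by (intro prod_pos) (auto simp: flat_1_pos_iff)
next
  assume *: "0 < bump a b x"
  then have "flat 1 (x $ i - a $ i) * flat 1 (b $ i - x $ i) \<noteq> 0" for i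
    unfolding bump_def by (auto simp: prod_zero_iff dest: less_imp_neq)
  then have "flat 1 (x $ i - a $ i) \<noteq> 0" "flat 1 (b $ i - x $ i) \<noteq> 0" for i
    by auto
  then have "0 < x $ i - a $ i \<and> 0 < b $ i - x $ i" for i
    using flat_1_nonneg[of "x $ i - a $ i"] flat_1_nonneg[of "b $ i - x $ i"]
      flat_1_pos_iff[of "x $ i - a $ i"] flat_1_pos_iff[of "b $ i - x $ i"]
    by (simp add: order_less_le)
  then show "x \<in> box a b" by (auto simp: mem_box_cart)
qed

lemma bump_eq_0: "x \<notin> box a b \<Longrightarrow> bump a b x = 0"
  using bump_pos_iff[of a b x] bump_nonneg[of a b x] by linarith

lemma compactly_supportedI: "(\<And>x. x \<notin> cbox a b \<Longrightarrow> f x = 0) \<Longrightarrow> compactly_supported f"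
proof -
  assume "\<And>x. x \<notin> cbox a b \<Longrightarrow> f x = 0"
  then have "{x. f x \<noteq> 0} \<subseteq> cbox a b" by blast
  then have "bounded {x. f x \<noteq> 0}" using bounded_cbox bounded_subset by blast
  then show ?thesis unfolding compactly_supported_def by (simp add: compact_closure)
qed

lemma Ck_bump:
  fixes a b :: "real^'n"
  shows "Ck k (bump a b)"
proof -
  have "Ck k (\<lambda>x. flat 1 (x $ i - a $ i) * flat 1 (b $ i - x $ i))" for i
  proof (rule Ck_mult)
    have "Ck k (\<lambda>x::real^'n. (\<lambda>j t. flat (flat_deriv_poly j) (t - a $ i)) 0 (x $ i))"
    proof (rule Ck_component)
      show "DERIV (\<lambda>t. flat (flat_deriv_poly j) (t - a $ i)) t
          :> flat (flat_deriv_poly (Suc j)) (t - a $ i)" for j t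
      proof -
        have "DERIV (\<lambda>t. t - a $ i) t :> 1" by (auto intro!: derivative_eq_intros)
        from DERIV_chain2[OF flat_iterated_deriv this, of j] show ?thesis by simp
      qed
    qed
    then show "Ck k (\<lambda>x. flat 1 (x $ i - a $ i))" by (simp add: flat_deriv_poly_def)
    have "Ck k (\<lambda>x::real^'n. (\<lambda>j t. (-1) ^ j * flat (flat_deriv_poly j) (b $ i - t)) 0 (x $ i))"
    proof (rule Ck_component)
      show "DERIV (\<lambda>t. (-1) ^ j * flat (flat_deriv_poly j) (b $ i - t)) t
          :> (-1) ^ Suc j * flat (flat_deriv_poly (Suc j)) (b $ i - t)" for j t
      proof -
        have "DERIV (\<lambda>t. b $ i - t) t :> -1" by (auto intro!: derivative_eq_intros)
        from DERIV_cmult[OF DERIV_chain2[OF flat_iterated_deriv this], of "(-1) ^ j" j]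
        show ?thesis by simp
      qed
    qed
    then show "Ck k (\<lambda>x. flat 1 (b $ i - x $ i))" by (simp add: flat_deriv_poly_def)
  qed
  then have "Ck k (\<lambda>x. \<Prod>i\<in>UNIV. flat 1 (x $ i - a $ i) * flat 1 (b $ i - x $ i))"
    by (intro Ck_prod) auto
  moreover have "bump a b = (\<lambda>x. \<Prod>i\<in>UNIV. flat 1 (x $ i - a $ i) * flat 1 (b $ i - x $ i))"
    by (auto simp: bump_def)
  ultimately show ?thesis by simp
qed

lemma bump_Cinf_c: "bump a b \<in> Cinf_c"
proof -
  have "compactly_supported (bump a b)"
    by (rule compactly_supportedI[of a b])
       (meson bump_eq_0 box_subset_cbox subsetD)
  then show ?thesis using Ck_bump by (auto simp: Cinf_c_def)
qed

section \<open>Compactly supported functions and integration by parts\<close>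

definition cube :: "real \<Rightarrow> (real^'n) set" where
  "cube R = cbox (vec (- R)) (vec R)"

lemma mem_cube: "x \<in> cube R \<longleftrightarrow> (\<forall>i. \<bar>x $ i\<bar> \<le> R)"
  by (auto simp: cube_def mem_box_cart abs_le_iff minus_le_iff)

lemma cube_mono: "R \<le> S \<Longrightarrow> cube R \<subseteq> cube S"
  unfolding subset_iff mem_cube using order_trans by blast

lemma compact_cube: "compact (cube R)" and closed_cube: "closed (cube R)"
  by (auto simp: cube_def)

lemma bounded_subset_cube:
  assumes "bounded S"
  obtains R where "R > 0" "S \<subseteq> (cube R :: (real^'n) set)"
proof -
  obtain a where a: "a > 0" "\<And>x. x \<in> S \<Longrightarrow> norm x \<le> a"
    using assms bounded_pos by metis
  have "S \<subseteq> cube a"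
  proof
    fix x assume "x \<in> S"
    then show "x \<in> cube a"
      unfolding mem_cube using a(2) component_le_norm_cart order_trans by blast
  qed
  with a that show ?thesis by blast
qed

text \<open>
  Supports are measured by cubes around the origin, so that finitely many of them are contained in a common
  compact box.
\<close>

lemma compactly_supported_cube:
  assumes "compactly_supported f"
  obtains R where "R > 0" "\<And>x. x \<notin> cube R \<Longrightarrow> f x = 0"
proof -
  have "bounded {x. f x \<noteq> 0}"
    using assms unfolding compactly_supported_def
    by (meson bounded_subset closure_subset compact_imp_bounded)
  then obtain R where "R > 0" "{x. f x \<noteq> 0} \<subseteq> cube R" by (rule bounded_subset_cube)
  with that show ?thesis by blast
qed

lemma grad_eq_0_outside_closed:
  assumes "closed S" "\<And>x. x \<notin> S \<Longrightarrow> f x = 0" "x \<notin> S"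
  shows "grad f x = 0"
proof -
  have "GDERIV (\<lambda>x. 0) x :> 0" by (rule GDERIV_const)
  then have "((\<lambda>x. 0) has_derivative (\<lambda>h. 0)) (at x)" by (simp add: gderiv_def)
  then have "(f has_derivative (\<lambda>h. 0)) (at x)"
    by (rule has_derivative_transform_within_open[of _ _ _ _ "- S"]) (use assms in auto)
  then show ?thesis by (intro grad_eqI) (simp add: gderiv_def)
qed

lemmas grad_eq_0_outside = grad_eq_0_outside_closed[OF closed_cube]

lemma continuous_cube_bound:
  fixes f :: "real^'n \<Rightarrow> 'b::real_normed_vector"
  assumes "continuous_on UNIV f" "\<And>x. x \<notin> cube R \<Longrightarrow> f x = 0"
  obtains B where "B > 0" "\<And>x. norm (f x) \<le> B"
proof -
  have "compact (f ` cube R)"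
    using assms(1) by (intro compact_continuous_image compact_cube) (auto intro: continuous_on_subset)
  then obtain B where B: "B > 0" "\<And>y. y \<in> f ` cube R \<Longrightarrow> norm y \<le> B"
    using compact_imp_bounded bounded_pos by metis
  have "norm (f x) \<le> B" for x
    using B assms(2)[of x] by (cases "x \<in> cube R") auto
  with B that show ?thesis by blast
qed

lemma C1_c_D:
  assumes "u \<in> C1_c"
  shows "GDERIV u x :> grad u x" "continuous_on UNIV u" "continuous_on UNIV (grad u)"
    "compactly_supported u"
proof -
  from assms show "GDERIV u x :> grad u x" "continuous_on UNIV (grad u)" "compactly_supported u"
    unfolding C1_c_def mem_Collect_eq Ck_1_iff by blast+
  from assms have "GDERIV u x :> grad u x" for x
    unfolding C1_c_def mem_Collect_eq Ck_1_iff by blast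
  then show "continuous_on UNIV u" by (rule gderiv_continuous)
qed

lemma C1_c_measurable:
  assumes "u \<in> C1_c"
  shows "u \<in> borel_measurable borel" "grad u \<in> borel_measurable borel"
  using C1_c_D[OF assms] by (auto intro: borel_measurable_continuous_onI)

lemma C1_c_bounds:
  assumes "u \<in> C1_c"
  obtains R B where "R > 0" "B > 0" "\<And>x. x \<notin> cube R \<Longrightarrow> u x = 0"
    "\<And>x. x \<notin> cube R \<Longrightarrow> grad u x = 0" "\<And>x. \<bar>u x\<bar> \<le> B" "\<And>x. norm (grad u x) \<le> B"
proof -
  obtain R where R: "R > 0" "\<And>x. x \<notin> cube R \<Longrightarrow> u x = 0"
    using C1_c_D(4)[OF assms] compactly_supported_cube by blast
  then have R': "\<And>x. x \<notin> cube R \<Longrightarrow> grad u x = 0" using grad_eq_0_outside by blast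
  obtain B where B: "B > 0" "\<And>x. norm (u x) \<le> B"
    using continuous_cube_bound[OF C1_c_D(2)[OF assms] R(2)] by blast
  obtain B' where B': "B' > 0" "\<And>x. norm (grad u x) \<le> B'"
    using continuous_cube_bound[OF C1_c_D(3)[OF assms] R'] by blast
  show ?thesis
    by (rule that[of R "max B B'"]) (use R R' B B' in \<open>auto simp: le_max_iff_disj\<close>)
qed

lemma Cinf_c_subset_C1_c: "Cinf_c \<subseteq> C1_c"
  by (auto simp: Cinf_c_def C1_c_def simp del: Ck.simps)

lemma C1_c_I:
  assumes "\<And>x. GDERIV f x :> g x" "continuous_on UNIV g" "\<And>x. x \<notin> cube R \<Longrightarrow> f x = 0"
  shows "f \<in> C1_c" "grad f = g"
  using Ck_1I[OF assms(1,2)] assms(3) compactly_supportedI[of "vec (- R)" "vec R" f]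
  by (auto simp: C1_c_def cube_def simp del: Ck.simps)

text \<open>
  Integrals over a compact box may be differentiated under the integral sign as soon as the integrand is
  continuously differentiable; translation invariance and dominated convergence concern integrals over the
  whole space. For continuous functions supported in a cube this passes between the two.
\<close>

lemma integral_cube:
  fixes f :: "real^'n \<Rightarrow> real"
  assumes "continuous_on UNIV f" "\<And>x. x \<notin> cube R \<Longrightarrow> f x = 0"
  shows "integrable lborel f" "integral (cube R) f = (\<integral>x. f x \<partial>lborel)"
proof -
  have "integrable lborel (\<lambda>x. indicator (cube R) x *\<^sub>R f x)"
    by (intro borel_integrable_compact compact_cube continuous_on_subset[OF assms(1)]) auto
  moreover have "(\<lambda>x. indicator (cube R) x *\<^sub>R f x) = f"
    using assms(2) by (intro ext) (auto simp: indicator_def)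
  ultimately show i: "integrable lborel f" by simp
  have "integral (cube R) f = integral UNIV f"
    by (rule Henstock_Kurzweil_Integration.integral_spike_set)
       (use assms(2) in \<open>auto intro!: negligible_subset[OF negligible_empty]\<close>)
  then show "integral (cube R) f = (\<integral>x. f x \<partial>lborel)"
    using integral_lborel[OF i] by simp
qed

lemma lborel_integral_reflect:
  fixes f :: "real^'n \<Rightarrow> real"
  assumes [measurable]: "f \<in> borel_measurable borel"
  shows "(\<integral>y. f (x - y) \<partial>lborel) = (\<integral>y. f y \<partial>lborel)"
proof -
  have "(lborel :: (real^'n) measure) = density (distr lborel borel (\<lambda>y. x + (-1) *\<^sub>R y)) (\<lambda>_. ennreal (\<bar>-1\<bar> ^ DIM(real^'n)))"
    by (rule lborel_affine) simp
  then have "(lborel :: (real^'n) measure) = distr lborel borel (\<lambda>y. x - y)"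
    by (simp add: density_1)
  then have "(\<integral>y. f y \<partial>lborel) = (\<integral>y. f y \<partial>distr lborel borel (\<lambda>y. x - y))" by simp
  also have "\<dots> = (\<integral>y. f (x - y) \<partial>lborel)" by (rule integral_distr) auto
  finally show ?thesis by simp
qed

lemma lborel_integral_translate:
  fixes f :: "real^'n \<Rightarrow> real"
  assumes [measurable]: "f \<in> borel_measurable borel"
  shows "(\<integral>y. f (y + a) \<partial>lborel) = (\<integral>y. f y \<partial>lborel)"
proof -
  have "(\<integral>y. f y \<partial>lborel) = (\<integral>y. f y \<partial>distr lborel borel ((+) a))"
    by (simp add: lborel_distr_plus)
  also have "\<dots> = (\<integral>y. f (a + y) \<partial>lborel)" by (rule integral_distr) auto
  finally show ?thesis by (simp add: add.commute)
qed

text \<open>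
  The integral of a translate of \<open>F\<close> along the axis \<open>i\<close> does not depend on the translation, and its
  derivative with respect to the translation is the integral of the partial derivative.
\<close>

lemma integral_grad_eq_0:
  fixes F :: "real^'n \<Rightarrow> real"
  assumes F: "F \<in> C1_c"
  shows "(\<integral>x. grad F x $ i \<partial>lborel) = 0"
proof -
  obtain R B where R: "R > 0" "\<And>x. x \<notin> cube R \<Longrightarrow> F x = 0" "\<And>x. x \<notin> cube R \<Longrightarrow> grad F x = 0"
    using C1_c_bounds[OF F] by metis
  have cF: "continuous_on UNIV F" and cG: "continuous_on UNIV (grad F)"
    using C1_c_D[OF F] by auto
  define g where "g t = integral (cube (R + 1)) (\<lambda>x. F (x + t *\<^sub>R axis i 1))" for t
  \<comment> \<open>Enlarging the cube by one leaves room for translations of length at most one.\<close>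
  have shift: "x + t *\<^sub>R axis i 1 \<notin> cube R" if "x \<notin> cube (R + 1)" "t \<in> {-1..1}" for x and t :: real
  proof
    assume *: "x + t *\<^sub>R axis i 1 \<in> cube R"
    have "\<bar>x $ j\<bar> \<le> R + 1" for j
    proof -
      have "\<bar>(x + t *\<^sub>R axis i 1) $ j\<bar> \<le> R" using * by (auto simp: mem_cube)
      moreover have "\<bar>(t *\<^sub>R axis i 1 :: real^'n) $ j\<bar> \<le> 1"
        using that(2) by (auto simp: axis_def)
      ultimately show ?thesis by simp
    qed
    with that(1) show False by (auto simp: mem_cube)
  qed
  have g_const: "g t = (\<integral>x. F x \<partial>lborel)" if "t \<in> {-1..1}" for t
  proof -
    have "g t = (\<integral>x. F (x + t *\<^sub>R axis i 1) \<partial>lborel)"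
      unfolding g_def
    proof (rule integral_cube(2))
      show "continuous_on UNIV (\<lambda>x. F (x + t *\<^sub>R axis i 1))"
        by (rule continuous_on_compose2[OF cF]) (auto intro!: continuous_intros)
    qed (use shift[OF _ that] R in auto)
    then show ?thesis
      using C1_c_measurable(1)[OF F] by (simp add: lborel_integral_translate)
  qed
  have g_D: "(g has_vector_derivative integral (cube (R + 1)) (\<lambda>x. grad F (x + 0 *\<^sub>R axis i 1) $ i))
          (at 0 within {-1..1})"
    unfolding g_def cube_def
  proof (rule leibniz_rule_vector_derivative)
    show "((\<lambda>t. F (x + t *\<^sub>R axis i 1)) has_vector_derivative grad F (x + t *\<^sub>R axis i 1) $ i)
          (at t within {-1..1})" for x t
    proof -
      have "(F has_derivative (\<lambda>h. inner h (grad F (x + t *\<^sub>R axis i 1)))) (at (x + t *\<^sub>R axis i 1))"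
        using C1_c_D(1)[OF F] by (simp add: gderiv_def)
      then have "((\<lambda>t. F (x + t *\<^sub>R axis i 1)) has_derivative
         (\<lambda>s. inner (s *\<^sub>R axis i 1) (grad F (x + t *\<^sub>R axis i 1)))) (at t within {-1..1})"
        by (rule has_derivative_compose[rotated]) (auto intro!: derivative_eq_intros)
      then show ?thesis by (simp add: has_vector_derivative_def inner_axis')
    qed
    show "(\<lambda>x. F (x + t *\<^sub>R axis i 1)) integrable_on cbox (vec (- (R + 1))) (vec (R + 1))" for t
      by (intro integrable_continuous continuous_on_compose2[OF cF]) (auto intro!: continuous_intros)
    show "continuous_on ({-1..1} \<times> cbox (vec (- (R + 1))) (vec (R + 1)))
       (\<lambda>(t, x). grad F (x + t *\<^sub>R axis i 1) $ i)"
      unfolding split_beta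
      by (intro continuous_on_component continuous_on_compose2[OF cG]) (auto intro!: continuous_intros)
  qed auto
  have D: "(g has_vector_derivative (\<integral>x. grad F x $ i \<partial>lborel)) (at 0 within {-1..1})"
  proof -
    have "integral (cube (R + 1)) (\<lambda>x. grad F x $ i) = (\<integral>x. grad F x $ i \<partial>lborel)"
    proof (rule integral_cube(2))
      show "grad F x $ i = 0" if "x \<notin> cube (R + 1)" for x
        proof -
        have "x \<notin> cube R" using that cube_mono[of R "R + 1"] by auto
        then show ?thesis using R(3) by simp
      qed
    qed (intro continuous_on_component cG)
    with g_D show ?thesis by simp
  qed
  have "((\<lambda>t. \<integral>x. F x \<partial>lborel) has_vector_derivative 0) (at 0 within {-1..1::real})" by simp
  then have "(g has_vector_derivative 0) (at 0 within {-1..1})"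
    by (rule has_vector_derivative_transform[rotated 2]) (use g_const in auto)
  with D show ?thesis
    using vector_derivative_unique_within[of 0 "{-1..1::real}"]
    by (metis atLeastAtMost_iff at_within_Icc_at neg_less_0_iff_less trivial_limit_at zero_less_one)
qed

lemma C1_c_mult:
  assumes v: "v \<in> C1_c" and f: "Ck 1 f"
  shows "(\<lambda>x. v x * f x) \<in> C1_c" "grad (\<lambda>x. v x * f x) x = v x *\<^sub>R grad f x + f x *\<^sub>R grad v x"
proof -
  obtain R where R: "\<And>x. x \<notin> cube R \<Longrightarrow> v x = 0"
    using C1_c_D(4)[OF v] compactly_supported_cube by blast
  have f': "\<And>x. GDERIV f x :> grad f x" "continuous_on UNIV (grad f)"
    using f unfolding Ck_1_iff by blast+
  have D: "GDERIV (\<lambda>x. v x * f x) x :> v x *\<^sub>R grad f x + f x *\<^sub>R grad v x" for x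
    by (intro GDERIV_mult C1_c_D(1)[OF v] f'(1))
  have c: "continuous_on UNIV (\<lambda>x. v x *\<^sub>R grad f x + f x *\<^sub>R grad v x)"
    by (intro continuous_intros C1_c_D[OF v] f'(2) gderiv_continuous[OF f'(1)])
  have 0: "v x * f x = 0" if "x \<notin> cube R" for x using R[OF that] by simp
  show "(\<lambda>x. v x * f x) \<in> C1_c" by (rule C1_c_I(1)[OF D c 0])
  show "grad (\<lambda>x. v x * f x) x = v x *\<^sub>R grad f x + f x *\<^sub>R grad v x"
    using C1_c_I(2)[OF D c 0] by simp
qed

text \<open>
  The product \<open>v * f\<close> is again in \<open>C1_c\<close>, so that the integral of its partial derivative vanishes.
\<close>

lemma integration_by_parts:
  fixes v f :: "real^'n \<Rightarrow> real"
  assumes v: "v \<in> C1_c" and f: "Ck 1 f"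
  shows "(\<integral>x. v x * grad f x $ i \<partial>lborel) = - (\<integral>x. grad v x $ i * f x \<partial>lborel)"
proof -
  obtain R B where R: "\<And>x. x \<notin> cube R \<Longrightarrow> v x = 0" "\<And>x. x \<notin> cube R \<Longrightarrow> grad v x = 0"
    using C1_c_bounds[OF v] by metis
  have f': "\<And>x. GDERIV f x :> grad f x" "continuous_on UNIV (grad f)"
    using f unfolding Ck_1_iff by blast+
  have "integrable lborel (\<lambda>x. v x * grad f x $ i)"
    by (rule integral_cube(1)[of _ R]) (auto intro!: continuous_intros C1_c_D[OF v] f' simp: R)
  moreover have "integrable lborel (\<lambda>x. grad v x $ i * f x)"
    by (rule integral_cube(1)[of _ R])
       (auto intro!: continuous_intros C1_c_D[OF v] gderiv_continuous[OF f'(1)] simp: R)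
  moreover have "(\<integral>x. v x * grad f x $ i + grad v x $ i * f x \<partial>lborel) = 0"
    using integral_grad_eq_0[OF C1_c_mult(1)[OF v f], of i] C1_c_mult(2)[OF v f]
    by (simp add: mult.commute)
  ultimately show ?thesis by simp
qed

section \<open>Mollification\<close>

text \<open>
  The cube is meant to contain the support of \<open>f\<close>. Over a compact box, continuity of the integrand and
  of its derivative is all that differentiation under the integral sign requires.
\<close>

definition convolve :: "real \<Rightarrow> (real^'n \<Rightarrow> real) \<Rightarrow> (real^'n \<Rightarrow> real) \<Rightarrow> real^'n \<Rightarrow> real" where
  "convolve R f r x = integral (cube R) (\<lambda>y. f y * r (x - y))"

lemma continuous_diff_arg:
  fixes r :: "real^'n \<Rightarrow> 'b::topological_space"
  shows "continuous_on UNIV r \<Longrightarrow> continuous_on S (\<lambda>p. r (fst p - snd p))"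
  by (rule continuous_on_compose2) (auto intro!: continuous_intros)

text \<open>
  Differentiation under the integral sign puts the derivative on the factor \<open>r\<close>. Iterating this, the
  convolution is as smooth as \<open>r\<close>, although \<open>f\<close> is merely continuous.
\<close>

lemma gderiv_convolve:
  fixes f r :: "real^'n \<Rightarrow> real"
  assumes f: "continuous_on UNIV f" and r: "Ck 1 r"
  shows "GDERIV (convolve R f r) x :> (\<chi> i. convolve R f (\<lambda>x. grad r x $ i) x)"
proof -
  have r': "\<And>x. GDERIV r x :> grad r x" "continuous_on UNIV (grad r)"
    using r unfolding Ck_1_iff by blast+
  have f2: "continuous_on S (\<lambda>p. f (snd p))" for S :: "((real^'n) \<times> (real^'n)) set"
    by (rule continuous_on_compose2[OF f]) (auto intro!: continuous_intros)
  have f1: "continuous_on S f" for S using f continuous_on_subset by blast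
  let ?G = "\<lambda>y. f y *\<^sub>R grad r (x - y)"
  have cG: "continuous_on S ?G" for S
    by (intro continuous_intros f1 continuous_on_compose2[OF r'(2)]) auto
  have "((\<lambda>x. integral (cbox (vec (- R)) (vec R)) (\<lambda>y. f y * r (x - y))) has_derivative
      integral (cbox (vec (- R)) (vec R)) (\<lambda>y. blinfun_inner_left (f y *\<^sub>R grad r (x - y)))) (at x within UNIV)"
  proof (rule leibniz_rule)
    show "((\<lambda>x. f y * r (x - y)) has_derivative blinfun_apply (blinfun_inner_left (f y *\<^sub>R grad r (x - y))))
        (at x within UNIV)" for x y
    proof -
      have "(r has_derivative (\<lambda>h. inner h (grad r (x - y)))) (at (x - y))"
        using r'(1) by (simp add: gderiv_def)
      then have "((\<lambda>x. r (x - y)) has_derivative (\<lambda>h. inner h (grad r (x - y)))) (at x)"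
        by (rule has_derivative_compose[rotated]) (auto intro!: derivative_eq_intros)
      then have "((\<lambda>x. f y * r (x - y)) has_derivative (\<lambda>h. f y * inner h (grad r (x - y)))) (at x)"
        by (rule has_derivative_mult_right)
      then show ?thesis by simp
    qed
    show "(\<lambda>y. f y * r (x - y)) integrable_on cbox (vec (- R)) (vec R)" for x
      by (intro integrable_continuous continuous_intros f1 continuous_on_compose2[OF gderiv_continuous[OF r'(1), of UNIV]]) auto
    show "continuous_on (UNIV \<times> cbox (vec (- R)) (vec R))
        (\<lambda>(x, y). blinfun_inner_left (f y *\<^sub>R grad r (x - y)))"
      unfolding split_beta
      by (intro bounded_linear.continuous_on[OF bounded_linear_blinfun_inner_left] continuous_intros f2
          continuous_diff_arg r'(2))
  qed auto
  also have "integral (cbox (vec (- R)) (vec R)) (\<lambda>y. blinfun_inner_left (?G y))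
      = blinfun_inner_left (integral (cbox (vec (- R)) (vec R)) ?G)"
    using integral_linear[OF integrable_continuous[OF cG] bounded_linear_blinfun_inner_left]
    by (simp add: o_def)
  finally have "GDERIV (convolve R f r) x :> integral (cube R) ?G"
    by (simp add: gderiv_def convolve_def[abs_def] cube_def)
  moreover have "integral (cube R) ?G = (\<chi> i. convolve R f (\<lambda>x. grad r x $ i) x)"
  proof (rule vec_eq_iff[THEN iffD2], rule allI)
    fix i
    have "integral (cube R) ?G $ i = integral (cube R) (\<lambda>y. ?G y $ i)"
      using integral_linear[OF integrable_continuous[OF cG] bounded_linear_vec_nth, of "vec (- R)" "vec R" i]
      by (simp add: o_def cube_def)
    then show "integral (cube R) ?G $ i = (\<chi> i. convolve R f (\<lambda>x. grad r x $ i) x) $ i"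
      by (simp add: convolve_def)
  qed
  ultimately show ?thesis by simp
qed

lemma Ck_convolve:
  fixes f r :: "real^'n \<Rightarrow> real"
  assumes f: "continuous_on UNIV f"
  shows "Ck k r \<Longrightarrow> Ck k (convolve R f r)"
proof (induction k arbitrary: r)
  case 0
  have f2: "continuous_on S (\<lambda>p. f (snd p))" for S :: "((real^'n) \<times> (real^'n)) set"
    by (rule continuous_on_compose2[OF f]) (auto intro!: continuous_intros)
  have "continuous_on UNIV (\<lambda>x. integral (cbox (vec (- R)) (vec R)) (\<lambda>y. f y * r (x - y)))"
  proof (rule integral_continuous_on_param)
    show "continuous_on (UNIV \<times> cbox (vec (- R)) (vec R)) (\<lambda>(x, y). f y * r (x - y))"
      unfolding split_beta
      by (intro continuous_intros f2 continuous_diff_arg) (use 0 in auto)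
  qed
  then show ?case by (simp add: convolve_def[abs_def] cube_def)
next
  case (Suc k)
  have "Ck 1 r" by (rule Ck_mono[OF _ Suc.prems]) simp
  from gderiv_convolve[OF f this] show ?case
    by (rule Ck_SucI) (use Suc in auto)
qed


definition mollifier :: "real \<Rightarrow> real^'n \<Rightarrow> real" where
  "mollifier e x = bump (vec (- e)) (vec e) x / (\<integral>y. bump (vec (- e)) (vec e) (y::real^'n) \<partial>lborel)"

lemma bump_outside_cube: "x \<notin> cube e \<Longrightarrow> bump (vec (- e)) (vec e) x = 0"
  by (rule bump_eq_0) (use box_subset_cbox in \<open>auto simp: cube_def\<close>)

lemma continuous_bump: "continuous_on UNIV (bump a b)"
  using Ck_bump[of 0 a b] by simp

text \<open>
  The bump function is positive on a nonempty open box, which is not a null set. This makes the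
  normalisation in the definition of the mollifier legitimate.
\<close>

lemma bump_integral_pos:
  assumes "box a b \<noteq> {}"
  shows "0 < (\<integral>y. bump a b (y::real^'n) \<partial>lborel)"
proof -
  have "bump a b \<in> C1_c" using bump_Cinf_c Cinf_c_subset_C1_c by blast
  then obtain R where R: "\<And>x. x \<notin> cube R \<Longrightarrow> bump a b x = 0" using C1_c_bounds by metis
  have i: "integrable lborel (bump a b)"
    by (rule integral_cube(1)[OF continuous_bump R])
  have "(\<integral>y. bump a b y \<partial>lborel) \<noteq> 0"
  proof
    assume "(\<integral>y. bump a b y \<partial>lborel) = 0"
    then have "AE y in lborel. bump a b y = 0"
      using integral_nonneg_eq_0_iff_AE[OF i] bump_nonneg by auto
    then have "AE y in lborel. y \<notin> box a b"
      by eventually_elim (metis bump_pos_iff less_irrefl)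
    then have "emeasure lborel (box a b) = 0"
      by (subst (asm) AE_iff_measurable[OF _ refl]) auto
    moreover have "\<forall>i\<in>Basis. a \<bullet> i < b \<bullet> i" using assms by (simp add: box_ne_empty(2))
    then have "emeasure lborel (box a b) = (\<Prod>i\<in>Basis. (b - a) \<bullet> i)" "(\<Prod>i\<in>Basis. (b - a) \<bullet> i) > 0"
      by (auto intro!: prod_pos simp: emeasure_lborel_box inner_diff_left less_imp_le)
    ultimately show False using ennreal_eq_0_iff by (metis not_le)
  qed
  moreover have "0 \<le> (\<integral>y. bump a b y \<partial>lborel)"
    by (intro integral_nonneg_AE) (simp add: bump_nonneg)
  ultimately show ?thesis by linarith
qed

lemma mollifier_props:
  fixes x :: "real^'n"
  assumes "e > 0"
  shows "0 \<le> mollifier e x" "x \<notin> cube e \<Longrightarrow> mollifier e x = 0"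
    "Ck k (mollifier e :: real^'n \<Rightarrow> real)" "(\<integral>y. mollifier e (y::real^'n) \<partial>lborel) = 1"
proof -
  have "vec 0 \<in> box (vec (- e)) (vec e :: real^'n)" using assms unfolding mem_box_cart by simp
  then have ne: "box (vec (- e)) (vec e :: real^'n) \<noteq> {}" by blast
  have pos: "0 < (\<integral>y. bump (vec (- e)) (vec e) (y::real^'n) \<partial>lborel)"
    by (rule bump_integral_pos[OF ne])
  show "0 \<le> mollifier e x" using pos by (simp add: mollifier_def bump_nonneg)
  show "x \<notin> cube e \<Longrightarrow> mollifier e x = 0" by (simp add: mollifier_def bump_outside_cube)
  show "(\<integral>y. mollifier e (y::real^'n) \<partial>lborel) = 1"
    using pos by (simp add: mollifier_def)
  have "Ck k (\<lambda>x::real^'n. bump (vec (- e)) (vec e) x * inverse (\<integral>y. bump (vec (- e)) (vec e) (y::real^'n) \<partial>lborel))"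
    by (intro Ck_mult Ck_bump Ck_const)
  then show "Ck k (mollifier e :: real^'n \<Rightarrow> real)"
    by (simp add: mollifier_def[abs_def] divide_inverse)
qed

text \<open>
  The mollifier is a probability density on a cube of side \<open>2 e\<close>, so that the convolution is an average of \<open>f\<close> over
  points near \<open>x\<close>: it inherits bounds on \<open>f\<close> and bounds on the oscillation of \<open>f\<close> near \<open>x\<close>.
\<close>

lemma convolve_mollifier:
  fixes f :: "real^'n \<Rightarrow> real"
  assumes f: "continuous_on UNIV f" "\<And>x. x \<notin> cube R \<Longrightarrow> f x = 0" and e: "0 < e" "e \<le> 1"
  shows "(\<And>y. \<bar>f y\<bar> \<le> B) \<Longrightarrow> \<bar>convolve R f (mollifier e) x\<bar> \<le> B"
    and "x \<notin> cube (R + 1) \<Longrightarrow> convolve R f (mollifier e) x = 0"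
    and "(\<And>y. x - y \<in> cube e \<Longrightarrow> \<bar>f y - f x\<bar> \<le> d) \<Longrightarrow> \<bar>convolve R f (mollifier e) x - f x\<bar> \<le> d"
proof -
  let ?m = "mollifier e :: real^'n \<Rightarrow> real"
  note m = mollifier_props[OF e(1)]
  have cm: "continuous_on UNIV ?m" using m(3)[of 0] by simp
  have cm': "continuous_on UNIV (\<lambda>y. ?m (x - y))"
    by (rule continuous_on_compose2[OF cm]) (auto intro!: continuous_intros)
  have c: "continuous_on UNIV (\<lambda>y. f y * ?m (x - y))" by (intro continuous_intros f cm')
  have z: "f y * ?m (x - y) = 0" if "y \<notin> cube R" for y using f(2)[OF that] by simp
  have eq: "convolve R f ?m x = (\<integral>y. f y * ?m (x - y) \<partial>lborel)"
    unfolding convolve_def by (rule integral_cube(2)[OF c z])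
  have i: "integrable lborel (\<lambda>y. f y * ?m (x - y))" by (rule integral_cube(1)[OF c z])
  have one: "(\<integral>y. ?m (x - y) \<partial>lborel) = 1"
    using lborel_integral_reflect[of ?m x] m(4) borel_measurable_continuous_onI[OF cm] by simp
  then have im: "integrable lborel (\<lambda>y. ?m (x - y))"
    using not_integrable_integral_eq by fastforce
  show "\<bar>convolve R f ?m x\<bar> \<le> B" if B: "\<And>y. \<bar>f y\<bar> \<le> B"
  proof -
    have "\<bar>convolve R f ?m x\<bar> \<le> (\<integral>y. \<bar>f y * ?m (x - y)\<bar> \<partial>lborel)"
      unfolding eq by (rule integral_abs_bound)
    also have "\<dots> \<le> (\<integral>y. B * ?m (x - y) \<partial>lborel)"
    proof (rule integral_mono)
      fix y
      show "\<bar>f y * ?m (x - y)\<bar> \<le> B * ?m (x - y)"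
        using mult_right_mono[OF B[of y] m(1)[of "x - y"]] m(1)[of "x - y"] by (simp add: abs_mult)
    qed (use i im in \<open>auto simp del: abs_mult simp: \<close>)
    finally show ?thesis using one by simp
  qed
  show "convolve R f ?m x = 0" if "x \<notin> cube (R + 1)"
  proof -
    have "f y * ?m (x - y) = 0" for y
    proof (rule ccontr)
      assume "f y * ?m (x - y) \<noteq> 0"
      then have "y \<in> cube R" "x - y \<in> cube e" using f(2)[of y] m(2)[of "x - y"] by auto
      then have j: "\<bar>y $ j\<bar> \<le> R \<and> \<bar>x $ j - y $ j\<bar> \<le> e" for j by (auto simp: mem_cube)
      have "\<bar>x $ j\<bar> \<le> R + 1" for j using e(2) j[of j] by linarith
      with that show False by (auto simp: mem_cube)
    qed
    then have "(\<lambda>y. f y * ?m (x - y)) = (\<lambda>y. 0)" by auto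
    then show ?thesis unfolding eq by simp
  qed
  show "\<bar>convolve R f ?m x - f x\<bar> \<le> d" if d: "\<And>y. x - y \<in> cube e \<Longrightarrow> \<bar>f y - f x\<bar> \<le> d"
  proof -
    have "convolve R f ?m x - f x = (\<integral>y. f y * ?m (x - y) \<partial>lborel) - (\<integral>y. f x * ?m (x - y) \<partial>lborel)"
      using one eq by simp
    also have "\<dots> = (\<integral>y. f y * ?m (x - y) - f x * ?m (x - y) \<partial>lborel)"
      by (rule Bochner_Integration.integral_diff[symmetric]) (use i im in auto)
    finally have "\<bar>convolve R f ?m x - f x\<bar> \<le> (\<integral>y. \<bar>f y * ?m (x - y) - f x * ?m (x - y)\<bar> \<partial>lborel)"
      using integral_abs_bound by simp
    also have "\<dots> \<le> (\<integral>y. d * ?m (x - y) \<partial>lborel)"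
    proof (rule integral_mono)
      fix y
      show "\<bar>f y * ?m (x - y) - f x * ?m (x - y)\<bar> \<le> d * ?m (x - y)"
      proof (cases "x - y \<in> cube e")
        case True
        then have "\<bar>f y - f x\<bar> * ?m (x - y) \<le> d * ?m (x - y)"
          using d m(1) by (intro mult_right_mono) auto
        then show ?thesis using m(1)[of "x - y"] by (simp add: left_diff_distrib[symmetric] abs_mult)
      qed (simp add: m(2))
    qed (use i im in auto)
    finally show ?thesis using one by simp
  qed
qed

lemma convolve_mollifier_tendsto:
  fixes f :: "real^'n \<Rightarrow> real"
  assumes f: "continuous_on UNIV f" "\<And>x. x \<notin> cube R \<Longrightarrow> f x = 0"
  shows "(\<lambda>k. convolve R f (mollifier (inverse (real (Suc k)))) x) \<longlonglongrightarrow> f x"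
proof (rule LIMSEQ_I)
  fix r :: real assume r: "0 < r"
  have "isCont f x" using f(1) by (simp add: continuous_on_eq_continuous_at)
  then obtain d where d: "d > 0" "\<And>y. dist y x < d \<Longrightarrow> dist (f y) (f x) < r / 2"
    using r unfolding continuous_at_eps_delta by (meson half_gt_zero)
  have "(\<lambda>k. real CARD('n) * inverse (real (Suc k))) \<longlonglongrightarrow> real CARD('n) * 0"
    by (intro tendsto_intros LIMSEQ_inverse_real_of_nat)
  then have "eventually (\<lambda>k. real CARD('n) * inverse (real (Suc k)) < d) sequentially"
    using d(1) by (intro order_tendstoD(2)) auto
  then obtain N where N: "\<And>k. k \<ge> N \<Longrightarrow> real CARD('n) * inverse (real (Suc k)) < d"
    by (auto simp: eventually_sequentially)
  have "norm (convolve R f (mollifier (inverse (real (Suc k)))) x - f x) < r" if k: "k \<ge> N" for k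
  proof -
    let ?e = "inverse (real (Suc k))"
    have "\<bar>convolve R f (mollifier ?e) x - f x\<bar> \<le> r / 2"
    proof (rule convolve_mollifier(3)[OF f])
      fix y assume "x - y \<in> cube ?e"
      then have "norm (x - y) \<le> (\<Sum>i\<in>(UNIV::'n set). ?e)"
        by (intro order_trans[OF norm_le_l1_cart] sum_mono) (auto simp: mem_cube)
      also have "\<dots> < d" using N[OF k] by simp
      finally have "dist y x < d" by (simp add: dist_norm norm_minus_commute)
      from d(2)[OF this] show "\<bar>f y - f x\<bar> \<le> r / 2" by (simp add: dist_real_def)
    qed (auto simp: field_simps)
    then show ?thesis using r by simp
  qed
  then show "\<exists>no. \<forall>k\<ge>no. norm (convolve R f (mollifier (inverse (real (Suc k)))) x - f x) < r"
    by blast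
qed

text \<open>
  The mollified functions are smooth, and integration by parts shows that their partial derivatives are the
  mollified partial derivatives of \<open>v\<close>. Hence values and gradients converge pointwise, and both stay
  bounded with supports in a fixed cube, which is what dominated convergence asks for.
\<close>

lemma C1_c_smooth_approximation:
  fixes v :: "real^'n \<Rightarrow> real"
  assumes v: "v \<in> C1_c"
  obtains \<phi> R B where "\<And>k::nat. \<phi> k \<in> Cinf_c" "R > 0"
    "\<And>k x. x \<notin> cube R \<Longrightarrow> \<phi> k x = 0" "\<And>k x. x \<notin> cube R \<Longrightarrow> grad (\<phi> k) x = 0"
    "\<And>k x. \<bar>\<phi> k x\<bar> \<le> B" "\<And>k x. norm (grad (\<phi> k) x) \<le> B"
    "\<And>x. (\<lambda>k. \<phi> k x) \<longlonglongrightarrow> v x" "\<And>x. (\<lambda>k. grad (\<phi> k) x) \<longlonglongrightarrow> grad v x"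
proof -
  obtain R B where R: "R > 0" "B > 0" "\<And>x. x \<notin> cube R \<Longrightarrow> v x = 0"
    "\<And>x. x \<notin> cube R \<Longrightarrow> grad v x = 0" and B: "\<And>x. \<bar>v x\<bar> \<le> B" "\<And>x. norm (grad v x) \<le> B"
    using C1_c_bounds[OF v] by metis
  note cv = C1_c_D(2)[OF v] and cg = C1_c_D(3)[OF v]
  define m where "m k = (mollifier (inverse (real (Suc k))) :: real^'n \<Rightarrow> real)" for k :: nat
  define \<phi> where "\<phi> k = convolve R v (m k)" for k
  have e: "0 < inverse (real (Suc k))" "inverse (real (Suc k)) \<le> 1" for k by (auto simp: field_simps)
  have Ckm: "Ck l (m k)" for k l unfolding m_def by (rule mollifier_props(3)[OF e(1)])
  have out: "\<phi> k x = 0" if "x \<notin> cube (R + 1)" for k x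
    unfolding \<phi>_def m_def by (rule convolve_mollifier(2)[OF cv R(3) e that])
  have smooth: "\<phi> k \<in> Cinf_c" for k
    using Ck_convolve[OF cv Ckm] compactly_supportedI[of "vec (- (R + 1))" "vec (R + 1)" "\<phi> k"] out
    by (auto simp: Cinf_c_def \<phi>_def cube_def simp del: Ck.simps)
  have cgi: "continuous_on UNIV (\<lambda>x. grad v x $ i)" for i by (intro continuous_on_component cg)
  have cgi0: "grad v x $ i = 0" if "x \<notin> cube R" for x i using R(4)[OF that] by simp
  have grad_\<phi>: "grad (\<phi> k) x $ i = convolve R (\<lambda>x. grad v x $ i) (m k) x" for k x i
  proof -
    let ?r = "\<lambda>y. m k (x - y)"
    have mk: "\<And>y. GDERIV (m k) y :> grad (m k) y" "continuous_on UNIV (grad (m k))"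
      using Ckm[of 1 k] unfolding Ck_1_iff by blast+
    have D: "GDERIV ?r y :> - grad (m k) (x - y)" for y
    proof -
      have "(m k has_derivative (\<lambda>h. inner h (grad (m k) (x - y)))) (at (x - y))"
        using mk(1) by (simp add: gderiv_def)
      then have "(?r has_derivative (\<lambda>h. inner (- h) (grad (m k) (x - y)))) (at y)"
        by (rule has_derivative_compose[rotated]) (auto intro!: derivative_eq_intros)
      then show ?thesis by (simp add: gderiv_def)
    qed
    have cr: "continuous_on UNIV (\<lambda>y. - grad (m k) (x - y))"
      by (intro continuous_intros continuous_on_compose2[OF mk(2)]) auto
    note r = Ck_1I[OF D cr]
    have cmi: "continuous_on UNIV (\<lambda>y. grad (m k) (x - y) $ i)"
      by (intro continuous_on_component continuous_on_compose2[OF mk(2)] continuous_intros) auto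
    have "grad (\<phi> k) x $ i = convolve R v (\<lambda>x. grad (m k) x $ i) x"
      unfolding \<phi>_def using grad_eqI[OF gderiv_convolve[OF cv Ckm[of 1 k]], of R x] by simp
    also have "\<dots> = (\<integral>y. v y * grad (m k) (x - y) $ i \<partial>lborel)"
      unfolding convolve_def by (rule integral_cube(2)) (use R in \<open>auto intro!: continuous_intros cv cmi\<close>)
    also have "\<dots> = - (\<integral>y. v y * grad ?r y $ i \<partial>lborel)"
      unfolding r(2) by simp
    also have "\<dots> = (\<integral>y. grad v y $ i * ?r y \<partial>lborel)"
      using integration_by_parts[OF v r(1)] by simp
    also have "\<dots> = convolve R (\<lambda>x. grad v x $ i) (m k) x"
      unfolding convolve_def
      by (rule integral_cube(2)[symmetric])
         (use R in \<open>auto intro!: continuous_intros cgi gderiv_continuous[OF D]\<close>)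
    finally show ?thesis .
  qed
  show ?thesis
  proof (rule that[of \<phi> "R + 1" "CARD('n) * B + B"])
    fix k x
    show "\<phi> k \<in> Cinf_c" by (rule smooth)
    show "\<phi> k x = 0" if "x \<notin> cube (R + 1)" by (rule out[OF that])
    show "grad (\<phi> k) x = 0" if "x \<notin> cube (R + 1)" by (rule grad_eq_0_outside[OF out that])
    have "\<bar>\<phi> k x\<bar> \<le> B"
      unfolding \<phi>_def m_def by (rule convolve_mollifier(1)[OF cv R(3) e B(1)])
    then show "\<bar>\<phi> k x\<bar> \<le> CARD('n) * B + B" using R(2) by (smt (verit) mult_nonneg_nonneg of_nat_0_le_iff)
    have "\<bar>grad (\<phi> k) x $ i\<bar> \<le> B" for i
      unfolding grad_\<phi> m_def
      by (rule convolve_mollifier(1)[OF cgi cgi0 e], assumption)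
         (rule order_trans[OF component_le_norm_cart B(2)])
    then have "norm (grad (\<phi> k) x) \<le> (\<Sum>i\<in>(UNIV::'n set). B)"
      by (intro order_trans[OF norm_le_l1_cart] sum_mono)
    then show "norm (grad (\<phi> k) x) \<le> CARD('n) * B + B" using R(2) by simp
    show "(\<lambda>k. \<phi> k x) \<longlonglongrightarrow> v x"
      unfolding \<phi>_def m_def by (rule convolve_mollifier_tendsto[OF cv R(3)])
    show "(\<lambda>k. grad (\<phi> k) x) \<longlonglongrightarrow> grad v x"
      by (rule vec_tendstoI) (unfold grad_\<phi> m_def, rule convolve_mollifier_tendsto[OF cgi cgi0])
  qed (use R in simp)
qed

section \<open>The monomial weight and its measure\<close>

lemma monomial_weight_nonneg: "0 \<le> monomial_weight A x"
  unfolding monomial_weight_def by (intro prod_nonneg) auto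

lemma monomial_weight_measurable [measurable]:
  fixes A :: "real^'n"
  shows "monomial_weight A \<in> borel_measurable borel"
proof -
  have "(\<lambda>x::real^'n. if A $ i = 0 then 1 else \<bar>x $ i\<bar> powr (A $ i)) \<in> borel_measurable borel" for i
    by (cases "A $ i = 0")
       (auto intro!: measurable_compose[OF borel_measurable_continuous_onI[of "\<lambda>x. x $ i"]] continuous_intros)
  then show ?thesis unfolding monomial_weight_def[abs_def] by (intro borel_measurable_prod)
qed

text \<open>
  The weight grows away from the coordinate hyperplanes. The Sobolev inequality rests on this and on the
  value of the weight at points with equal coordinates, which turns a lower bound for the coordinates into
  one for the weight.
\<close>

lemma monomial_weight_mono:
  assumes "\<And>i. 0 \<le> A $ i" "\<And>i. \<bar>x $ i\<bar> \<le> \<bar>y $ i\<bar>"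
  shows "monomial_weight A x \<le> monomial_weight A y"
  unfolding monomial_weight_def
  by (intro prod_mono) (use assms in \<open>auto intro!: powr_mono2\<close>)

lemma monomial_weight_const:
  assumes "t > 0"
  shows "monomial_weight A (vec t) = t powr (\<Sum>i\<in>UNIV. A $ i)"
proof -
  have "monomial_weight A (vec t) = (\<Prod>i\<in>UNIV. t powr (A $ i))"
    unfolding monomial_weight_def using assms by (intro prod.cong) auto
  also have "\<dots> = t powr (\<Sum>i\<in>UNIV. A $ i)"
    using assms by (simp add: powr_sum)
  finally show ?thesis .
qed

lemma monomial_weight_pos:
  assumes "\<And>i. x $ i \<noteq> 0"
  shows "0 < monomial_weight A x"
  unfolding monomial_weight_def by (intro prod_pos) (use assms in \<open>auto simp: powr_gt_zero\<close>)

lemma AE_components_nonzero: "AE x in lebesgue. \<forall>i. (x::real^'n) $ i \<noteq> 0"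
proof -
  have "AE x in lebesgue. (x::real^'n) $ i \<noteq> 0" for i
  proof -
    have "{x. x $ i = 0} \<in> null_sets (lebesgue :: (real^'n) measure)"
      using negligible_standard_hyperplane_cart[of i] negligible_iff_null_sets by auto
    then show ?thesis by (rule AE_not_in[THEN eventually_mono]) auto
  qed
  then show ?thesis by (simp add: AE_all_countable)
qed

lemma sets_monomial_measure [measurable_cong]: "sets (monomial_measure A) = sets lebesgue"
  by (simp add: monomial_measure_def)

lemma space_monomial_measure [simp]: "space (monomial_measure A) = UNIV"
  by (simp add: monomial_measure_def)

lemma borel_imp_lebesgue_measurable:
  "f \<in> borel_measurable borel \<Longrightarrow> f \<in> borel_measurable lebesgue"
  by (rule measurable_completion) simp

lemma borel_imp_monomial_measurable:
  "f \<in> borel_measurable borel \<Longrightarrow> f \<in> borel_measurable (monomial_measure A)"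
  by (subst measurable_cong_sets[OF sets_monomial_measure refl]) (rule borel_imp_lebesgue_measurable)

lemma cube_monomial_sets: "cube R \<in> sets (monomial_measure A)"
  unfolding sets_monomial_measure
  by (intro sets_completionI_sets) (simp add: borel_closed closed_cube)

text \<open>
  The weight is positive off the coordinate hyperplanes, so that the weighted measure and Lebesgue measure
  have the same null sets.
\<close>

lemma AE_monomial_measure:
  fixes A :: "real^'n"
  shows "(AE x in monomial_measure A. P x) \<longleftrightarrow> (AE x in lebesgue. P x)"
proof -
  have "(\<lambda>x. ennreal (monomial_weight A x)) \<in> borel_measurable lebesgue"
    by (intro borel_imp_lebesgue_measurable) measurable
  then have "(AE x in monomial_measure A. P x) \<longleftrightarrow> (AE x in lebesgue. 0 < ennreal (monomial_weight A x) \<longrightarrow> P x)"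
    unfolding monomial_measure_def by (rule AE_density)
  also have "\<dots> \<longleftrightarrow> (AE x in lebesgue. P x)"
  proof
    assume "AE x in lebesgue. 0 < ennreal (monomial_weight A x) \<longrightarrow> P x"
    with AE_components_nonzero show "AE x in lebesgue. P x"
      by eventually_elim (use monomial_weight_pos in auto)
  qed auto
  finally show ?thesis .
qed

lemma nn_integral_monomial_measure_lebesgue:
  assumes "f \<in> borel_measurable lebesgue"
  shows "(\<integral>\<^sup>+x. f x \<partial>monomial_measure A) = (\<integral>\<^sup>+x. ennreal (monomial_weight A x) * f x \<partial>lebesgue)"
  unfolding monomial_measure_def
  by (rule nn_integral_density) (use assms in \<open>auto intro!: borel_imp_lebesgue_measurable\<close>)

lemma nn_integral_monomial_measure:
  fixes f :: "real^'n \<Rightarrow> ennreal"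
  assumes "f \<in> borel_measurable borel"
  shows "(\<integral>\<^sup>+x. f x \<partial>monomial_measure A) = (\<integral>\<^sup>+x. ennreal (monomial_weight A x) * f x \<partial>lborel)"
  using nn_integral_monomial_measure_lebesgue[OF borel_imp_lebesgue_measurable[OF assms]]
  by (simp add: nn_integral_completion)

lemma emeasure_monomial_measure:
  fixes S :: "(real^'n) set"
  assumes [measurable]: "S \<in> sets borel"
  shows "emeasure (monomial_measure A) S = (\<integral>\<^sup>+x. ennreal (monomial_weight A x) * indicator S x \<partial>lborel)"
proof -
  have "S \<in> sets (monomial_measure A)"
    using assms by (simp add: sets_monomial_measure sets_completionI_sets)
  then have "emeasure (monomial_measure A) S = (\<integral>\<^sup>+x. indicator S x \<partial>monomial_measure A)"
    by simp
  also have "\<dots> = (\<integral>\<^sup>+x. ennreal (monomial_weight A x) * indicator S x \<partial>lborel)"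
    by (rule nn_integral_monomial_measure) simp
  finally show ?thesis .
qed

lemma emeasure_monomial_measure_cube:
  fixes A :: "real^'n"
  assumes A: "\<And>i. 0 \<le> A $ i" and R: "R > 0"
  shows "emeasure (monomial_measure A) (cube R) < \<infinity>"
proof -
  have fin: "emeasure lborel (cube R :: (real^'n) set) < \<infinity>"
    by (intro emeasure_compact_finite compact_cube)
  have "emeasure (monomial_measure A) (cube R)
      = (\<integral>\<^sup>+x. ennreal (monomial_weight A x) * indicator (cube R) x \<partial>lborel)"
    by (rule emeasure_monomial_measure) (simp add: borel_closed closed_cube)
  also have "\<dots> \<le> (\<integral>\<^sup>+x. ennreal (monomial_weight A (vec R)) * indicator (cube R) (x::real^'n) \<partial>lborel)"
  proof (rule nn_integral_mono)
    fix x :: "real^'n"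
    have "monomial_weight A x \<le> monomial_weight A (vec R)" if "x \<in> cube R"
      using that R by (intro monomial_weight_mono A) (auto simp: mem_cube)
    then show "ennreal (monomial_weight A x) * indicator (cube R) x
        \<le> ennreal (monomial_weight A (vec R)) * indicator (cube R) x"
      by (auto simp: indicator_def intro: ennreal_leI)
  qed
  also have "\<dots> = ennreal (monomial_weight A (vec R)) * emeasure lborel (cube R :: (real^'n) set)"
    by (rule nn_integral_cmult_indicator) (simp add: borel_closed closed_cube)
  also have "\<dots> < \<infinity>"
    using fin by (simp add: ennreal_mult_less_top)
  finally show ?thesis .
qed

section \<open>Lebesgue norms\<close>

text \<open>
  Bounds on norms are translated into bounds on integrals of powers. In this form all the passages to the
  limit below are statements about integrals.
\<close>

lemma lp_norm_le_iff:
  assumes "p > 0" "K \<ge> 0"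
  shows "lp_norm M p f \<le> ennreal K \<longleftrightarrow> (\<integral>\<^sup>+x. ennreal (\<bar>f x\<bar> powr p) \<partial>M) \<le> ennreal (K powr p)"
proof (cases "(\<integral>\<^sup>+x. ennreal (\<bar>f x\<bar> powr p) \<partial>M)")
  case (real r)
  have "r powr (1 / p) \<le> K \<longleftrightarrow> r \<le> K powr p"
  proof
    assume "r powr (1 / p) \<le> K"
    then have "(r powr (1 / p)) powr p \<le> K powr p" using assms by (intro powr_mono2) auto
    then show "r \<le> K powr p" using assms real by (simp add: powr_powr)
  next
    assume "r \<le> K powr p"
    then have "r powr (1 / p) \<le> (K powr p) powr (1 / p)" using assms real by (intro powr_mono2) auto
    then show "r powr (1 / p) \<le> K" using assms by (simp add: powr_powr)
  qed
  then show ?thesis using assms real by (simp add: lp_norm_def Let_def)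
next
  case top
  then show ?thesis by (simp add: lp_norm_def top_unique)
qed

lemma lp_norm_eq_top_iff:
  "lp_norm M p f = \<infinity> \<longleftrightarrow> (\<integral>\<^sup>+x. ennreal (\<bar>f x\<bar> powr p) \<partial>M) = \<infinity>"
  by (simp add: lp_norm_def Let_def)

lemma lp_norm_eq_0_iff:
  assumes "p > 0"
  shows "lp_norm M p f = 0 \<longleftrightarrow> (\<integral>\<^sup>+x. ennreal (\<bar>f x\<bar> powr p) \<partial>M) = 0"
  using lp_norm_le_iff[OF assms, of 0 M f] by simp

lemma lp_norm_cong_AE:
  assumes "AE x in M. f x = g x"
  shows "lp_norm M p f = lp_norm M p g"
proof -
  have "(\<integral>\<^sup>+x. ennreal (\<bar>f x\<bar> powr p) \<partial>M) = (\<integral>\<^sup>+x. ennreal (\<bar>g x\<bar> powr p) \<partial>M)"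
    by (rule nn_integral_cong_AE) (use assms in \<open>eventually_elim, simp\<close>)
  then show ?thesis by (simp add: lp_norm_def)
qed

lemma lp_norm_real:
  assumes "(\<integral>\<^sup>+x. ennreal (\<bar>f x\<bar> powr p) \<partial>M) = ennreal r" "r \<ge> 0"
  shows "lp_norm M p f = ennreal (r powr (1 / p))"
  using assms by (simp add: lp_norm_def)

lemma lp_norm_Fatou:
  assumes q: "q > 0" and K: "K \<ge> 0"
    and m: "\<And>n. v n \<in> borel_measurable M"
    and lim: "AE x in M. (\<lambda>n. v n x) \<longlonglongrightarrow> u x"
    and le: "eventually (\<lambda>n. lp_norm M q (v n) \<le> ennreal K) sequentially"
  shows "lp_norm M q u \<le> ennreal K"
proof -
  have "(\<integral>\<^sup>+x. ennreal (\<bar>u x\<bar> powr q) \<partial>M) = (\<integral>\<^sup>+x. liminf (\<lambda>n. ennreal (\<bar>v n x\<bar> powr q)) \<partial>M)"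
  proof (rule nn_integral_cong_AE, use lim in eventually_elim)
    fix x assume "(\<lambda>n. v n x) \<longlonglongrightarrow> u x"
    then have "(\<lambda>n. ennreal (\<bar>v n x\<bar> powr q)) \<longlonglongrightarrow> ennreal (\<bar>u x\<bar> powr q)"
      using q by (intro tendsto_ennrealI tendsto_powr2 tendsto_rabs tendsto_const) auto
    then show "ennreal (\<bar>u x\<bar> powr q) = liminf (\<lambda>n. ennreal (\<bar>v n x\<bar> powr q))"
      using lim_imp_Liminf by (metis sequentially_bot)
  qed
  also have "\<dots> \<le> liminf (\<lambda>n. \<integral>\<^sup>+x. ennreal (\<bar>v n x\<bar> powr q) \<partial>M)"
    by (rule nn_integral_liminf) (use m in measurable)
  also have "\<dots> \<le> ennreal (K powr q)"
  proof (rule Liminf_le)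
    show "eventually (\<lambda>n. (\<integral>\<^sup>+x. ennreal (\<bar>v n x\<bar> powr q) \<partial>M) \<le> ennreal (K powr q)) sequentially"
      using le by eventually_elim (simp add: lp_norm_le_iff[OF q K])
  qed simp
  finally show ?thesis by (simp add: lp_norm_le_iff[OF q K])
qed

text \<open>
  An inequality between a norm of \<open>v n\<close> and a norm of \<open>G n\<close> survives the limit if the left side
  is lower semicontinuous, by Fatou's lemma and almost everywhere convergence, and the right side is
  upper semicontinuous, which is the last hypothesis. It is used twice: to pass from smooth to
  continuously differentiable functions, and from these to their closure.
\<close>

lemma lp_norm_limit_inequality:
  fixes c :: real
  assumes q: "q > 0" and p: "p > 0" and c: "c \<ge> 0"
    and m: "\<And>n. v n \<in> borel_measurable M"
    and lim: "AE x in M. (\<lambda>n. v n x) \<longlonglongrightarrow> u x"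
    and le: "\<And>n. lp_norm M q (v n) \<le> ennreal c * lp_norm M p (G n)"
    and fin: "lp_norm M p g < \<infinity>"
    and limsup: "\<And>L. lp_norm M p g < ennreal L \<Longrightarrow> 0 < L \<Longrightarrow>
        eventually (\<lambda>n. lp_norm M p (G n) \<le> ennreal L) sequentially"
  shows "lp_norm M q u \<le> ennreal c * lp_norm M p g"
proof -
  obtain l where l: "l \<ge> 0" "lp_norm M p g = ennreal l"
    using fin by (cases "lp_norm M p g") auto
  have *: "lp_norm M q u \<le> ennreal (c * L)" if "L > l" for L
  proof (rule lp_norm_Fatou[OF q _ m lim])
    have "eventually (\<lambda>n. lp_norm M p (G n) \<le> ennreal L) sequentially"
      using l that by (intro limsup) (auto simp: ennreal_less_iff)
    then show "eventually (\<lambda>n. lp_norm M q (v n) \<le> ennreal (c * L)) sequentially"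
    proof eventually_elim
      case (elim n)
      have "lp_norm M q (v n) \<le> ennreal c * ennreal L"
        using le[of n] mult_left_mono[OF elim, of "ennreal c"] by simp
      then show ?case using c by (simp add: ennreal_mult')
    qed
  qed (use c l that in auto)
  then have "lp_norm M q u \<noteq> \<infinity>" using l by (metis ennreal_less_top gt_ex infinity_ennreal_def leD)
  then obtain k where k: "k \<ge> 0" "lp_norm M q u = ennreal k" by (cases "lp_norm M q u") auto
  have "k \<le> c * L" if "L > l" for L
    using *[OF that] k c l that by (simp add: ennreal_le_iff)
  then have "eventually (\<lambda>L. k \<le> c * L) (at_right l)"
    by (auto simp: eventually_at_filter)
  moreover have "((\<lambda>L. c * L) \<longlongrightarrow> c * l) (at_right l)" by (intro tendsto_intros)
  ultimately have "k \<le> c * l"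
    by (intro tendsto_lowerbound[of "\<lambda>L. c * L" _ "at_right l"]) auto
  then show ?thesis using k l c by (simp add: ennreal_mult'[symmetric] ennreal_leI)
qed

text \<open>
  Write \<open>a + b\<close> as the convex combination of \<open>a / (1 - \<theta>)\<close> and \<open>b / \<theta>\<close> with the weights
  \<open>1 - \<theta>\<close> and \<open>\<theta>\<close>, and use the convexity of the power.
\<close>

lemma powr_add_le_convex:
  fixes a b p \<theta> :: real
  assumes "p \<ge> 1" "0 < \<theta>" "\<theta> < 1" "a \<ge> 0" "b \<ge> 0"
  shows "(a + b) powr p \<le> (1 - \<theta>) powr (1 - p) * a powr p + \<theta> powr (1 - p) * b powr p"
proof -
  have ge1: "s powr (1 - p) \<ge> 1" if "0 < s" "s < 1" for s :: real
    using powr_mono'[of "1 - p" 0 s] that assms by simp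
  consider "a = 0" | "b = 0" | "a > 0" "b > 0" using assms by linarith
  then show ?thesis
  proof cases
    case 1
    then show ?thesis using mult_right_mono[OF ge1[of \<theta>], of "b powr p"] assms by simp
  next
    case 2
    then show ?thesis using mult_right_mono[OF ge1[of "1 - \<theta>"], of "a powr p"] assms by simp
  next
    case 3
    have "(1 - \<theta>) * (a / (1 - \<theta>)) + \<theta> * (b / \<theta>) = a + b" using assms by simp
    moreover have "((1 - \<theta>) * (a / (1 - \<theta>)) + \<theta> * (b / \<theta>)) powr p
        \<le> (1 - \<theta>) * (a / (1 - \<theta>)) powr p + \<theta> * (b / \<theta>) powr p"
      using convex_onD[OF powr_convex[OF assms(1)], of \<theta> "a / (1 - \<theta>)" "b / \<theta>"] assms 3
      by simp
    moreover have "s * (y / s) powr p = s powr (1 - p) * y powr p" if "s > 0" "y \<ge> 0" for s y :: real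
      using that by (simp add: powr_divide powr_diff)
    ultimately show ?thesis using assms 3 by simp
  qed
qed

text \<open>
  This plays the role of the triangle inequality for the norm. Integrate the previous inequality: the
  norm of \<open>d n\<close> tends to \<open>0\<close>, so that for every \<open>\<theta>\<close> the integrals of the powers of \<open>a n\<close>
  are eventually bounded by about \<open>(1 - \<theta>) powr (1 - p)\<close> times the one for \<open>b\<close>, and
  \<open>\<theta>\<close> may be as small as desired.
\<close>

lemma lp_norm_limsup_of_Lp_convergence:
  assumes p: "p \<ge> 1"
    and m: "\<And>n. a n \<in> borel_measurable M" "b \<in> borel_measurable M"
    and le: "\<And>n x. \<bar>a n x\<bar> \<le> \<bar>b x\<bar> + \<bar>d n x\<bar>" and md: "\<And>n. d n \<in> borel_measurable M"
    and lim: "(\<lambda>n. lp_norm M p (d n)) \<longlonglongrightarrow> 0"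
    and L: "lp_norm M p b < ennreal L" "0 < L"
  shows "eventually (\<lambda>n. lp_norm M p (a n) \<le> ennreal L) sequentially"
proof -
  have p0: "p > 0" using p by simp
  obtain l where l: "l \<ge> 0" "lp_norm M p b = ennreal l" "l < L"
    using L by (cases "lp_norm M p b") (auto simp: ennreal_less_iff)
  have "((\<lambda>\<theta>. (1 - \<theta>) powr (1 - p) * l powr p) \<longlongrightarrow> (1 - 0) powr (1 - p) * l powr p) (at_right 0)"
    by (intro tendsto_intros) auto
  moreover have "l powr p < L powr p" using l p0 by (intro powr_less_mono2) auto
  ultimately have "eventually (\<lambda>\<theta>. (1 - \<theta>) powr (1 - p) * l powr p < L powr p) (at_right 0)"
    by (intro order_tendstoD(2)) auto
  moreover have "eventually (\<lambda>\<theta>::real. 0 < \<theta> \<and> \<theta> < 1) (at_right 0)"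
    using eventually_at_right_less[of 0] eventually_at_right_real[of 0 1] by (auto elim: eventually_elim2)
  ultimately obtain \<theta> where \<theta>: "(1 - \<theta>) powr (1 - p) * l powr p < L powr p" "0 < \<theta>" "\<theta> < 1"
    using eventually_happens'[OF trivial_limit_at_right_real eventually_conj] by blast
  \<comment> \<open>The room left for the integral of the powers of the functions \<open>d n\<close>, and the bound on their norm that keeps it small enough.\<close>
  define e where "e = L powr p - (1 - \<theta>) powr (1 - p) * l powr p"
  define k where "k = (e / \<theta> powr (1 - p)) powr (1 / p)"
  have e: "e > 0" using \<theta> by (simp add: e_def)
  then have k: "k > 0" "\<theta> powr (1 - p) * k powr p = e"
    using \<theta> p0 by (auto simp: k_def powr_powr)
  have "eventually (\<lambda>n. lp_norm M p (d n) < ennreal k) sequentially"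
    using lim k(1) by (intro order_tendstoD(2)) auto
  then show ?thesis
  proof eventually_elim
    case (elim n)
    have d: "(\<integral>\<^sup>+x. ennreal (\<bar>d n x\<bar> powr p) \<partial>M) \<le> ennreal (k powr p)"
      using elim k(1) lp_norm_le_iff[OF p0, of k M "d n"] by (simp add: less_imp_le)
    have b: "(\<integral>\<^sup>+x. ennreal (\<bar>b x\<bar> powr p) \<partial>M) \<le> ennreal (l powr p)"
      using l lp_norm_le_iff[OF p0, of l M b] by simp
    have "(\<integral>\<^sup>+x. ennreal (\<bar>a n x\<bar> powr p) \<partial>M)
        \<le> (\<integral>\<^sup>+x. ennreal ((1 - \<theta>) powr (1 - p)) * ennreal (\<bar>b x\<bar> powr p)
              + ennreal (\<theta> powr (1 - p)) * ennreal (\<bar>d n x\<bar> powr p) \<partial>M)"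
    proof (rule nn_integral_mono)
      fix x
      have "\<bar>a n x\<bar> powr p \<le> (\<bar>b x\<bar> + \<bar>d n x\<bar>) powr p"
        using le[of n x] p0 by (intro powr_mono2) auto
      also have "\<dots> \<le> (1 - \<theta>) powr (1 - p) * \<bar>b x\<bar> powr p + \<theta> powr (1 - p) * \<bar>d n x\<bar> powr p"
        using \<theta> p by (intro powr_add_le_convex) auto
      finally show "ennreal (\<bar>a n x\<bar> powr p) \<le> ennreal ((1 - \<theta>) powr (1 - p)) * ennreal (\<bar>b x\<bar> powr p)
              + ennreal (\<theta> powr (1 - p)) * ennreal (\<bar>d n x\<bar> powr p)"
        by (simp add: ennreal_mult'[symmetric] ennreal_plus[symmetric] ennreal_leI del: ennreal_plus)
    qed
    also have "\<dots> = ennreal ((1 - \<theta>) powr (1 - p)) * (\<integral>\<^sup>+x. ennreal (\<bar>b x\<bar> powr p) \<partial>M)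
        + ennreal (\<theta> powr (1 - p)) * (\<integral>\<^sup>+x. ennreal (\<bar>d n x\<bar> powr p) \<partial>M)"
      using m(2) md[of n] by (simp add: nn_integral_add nn_integral_cmult)
    also have "\<dots> \<le> ennreal ((1 - \<theta>) powr (1 - p)) * ennreal (l powr p)
        + ennreal (\<theta> powr (1 - p)) * ennreal (k powr p)"
      by (intro add_mono mult_left_mono b d) auto
    also have "\<dots> = ennreal (L powr p)"
      using k(2) e \<theta>
      by (simp add: ennreal_mult'[symmetric] e_def ennreal_plus[symmetric] del: ennreal_plus)
    finally show ?case using L lp_norm_le_iff[OF p0, of L M "a n"] by simp
  qed
qed

lemma lp_norm_finite:
  fixes A :: "real^'n"
  assumes A: "\<And>i. 0 \<le> A $ i" and p: "p > 0" and R: "R > 0"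
    and f: "\<And>x. x \<notin> cube R \<Longrightarrow> f x = 0" "\<And>x. \<bar>f x\<bar> \<le> B"
  shows "lp_norm (monomial_measure A) p f < \<infinity>" "(\<integral>\<^sup>+x. ennreal (\<bar>f x\<bar> powr p) \<partial>monomial_measure A) < \<infinity>"
proof -
  have "(\<integral>\<^sup>+x. ennreal (\<bar>f x\<bar> powr p) \<partial>monomial_measure A)
      \<le> (\<integral>\<^sup>+x. ennreal (B powr p) * indicator (cube R) x \<partial>monomial_measure A)"
    by (intro nn_integral_mono) (use f p in \<open>auto simp: indicator_def intro!: ennreal_leI powr_mono2\<close>)
  also have "\<dots> = ennreal (B powr p) * emeasure (monomial_measure A) (cube R)"
    by (rule nn_integral_cmult_indicator[OF cube_monomial_sets])
  also have "\<dots> < \<infinity>"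
    using emeasure_monomial_measure_cube[OF A R] by (simp add: ennreal_mult_less_top)
  finally show I: "(\<integral>\<^sup>+x. ennreal (\<bar>f x\<bar> powr p) \<partial>monomial_measure A) < \<infinity>" .
  then show "lp_norm (monomial_measure A) p f < \<infinity>"
    using lp_norm_eq_top_iff[of "monomial_measure A" p f] by (metis less_top infinity_ennreal_def)
qed

text \<open>
  Dominated convergence for bounded functions supported in a common cube, which has finite measure. The
  exponents may vary with the function as long as they stay bounded.
\<close>

lemma nn_integral_powr_tendsto:
  fixes A :: "real^'n" and f :: "nat \<Rightarrow> real^'n \<Rightarrow> real"
  assumes A: "\<And>i. 0 \<le> A $ i" and R: "R > 0"
    and m: "\<And>n. f n \<in> borel_measurable borel" "g \<in> borel_measurable borel"
    and f: "\<And>n x. x \<notin> cube R \<Longrightarrow> f n x = 0" "\<And>n x. \<bar>f n x\<bar> \<le> B"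
    and lim: "\<And>x. (\<lambda>n. \<bar>f n x\<bar> powr s n) \<longlonglongrightarrow> \<bar>g x\<bar> powr p"
    and s: "\<And>n. 0 \<le> s n" "\<And>n. s n \<le> D"
  shows "(\<lambda>n. \<integral>\<^sup>+x. ennreal (\<bar>f n x\<bar> powr s n) \<partial>monomial_measure A)
    \<longlonglongrightarrow> (\<integral>\<^sup>+x. ennreal (\<bar>g x\<bar> powr p) \<partial>monomial_measure A)"
proof (rule nn_integral_dominated_convergence[where w = "\<lambda>x. ennreal (max 1 B powr D) * indicator (cube R) x"])
  let ?M = "monomial_measure A"
  have powr: "(\<lambda>t::real. ennreal (\<bar>t\<bar> powr r)) \<in> borel_measurable borel" for r by measurable
  show "(\<lambda>x. ennreal (\<bar>f n x\<bar> powr s n)) \<in> borel_measurable ?M" for n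
    by (rule borel_imp_monomial_measurable[OF measurable_compose[OF m(1) powr]])
  show "(\<lambda>x. ennreal (\<bar>g x\<bar> powr p)) \<in> borel_measurable ?M"
    by (rule borel_imp_monomial_measurable[OF measurable_compose[OF m(2) powr]])
  show "(\<lambda>x. ennreal (max 1 B powr D) * indicator (cube R) x) \<in> borel_measurable ?M"
    by (intro borel_measurable_times_ennreal borel_measurable_indicator cube_monomial_sets) auto
  show "(\<integral>\<^sup>+x. ennreal (max 1 B powr D) * indicator (cube R) x \<partial>?M) < \<infinity>"
    using emeasure_monomial_measure_cube[OF A R]
    by (simp add: nn_integral_cmult_indicator cube_monomial_sets ennreal_mult_less_top)
  show "AE x in ?M. (\<lambda>n. ennreal (\<bar>f n x\<bar> powr s n)) \<longlonglongrightarrow> ennreal (\<bar>g x\<bar> powr p)"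
    by (intro AE_I2 tendsto_ennrealI lim)
  show "AE x in ?M. ennreal (\<bar>f n x\<bar> powr s n) \<le> ennreal (max 1 B powr D) * indicator (cube R) x" for n
  proof (rule AE_I2)
    fix x
    have "\<bar>f n x\<bar> powr s n \<le> max 1 B powr s n"
      using f(2)[of n x] s(1)[of n] by (intro powr_mono2) auto
    also have "\<dots> \<le> max 1 B powr D" using s(2)[of n] by (intro powr_mono) auto
    finally show "ennreal (\<bar>f n x\<bar> powr s n) \<le> ennreal (max 1 B powr D) * indicator (cube R) x"
      using f(1)[of x n] by (cases "x \<in> cube R") (auto intro: ennreal_leI)
  qed
qed

section \<open>The weak-type Sobolev inequality with exponent one\<close>

definition orthant :: "'n set \<Rightarrow> (real^'n) set" where
  "orthant S = {x. \<forall>i. if i \<in> S then 0 \<le> x $ i else x $ i \<le> 0}"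

text \<open>
  The directions of the rays that start in the orthant \<open>S\<close>: every coordinate points away from the
  corresponding hyperplane at a speed between \<open>1\<close> and \<open>2\<close>. A unit cube is chosen for its measure, \<open>1\<close>,
  so that integrals over it are averages.
\<close>

definition sector :: "'n::finite set \<Rightarrow> (real^'n) set" where
  "sector S = cbox (\<chi> i. if i \<in> S then 1 else - 2) (\<chi> i. if i \<in> S then 2 else - 1)"

lemma mem_sector: "z \<in> sector S \<longleftrightarrow> (\<forall>i. if i \<in> S then 1 \<le> z $ i \<and> z $ i \<le> 2 else - 2 \<le> z $ i \<and> z $ i \<le> - 1)"
  unfolding sector_def mem_box_cart by (intro iff_allI) simp

lemma orthant_borel [measurable]: "orthant S \<in> sets borel" for S :: "'n::finite set"
proof -
  have "orthant S = (\<Inter>i. if i \<in> S then {x. 0 \<le> x $ i} else {x. x $ i \<le> 0})"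
    by (auto simp: orthant_def split: if_splits)
  moreover have "closed \<dots>"
    by (intro closed_INT) (auto intro!: closed_Collect_le continuous_intros)
  ultimately show ?thesis by (simp add: borel_closed)
qed

lemma orthant_cover: "\<exists>S. x \<in> orthant S"
  by (rule exI[of _ "{i. 0 \<le> x $ i}"]) (auto simp: orthant_def)

lemma sector_borel [measurable]: "sector S \<in> sets borel"
  by (simp add: sector_def)

lemma emeasure_sector: "emeasure lborel (sector S :: (real^'n) set) = 1"
proof -
  have ne: "(\<chi> i. if i \<in> S then 1 else - 1) \<in> (sector S :: (real^'n) set)"
    by (auto simp: mem_sector)
  have "measure lborel (sector S :: (real^'n) set) = 1"
    using ne unfolding sector_def
    by (subst content_cbox_cart) (auto intro!: prod.neutral)
  then show ?thesis
    using emeasure_eq_ennreal_measure[of lborel "sector S :: (real^'n) set"]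
      emeasure_compact_finite[of "sector S :: (real^'n) set"]
    by (auto simp: sector_def)
qed

text \<open>
  Along such a ray no coordinate decreases in absolute value, and at the time \<open>t\<close> each of them is at
  least \<open>t\<close>. The first fact bounds the weight from below by its value at the starting point, the second
  by a power of \<open>t\<close>.
\<close>

lemma orthant_sector:
  assumes "x \<in> orthant S" "z \<in> sector S" "t \<ge> 0"
  shows "\<bar>x $ i\<bar> \<le> \<bar>(x + t *\<^sub>R z) $ i\<bar>" "t \<le> \<bar>(x + t *\<^sub>R z) $ i\<bar>"
proof -
  have "\<bar>x $ i\<bar> + t \<le> \<bar>x $ i + t * z $ i\<bar>"
  proof (cases "i \<in> S")
    case True
    then have "0 \<le> x $ i" "1 \<le> z $ i" using assms by (auto simp: orthant_def mem_sector)
    moreover have "t * 1 \<le> t * z $ i" using \<open>1 \<le> z $ i\<close> assms(3) by (intro mult_left_mono)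
    ultimately show ?thesis using assms(3) by simp
  next
    case False
    then have "x $ i \<le> 0" "z $ i \<le> - 1" using assms by (auto simp: orthant_def mem_sector)
    moreover have "t * z $ i \<le> t * (- 1)" using \<open>z $ i \<le> - 1\<close> assms(3) by (intro mult_left_mono)
    ultimately show ?thesis using assms(3) by simp
  qed
  then show "\<bar>x $ i\<bar> \<le> \<bar>(x + t *\<^sub>R z) $ i\<bar>" "t \<le> \<bar>(x + t *\<^sub>R z) $ i\<bar>"
    using assms(3) by auto
qed

lemma norm_sector: "z \<in> sector S \<Longrightarrow> norm z \<le> 2 * real CARD('n)" for z :: "real^'n"
proof -
  assume z: "z \<in> sector S"
  have "norm z \<le> (\<Sum>i\<in>(UNIV::'n set). 2)"
  proof (intro order_trans[OF norm_le_l1_cart] sum_mono)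
    fix i
    show "\<bar>z $ i\<bar> \<le> 2" using z by (auto simp: mem_sector abs_le_iff split: if_splits dest!: spec[of _ i])
  qed
  then show ?thesis by simp
qed

text \<open>
  The fundamental theorem of calculus along the ray, which eventually leaves the support of \<open>u\<close>. The
  factor is a bound for the speed of the ray.
\<close>

lemma ray_estimate:
  fixes u :: "real^'n \<Rightarrow> real"
  assumes u: "u \<in> C1_c" and z: "z \<in> sector S"
  shows "ennreal \<bar>u x\<bar> \<le> ennreal (2 * CARD('n))
      * (\<integral>\<^sup>+t. ennreal (norm (grad u (x + t *\<^sub>R z))) * indicator {0..} t \<partial>lborel)"
proof -
  let ?g = "\<lambda>t. grad u (x + t *\<^sub>R z)"
  obtain R where R: "R > 0" "\<And>x. x \<notin> cube R \<Longrightarrow> u x = 0" using C1_c_bounds[OF u] by metis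
  define i where "i = (undefined :: 'n)"
  define T where "T = R + \<bar>x $ i\<bar> + 1"
  have T: "T \<ge> 0" using R by (simp add: T_def)
  have zi: "1 \<le> \<bar>z $ i\<bar>" using z by (auto simp: mem_sector split: if_splits dest!: spec[of _ i])
  have "T * 1 \<le> T * \<bar>z $ i\<bar>" using zi T by (intro mult_left_mono)
  then have "T \<le> \<bar>T * z $ i\<bar>" using T by (simp add: abs_mult)
  then have "R < \<bar>(x + T *\<^sub>R z) $ i\<bar>" unfolding T_def by simp
  then have out: "u (x + T *\<^sub>R z) = 0" by (intro R(2)) (auto simp: mem_cube not_le)
  have cg: "continuous_on UNIV (grad u)" by (rule C1_c_D(3)[OF u])
  have cgt: "continuous_on {0..T} (\<lambda>t. ?g t)"
    by (rule continuous_on_compose2[OF cg]) (auto intro!: continuous_intros)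
  have I: "((\<lambda>t. inner z (?g t)) has_integral (u (x + T *\<^sub>R z) - u (x + 0 *\<^sub>R z))) {0..T}"
  proof (rule fundamental_theorem_of_calculus[OF T])
    fix t
    have "(u has_derivative (\<lambda>h. inner h (?g t))) (at (x + t *\<^sub>R z))"
      using C1_c_D(1)[OF u] by (simp add: gderiv_def)
    then have "((\<lambda>t. u (x + t *\<^sub>R z)) has_derivative (\<lambda>s. inner (s *\<^sub>R z) (?g t))) (at t within {0..T})"
      by (rule has_derivative_compose[rotated]) (auto intro!: derivative_eq_intros)
    then show "((\<lambda>t. u (x + t *\<^sub>R z)) has_vector_derivative inner z (?g t)) (at t within {0..T})"
      by (simp add: has_vector_derivative_def)
  qed
  have J: "(\<lambda>t. norm (?g t)) integrable_on {0..T}"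
    by (intro integrable_continuous_interval continuous_intros cgt)
  have "\<bar>u x\<bar> = norm (integral {0..T} (\<lambda>t. inner z (?g t)))"
    using integral_unique[OF I] out by simp
  also have "\<dots> \<le> integral {0..T} (\<lambda>t. 2 * CARD('n) * norm (?g t))"
  proof (rule integral_norm_bound_integral)
    show "(\<lambda>t. inner z (?g t)) integrable_on {0..T}" using I by blast
    show "(\<lambda>t. 2 * CARD('n) * norm (?g t)) integrable_on {0..T}"
      by (intro integrable_on_mult_right J)
    show "norm (inner z (?g t)) \<le> 2 * CARD('n) * norm (?g t)" for t
      using order_trans[OF Cauchy_Schwarz_ineq2 mult_right_mono[OF norm_sector[OF z]]] by simp
  qed
  also have "\<dots> = 2 * CARD('n) * integral {0..T} (\<lambda>t. norm (?g t))"
    by (rule integral_mult_right)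
  finally have "ennreal \<bar>u x\<bar> \<le> ennreal (2 * CARD('n)) * ennreal (integral {0..T} (\<lambda>t. norm (?g t)))"
    by (simp add: ennreal_mult'[symmetric] ennreal_leI)
  also have "ennreal (integral {0..T} (\<lambda>t. norm (?g t)))
      = (\<integral>\<^sup>+t. ennreal (norm (?g t)) * indicator {0..T} t \<partial>lborel)"
    using nn_integral_has_integral_lebesgue'[OF _ integrable_integral[OF J]] by simp
  also have "\<dots> \<le> (\<integral>\<^sup>+t. ennreal (norm (?g t)) * indicator {0..} t \<partial>lborel)"
    by (intro nn_integral_mono) (auto simp: indicator_def)
  finally show ?thesis by (simp add: mult_left_mono)
qed

lemma nn_integral_affine:
  fixes g :: "real^'n \<Rightarrow> ennreal"
  assumes [measurable]: "g \<in> borel_measurable borel" and t: "t > 0"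
  shows "(\<integral>\<^sup>+z. g (x + t *\<^sub>R z) \<partial>lborel) = ennreal (t powr (- CARD('n))) * (\<integral>\<^sup>+z. g z \<partial>lborel)"
proof -
  have "(lborel :: (real^'n) measure) = density (distr lborel borel (\<lambda>y. x + t *\<^sub>R y)) (\<lambda>_. ennreal (\<bar>t\<bar> ^ DIM(real^'n)))"
    by (rule lborel_affine) (use t in simp)
  then have "(\<integral>\<^sup>+z. g z \<partial>lborel) = (\<integral>\<^sup>+z. g z \<partial>density (distr lborel borel (\<lambda>y. x + t *\<^sub>R y)) (\<lambda>_. ennreal (\<bar>t\<bar> ^ DIM(real^'n))))"
    by simp
  also have "\<dots> = ennreal (t ^ CARD('n)) * (\<integral>\<^sup>+z. g (x + t *\<^sub>R z) \<partial>lborel)"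
    using t by (simp add: nn_integral_density nn_integral_distr nn_integral_cmult)
  finally have "ennreal (t powr (- CARD('n))) * (\<integral>\<^sup>+z. g z \<partial>lborel)
      = (ennreal (t powr (- CARD('n))) * ennreal (t ^ CARD('n))) * (\<integral>\<^sup>+z. g (x + t *\<^sub>R z) \<partial>lborel)"
    by (simp add: mult.assoc)
  also have "ennreal (t powr (- CARD('n))) * ennreal (t ^ CARD('n)) = 1"
    using t by (simp add: ennreal_mult'[symmetric] powr_minus powr_realpow)
  finally show ?thesis by simp
qed

lemma nn_integral_translate:
  fixes g :: "real^'n \<Rightarrow> ennreal"
  assumes [measurable]: "g \<in> borel_measurable borel"
  shows "(\<integral>\<^sup>+x. g (x + a) \<partial>lborel) = (\<integral>\<^sup>+x. g x \<partial>lborel)"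
proof -
  have "(\<integral>\<^sup>+x. g x \<partial>lborel) = (\<integral>\<^sup>+x. g x \<partial>distr lborel borel ((+) a))"
    by (simp add: lborel_distr_plus)
  also have "\<dots> = (\<integral>\<^sup>+x. g (a + x) \<partial>lborel)" by (rule nn_integral_distr) auto
  finally show ?thesis by (simp add: add.commute)
qed

lemma nn_integral_powr_tail:
  assumes "D > 1" "r > 0"
  shows "(\<integral>\<^sup>+t. ennreal (t powr (- D)) * indicator {r..} t \<partial>lborel) = ennreal (r powr (1 - D) / (D - 1))"
proof -
  have "((\<lambda>t. - (t powr (1 - D) / (D - 1))) \<longlongrightarrow> - (0 / (D - 1))) at_top"
    using assms by (intro tendsto_intros tendsto_neg_powr filterlim_ident) auto
  then have lim: "((\<lambda>t. - (t powr (1 - D) / (D - 1))) \<longlongrightarrow> 0) at_top" by simp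
  have "(\<integral>\<^sup>+t. ennreal (t powr (- D)) * indicator {r..} t \<partial>lborel) = 0 - (- (r powr (1 - D) / (D - 1)))"
  proof (rule nn_integral_FTC_atLeast[OF _ _ _ lim])
    fix t assume "r \<le> t"
    then have "DERIV (\<lambda>t. t powr (1 - D)) t :> (1 - D) * t powr (1 - D - 1)"
      using assms by (intro has_real_derivative_powr) auto
    moreover have "- ((1 - D) * t powr (1 - D - 1) / (D - 1)) = t powr (- D)"
      using assms by (simp add: divide_simps) (simp add: algebra_simps)
    ultimately     show "DERIV (\<lambda>t. - (t powr (1 - D) / (D - 1))) t :> t powr (- D)"
      using DERIV_minus[OF DERIV_cdivide] by metis
  qed auto
  then show ?thesis by simp
qed

text \<open>
  At the time \<open>t\<close> the weight is at least \<open>t\<close> to the power \<open>\<Sum>A\<close>, so that the weighted integral of \<open>f\<close> controls the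
  unweighted one over the points reached. The substitution \<open>z \<mapsto> x + t z\<close> contributes the remaining
  power of \<open>t\<close>, with exponent minus the dimension.
\<close>

lemma far_estimate:
  fixes A :: "real^'n" and f :: "real^'n \<Rightarrow> real"
  assumes A: "\<And>i. 0 \<le> A $ i" and [measurable]: "f \<in> borel_measurable borel" and f: "\<And>x. 0 \<le> f x"
    and x: "x \<in> orthant S" and t: "t > 0"
  shows "(\<integral>\<^sup>+z. ennreal (f (x + t *\<^sub>R z)) * indicator (sector S) z \<partial>lborel)
      \<le> ennreal (t powr (- hom_dim A)) * (\<integral>\<^sup>+x. ennreal (monomial_weight A x) * ennreal (f x) \<partial>lborel)"
proof -
  let ?a = "\<Sum>i\<in>UNIV. A $ i"
  let ?g = "\<lambda>z. ennreal (monomial_weight A (x + t *\<^sub>R z)) * ennreal (f (x + t *\<^sub>R z))"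
  let ?F = "\<integral>\<^sup>+x. ennreal (monomial_weight A x) * ennreal (f x) \<partial>lborel"
  have "(\<integral>\<^sup>+z. ennreal (f (x + t *\<^sub>R z)) * indicator (sector S) z \<partial>lborel)
      \<le> (\<integral>\<^sup>+z. ennreal (t powr (- ?a)) * (?g z) \<partial>lborel)"
  proof (rule nn_integral_mono)
    fix z
    show "ennreal (f (x + t *\<^sub>R z)) * indicator (sector S) z
      \<le> ennreal (t powr (- ?a)) * (?g z)"
    proof (cases "z \<in> sector S")
      case True
      have "t powr ?a = monomial_weight A (vec t)" using t by (simp add: monomial_weight_const)
      also have "\<dots> \<le> monomial_weight A (x + t *\<^sub>R z)"
        using orthant_sector(2)[OF x True] t by (intro monomial_weight_mono A) auto
      finally have "t powr (- ?a) * t powr ?a \<le> t powr (- ?a) * monomial_weight A (x + t *\<^sub>R z)"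
        by (intro mult_left_mono) auto
      then have "1 \<le> t powr (- ?a) * monomial_weight A (x + t *\<^sub>R z)"
        using t by (simp add: powr_add[symmetric])
      then have "f (x + t *\<^sub>R z) \<le> t powr (- ?a) * monomial_weight A (x + t *\<^sub>R z) * f (x + t *\<^sub>R z)"
        using mult_right_mono[OF _ f] by fastforce
      then show ?thesis using True monomial_weight_nonneg
        by (simp add: ennreal_mult'[symmetric] ennreal_mult''[symmetric] f ennreal_leI mult.assoc)
    qed simp
  qed
  also have "\<dots> = ennreal (t powr (- ?a)) *
      (\<integral>\<^sup>+z. ?g z \<partial>lborel)"
    by (rule nn_integral_cmult) measurable
  also have "(\<integral>\<^sup>+z. ?g z \<partial>lborel)
      = ennreal (t powr (- CARD('n))) * ?F"
    by (rule nn_integral_affine[OF _ t, of "\<lambda>x. ennreal (monomial_weight A x) * ennreal (f x)"]) measurable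
  also have "ennreal (t powr (- ?a)) * (ennreal (t powr (- CARD('n))) * ?F)
      = ennreal (t powr (- hom_dim A)) * ?F"
    by (simp add: mult.assoc[symmetric] ennreal_mult'[symmetric] powr_add[symmetric] hom_dim_def algebra_simps)
  finally show ?thesis .
qed

text \<open>
  The weight at \<open>x\<close> is at most the weight at \<open>x + t z\<close>. After an exchange of the integrals the
  invariance of Lebesgue measure under translation by \<open>t z\<close> gives the weighted integral of \<open>f\<close>, for each \<open>t\<close> and \<open>z\<close>
  separately.
\<close>

lemma near_estimate:
  fixes A :: "real^'n" and f :: "real^'n \<Rightarrow> real"
  assumes A: "\<And>i. 0 \<le> A $ i" and [measurable]: "f \<in> borel_measurable borel" and f: "\<And>x. 0 \<le> f x" and r: "r > 0"
  shows "(\<integral>\<^sup>+x. ennreal (monomial_weight A x) * indicator (orthant S) x *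
      (\<integral>\<^sup>+t. (\<integral>\<^sup>+z. ennreal (f (x + t *\<^sub>R z)) * indicator (sector S) z \<partial>lborel) * indicator {0..r} t \<partial>lborel) \<partial>lborel)
      \<le> ennreal r * (\<integral>\<^sup>+x. ennreal (monomial_weight A x) * ennreal (f x) \<partial>lborel)" (is "?L \<le> _ * ?F")
proof -
  let ?w = "\<lambda>x. ennreal (monomial_weight A x)"
  let ?h = "\<lambda>t z x. ?w x * indicator (orthant S) x * ennreal (f (x + t *\<^sub>R z)) * indicator (sector S) z * indicator {0..r} t"
  have "?L = (\<integral>\<^sup>+x. (\<integral>\<^sup>+t. (\<integral>\<^sup>+z. ?h t z x \<partial>lborel) \<partial>lborel) \<partial>lborel)"
    by (intro nn_integral_cong) (simp add: nn_integral_cmult[symmetric] nn_integral_multc[symmetric] mult.assoc)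
  also have "\<dots> = (\<integral>\<^sup>+t. (\<integral>\<^sup>+x. (\<integral>\<^sup>+z. ?h t z x \<partial>lborel) \<partial>lborel) \<partial>lborel)"
    by (rule lborel_pair.Fubini') measurable
  also have "\<dots> = (\<integral>\<^sup>+t. (\<integral>\<^sup>+z. (\<integral>\<^sup>+x. ?h t z x \<partial>lborel) \<partial>lborel) \<partial>lborel)"
    by (intro nn_integral_cong lborel_pair.Fubini') measurable
  also have "\<dots> \<le> (\<integral>\<^sup>+t. (\<integral>\<^sup>+z. ?F * indicator (sector S :: (real^'n) set) z * indicator {0..r} t \<partial>lborel) \<partial>lborel)"
  proof (intro nn_integral_mono)
    fix t :: real and z :: "real^'n"
    show "(\<integral>\<^sup>+x. ?h t z x \<partial>lborel)
        \<le> ?F * indicator (sector S) z * indicator {0..r} t"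
    proof (cases "z \<in> sector S \<and> t \<in> {0..r}")
      case True
      have "(\<integral>\<^sup>+x. ?h t z x \<partial>lborel)
         \<le> (\<integral>\<^sup>+x. ?w (x + t *\<^sub>R z) * ennreal (f (x + t *\<^sub>R z)) \<partial>lborel)"
      proof (rule nn_integral_mono)
        fix x
        have "monomial_weight A x \<le> monomial_weight A (x + t *\<^sub>R z)" if "x \<in> orthant S"
          using orthant_sector(1)[OF that, of z t] True by (intro monomial_weight_mono A) auto
        then show "?h t z x
            \<le> ?w (x + t *\<^sub>R z) * ennreal (f (x + t *\<^sub>R z))"
          using True by (auto simp: indicator_def intro!: mult_right_mono ennreal_leI)
      qed
      also have "\<dots> = ?F"
        by (rule nn_integral_translate[of "\<lambda>x. ?w x * ennreal (f x)"]) measurable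
      finally show ?thesis using True by simp
    qed auto
  qed
  also have "\<dots> = (\<integral>\<^sup>+t. ?F * indicator {0..r} t \<partial>lborel)"
    by (intro nn_integral_cong) (simp add: nn_integral_multc nn_integral_cmult_indicator emeasure_sector)
  also have "\<dots> = ennreal r * ?F"
    using r by (subst nn_integral_cmult_indicator) (simp_all add: mult.commute)
  finally show ?thesis .
qed


text \<open>
  By \<open>far_estimate\<close>, the smallness condition on \<open>r\<close> says that the part of the rays after the time
  \<open>r\<close> contributes at most \<open>l / 2\<close> to \<open>\<bar>u\<bar>\<close>. Where \<open>\<bar>u\<bar> \<ge> l\<close> the part before the time \<open>r\<close> must contribute
  the rest, and \<open>near_estimate\<close> bounds the measure of this set, as in Markov's inequality.
\<close>

lemma weak_type_orthant:
  fixes A :: "real^'n"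
  assumes A: "\<And>i. 0 \<le> A $ i" and D: "hom_dim A > 1" and u: "u \<in> C1_c" and l: "l > 0" and r: "r > 0"
    and F: "(\<integral>\<^sup>+x. ennreal (monomial_weight A x) * ennreal (norm (grad u x)) \<partial>lborel) = ennreal F" "F \<ge> 0"
    and small: "2 * real CARD('n) * F * (r powr (1 - hom_dim A) / (hom_dim A - 1)) \<le> l / 2"
  shows "(\<integral>\<^sup>+x. ennreal (monomial_weight A x) * indicator (orthant S \<inter> {x. l \<le> \<bar>u x\<bar>}) x \<partial>lborel)
      \<le> ennreal (4 * CARD('n) / l * r * F)"
proof -
  let ?K = "2 * real CARD('n)" and ?D = "hom_dim A"
  let ?w = "\<lambda>x. ennreal (monomial_weight A x)"
  let ?f = "\<lambda>x. norm (grad u x)"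
  note [measurable] = C1_c_measurable[OF u]
  define P where "P x t = (\<integral>\<^sup>+z. ennreal (?f (x + t *\<^sub>R z)) * indicator (sector S) z \<partial>lborel)" for x t
  have [measurable]: "case_prod P \<in> borel_measurable (lborel \<Otimes>\<^sub>M lborel)" "\<And>x. P x \<in> borel_measurable lborel"
    unfolding P_def[abs_def] by measurable
  define N where "N x = (\<integral>\<^sup>+t. P x t * indicator {0..r} t \<partial>lborel)" for x
  have [measurable]: "N \<in> borel_measurable borel"
    unfolding N_def[abs_def] by measurable
  have pw: "ennreal \<bar>u x\<bar> \<le> ennreal ?K * N x + ennreal (l / 2)" if x: "x \<in> orthant S" for x
  proof -
    let ?h = "\<lambda>z t. ennreal (?f (x + t *\<^sub>R z)) * indicator (sector S) z * indicator {0..} t"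
    have "ennreal \<bar>u x\<bar> = (\<integral>\<^sup>+z. ennreal \<bar>u x\<bar> * indicator (sector S :: (real^'n) set) z \<partial>lborel)"
      by (subst nn_integral_cmult_indicator) (auto simp: emeasure_sector)
    also have "\<dots> \<le> (\<integral>\<^sup>+z. ennreal ?K * (\<integral>\<^sup>+t. ?h z t \<partial>lborel) \<partial>lborel)"
    proof (rule nn_integral_mono)
      fix z
      show "ennreal \<bar>u x\<bar> * indicator (sector S) z
        \<le> ennreal ?K * (\<integral>\<^sup>+t. ?h z t \<partial>lborel)"
        using ray_estimate[OF u, of z S x] by (cases "z \<in> sector S") auto
    qed
    also have "\<dots> = ennreal ?K * (\<integral>\<^sup>+z. (\<integral>\<^sup>+t. ?h z t \<partial>lborel) \<partial>lborel)"
      by (rule nn_integral_cmult) measurable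
    also have "(\<integral>\<^sup>+z. (\<integral>\<^sup>+t. ?h z t \<partial>lborel) \<partial>lborel)
        = (\<integral>\<^sup>+t. (\<integral>\<^sup>+z. ?h z t \<partial>lborel) \<partial>lborel)"
      by (rule lborel_pair.Fubini') measurable
    also have "\<dots> = (\<integral>\<^sup>+t. P x t * indicator {0..} t \<partial>lborel)"
      unfolding P_def by (intro nn_integral_cong nn_integral_multc) measurable
    also have "\<dots> \<le> (\<integral>\<^sup>+t. P x t * indicator {0..r} t + ennreal F * (ennreal (t powr (- ?D)) * indicator {r..} t) \<partial>lborel)"
    proof (rule nn_integral_mono)
      fix t
      show "P x t * indicator {0..} t \<le> P x t * indicator {0..r} t + ennreal F * (ennreal (t powr (- ?D)) * indicator {r..} t)"
      proof (cases "t > r")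
        case True
        then have "P x t \<le> ennreal (t powr (- ?D)) * ennreal F"
          unfolding P_def F(1)[symmetric] using r by (intro far_estimate A x) auto
        then show ?thesis using True r by (simp add: mult.commute)
      qed (auto simp: indicator_def)
    qed
    also have "\<dots> = N x + ennreal F * ennreal (r powr (1 - ?D) / (?D - 1))"
      unfolding N_def nn_integral_powr_tail[OF D r, symmetric]
      by (subst nn_integral_add) (auto simp: nn_integral_cmult)
    finally have "ennreal \<bar>u x\<bar> \<le> ennreal ?K * (N x + ennreal F * ennreal (r powr (1 - ?D) / (?D - 1)))"
      by (simp add: mult_left_mono)
    also have "\<dots> = ennreal ?K * N x + ennreal (?K * F * (r powr (1 - ?D) / (?D - 1)))"
      using F(2) D by (simp add: distrib_left ennreal_mult'[symmetric] mult.assoc)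
    also have "\<dots> \<le> ennreal ?K * N x + ennreal (l / 2)"
      using small by (intro add_left_mono ennreal_leI)
    finally show ?thesis .
  qed
  have "(\<integral>\<^sup>+x. ?w x * indicator (orthant S \<inter> {x. l \<le> \<bar>u x\<bar>}) x \<partial>lborel)
      \<le> (\<integral>\<^sup>+x. ennreal (2 * ?K / l) * (?w x * indicator (orthant S) x * N x) \<partial>lborel)"
  proof (rule nn_integral_mono)
    fix x
    show "?w x * indicator (orthant S \<inter> {x. l \<le> \<bar>u x\<bar>}) x
        \<le> ennreal (2 * ?K / l) * (?w x * indicator (orthant S) x * N x)"
    proof (cases "x \<in> orthant S \<and> l \<le> \<bar>u x\<bar>")
      case True
      have "1 \<le> ennreal (2 * ?K / l) * N x"
      proof (cases "N x")
        case (real y)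
        then have "\<bar>u x\<bar> \<le> ?K * y + l / 2"
          using pw[of x] True l by (simp add: ennreal_mult'[symmetric] ennreal_plus[symmetric] ennreal_le_iff del: ennreal_plus)
        then have "1 \<le> (2 * ?K / l) * y" using True l by (simp add: field_simps)
        then show ?thesis using real l by (simp add: ennreal_mult'[symmetric])
      qed (use l in \<open>simp add: ennreal_mult_top\<close>)
      from mult_left_mono[OF this, of "?w x"] True show ?thesis by (simp add: mult_ac)
    qed auto
  qed
  also have "\<dots> = ennreal (2 * ?K / l) * (\<integral>\<^sup>+x. ?w x * indicator (orthant S) x * N x \<partial>lborel)"
    by (rule nn_integral_cmult) measurable
  also have "\<dots> \<le> ennreal (2 * ?K / l) * (ennreal r * ennreal F)"
    unfolding N_def P_def F(1)[symmetric]
    by (intro mult_left_mono near_estimate A r) auto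
  also have "\<dots> = ennreal (4 * CARD('n) / l * r * F)"
    using l r F(2) by (simp add: ennreal_mult'[symmetric])
  finally show ?thesis .
qed

text \<open>
  The sum over all orthants, with the smallest \<open>r\<close> that the smallness condition of
  \<open>weak_type_orthant\<close> permits. The exponent \<open>D / (D - 1)\<close> arises as \<open>1 + 1 / (D - 1)\<close>.
\<close>

lemma weak_type_sobolev:
  fixes A :: "real^'n"
  assumes A: "\<And>i. 0 \<le> A $ i" and D: "hom_dim A > 1"
  obtains C where "C > 0" "\<And>u l F. u \<in> C1_c \<Longrightarrow> l > 0 \<Longrightarrow> F \<ge> 0 \<Longrightarrow>
    (\<integral>\<^sup>+x. ennreal (monomial_weight A x) * ennreal (norm (grad u x)) \<partial>lborel) = ennreal F \<Longrightarrow>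
    (\<integral>\<^sup>+x. ennreal (monomial_weight A x) * indicator {x. l \<le> \<bar>u x\<bar>} x \<partial>lborel)
      \<le> ennreal (C * (F / l) powr (hom_dim A / (hom_dim A - 1)))"
proof -
  let ?K = "2 * real CARD('n)" and ?D = "hom_dim A"
  let ?w = "\<lambda>x. ennreal (monomial_weight A x)"
  define C where "C = 2 ^ CARD('n) * (2 * ?K) * (2 * ?K / (?D - 1)) powr (1 / (?D - 1))"
  have C: "C > 0" unfolding C_def using D by (intro mult_pos_pos) auto
  have "(\<integral>\<^sup>+x. ?w x * indicator {x. l \<le> \<bar>u x\<bar>} x \<partial>lborel) \<le> ennreal (C * (F / l) powr (?D / (?D - 1)))"
    if u: "u \<in> C1_c" and l: "l > 0" and F: "F \<ge> 0"
    "(\<integral>\<^sup>+x. ?w x * ennreal (norm (grad u x)) \<partial>lborel) = ennreal F" for u l F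
  proof -
    note [measurable] = C1_c_measurable[OF u]
    \<comment> \<open>Equality in the smallness condition; for vanishing \<open>F\<close> any radius will do.\<close>
    define r where "r = (if F = 0 then 1 else (2 * ?K * F / (l * (?D - 1))) powr (1 / (?D - 1)))"
    have base: "2 * ?K * F / (l * (?D - 1)) > 0" if "F \<noteq> 0" using that F l D by simp
    have r: "r > 0" using base F l D by (auto simp: r_def)
    have small: "?K * F * (r powr (1 - ?D) / (?D - 1)) \<le> l / 2"
    proof (cases "F = 0")
      case False
      have "r powr (1 - ?D) = (2 * ?K * F / (l * (?D - 1))) powr (-1)"
      proof -
        have "1 / (?D - 1) * (1 - ?D) = -1" using D by (simp add: field_simps)
        then show ?thesis using False by (simp only: r_def powr_powr if_False)
      qed
      also have "\<dots> = l * (?D - 1) / (2 * ?K * F)" using base[OF False] False F l D by (simp add: powr_minus)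
      finally show ?thesis using False F l D by (simp add: field_simps)
    qed (use l in simp)
    have "(\<integral>\<^sup>+x. ?w x * indicator {x. l \<le> \<bar>u x\<bar>} x \<partial>lborel)
        \<le> (\<integral>\<^sup>+x. (\<Sum>S\<in>UNIV. ?w x * indicator (orthant (S :: 'n set) \<inter> {x. l \<le> \<bar>u x\<bar>}) x) \<partial>lborel)"
    proof (rule nn_integral_mono)
      fix x :: "real^'n"
      obtain S where S: "x \<in> orthant S" using orthant_cover by blast
      have "?w x * indicator {x. l \<le> \<bar>u x\<bar>} x = ?w x * indicator (orthant S \<inter> {x. l \<le> \<bar>u x\<bar>}) x"
        using S by (auto simp: indicator_def)
      also have "\<dots> \<le> (\<Sum>S\<in>UNIV. ?w x * indicator (orthant (S :: 'n set) \<inter> {x. l \<le> \<bar>u x\<bar>}) x)"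
        by (rule member_le_sum) auto
      finally show "?w x * indicator {x. l \<le> \<bar>u x\<bar>} x
        \<le> (\<Sum>S\<in>UNIV. ?w x * indicator (orthant (S :: 'n set) \<inter> {x. l \<le> \<bar>u x\<bar>}) x)" .
    qed
    also have "\<dots> = (\<Sum>S\<in>UNIV. \<integral>\<^sup>+x. ?w x * indicator (orthant (S :: 'n set) \<inter> {x. l \<le> \<bar>u x\<bar>}) x \<partial>lborel)"
      by (rule nn_integral_sum) measurable
    also have "\<dots> \<le> (\<Sum>S\<in>(UNIV :: 'n set set). ennreal (4 * CARD('n) / l * r * F))"
      by (intro sum_mono weak_type_orthant A D u l r F small)
    also have "\<dots> = ennreal (2 ^ CARD('n) * (4 * CARD('n) / l * r * F))"
      by (simp add: ennreal_of_nat_eq_real_of_nat ennreal_mult'[symmetric])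
    also have "2 ^ CARD('n) * (4 * CARD('n) / l * r * F) = C * (F / l) powr (?D / (?D - 1))"
    proof (cases "F = 0")
      case False
      then have F0: "F > 0" using F by simp
      have "r = (2 * ?K / (?D - 1)) powr (1 / (?D - 1)) * (F / l) powr (1 / (?D - 1))"
        using F0 l D by (simp add: r_def powr_mult[symmetric] powr_divide[symmetric] field_simps)
      moreover have "?D / (?D - 1) = 1 + 1 / (?D - 1)" using D by (simp add: field_simps)
      moreover have "(F / l) powr (1 + 1 / (?D - 1)) = (F / l) * (F / l) powr (1 / (?D - 1))"
        using F0 l by (simp add: powr_add)
      ultimately show ?thesis by (simp add: C_def)
    qed simp
    finally show ?thesis .
  qed
  with C that show ?thesis by blast
qed

section \<open>From weak type to strong type by truncation\<close>

lemma smooth_step: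
  obtains h h' :: "real \<Rightarrow> real" and B where "B > 0" "\<And>t. DERIV h t :> h' t" "continuous_on UNIV h'"
    "\<And>t. t \<le> 1 \<Longrightarrow> h t = 0" "\<And>t. 2 \<le> t \<Longrightarrow> h t = 1" "\<And>t. \<bar>h' t\<bar> \<le> B"
    "\<And>t. t \<le> 1 \<or> 2 \<le> t \<Longrightarrow> h' t = 0"
proof -
  define e where "e = flat 1"
  define e' where "e' = flat (pCons 0 (pCons 0 (1 - pderiv 1)))"
  have De: "DERIV e t :> e' t" for t unfolding e_def e'_def by (rule flat_deriv)
  have ce: "continuous_on UNIV e" using De by (meson DERIV_continuous continuous_at_imp_continuous_on)
  have ce': "continuous_on UNIV e'"
    unfolding e'_def using flat_deriv by (meson DERIV_continuous continuous_at_imp_continuous_on)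
  have e0: "e t = 0" "e' t = 0" if "t \<le> 0" for t using that by (auto simp: e_def e'_def flat_def)
  have pos: "e (t - 1) + e (2 - t) > 0" for t
    using flat_1_nonneg[of "t - 1"] flat_1_nonneg[of "2 - t"] flat_1_pos_iff[of "t - 1"] flat_1_pos_iff[of "2 - t"]
    unfolding e_def by linarith
  define h where "h t = e (t - 1) / (e (t - 1) + e (2 - t))" for t
  define h' where "h' t = (e' (t - 1) * (e (t - 1) + e (2 - t)) - e (t - 1) * (e' (t - 1) - e' (2 - t)))
      / ((e (t - 1) + e (2 - t)) * (e (t - 1) + e (2 - t)))" for t
  have Dh: "DERIV h t :> h' t" for t
  proof -
    have "DERIV (\<lambda>t. t - 1) t :> 1" "DERIV (\<lambda>t. 2 - t) t :> -1" by (auto intro!: derivative_eq_intros)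
    then have 1: "DERIV (\<lambda>t. e (t - 1)) t :> e' (t - 1)" and 2: "DERIV (\<lambda>t. e (2 - t)) t :> - e' (2 - t)"
      using DERIV_chain2[OF De, of "\<lambda>t. t - 1" 1 t UNIV] DERIV_chain2[OF De, of "\<lambda>t. 2 - t" "-1" t UNIV] by auto
    have "e (t - 1) + e (2 - t) \<noteq> 0" using pos[of t] by simp
    from DERIV_divide[OF 1 DERIV_add[OF 1 2] this] show ?thesis by (simp add: h_def[abs_def] h'_def)
  qed
  have c1: "continuous_on UNIV (\<lambda>t. e (t - 1))" "continuous_on UNIV (\<lambda>t. e (2 - t))"
    "continuous_on UNIV (\<lambda>t. e' (t - 1))" "continuous_on UNIV (\<lambda>t. e' (2 - t))"
    by (auto intro!: continuous_on_compose2[OF ce] continuous_on_compose2[OF ce'] continuous_intros)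
  have "(e (t - 1) + e (2 - t)) * (e (t - 1) + e (2 - t)) \<noteq> 0" for t
    using pos[of t] by auto
  then have ch': "continuous_on UNIV h'"
    unfolding h'_def[abs_def] by (intro continuous_intros c1) auto
  have out: "h' t = 0" if "t \<le> 1 \<or> 2 \<le> t" for t
    using that e0[of "t - 1"] e0[of "2 - t"] by (auto simp: h'_def)
  have "compact (h' ` {1..2})"
    using ch' by (intro compact_continuous_image compact_Icc) (auto intro: continuous_on_subset)
  then obtain B where B: "B > 0" "\<And>y. y \<in> h' ` {1..2} \<Longrightarrow> norm y \<le> B"
    using compact_imp_bounded bounded_pos by metis
  have bd: "\<bar>h' t\<bar> \<le> B" for t
    using B(2)[of "h' t"] B(1) out[of t] by (cases "t \<in> {1..2}") auto
  show ?thesis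
  proof (rule that[of B h h'])
    show "h t = 0" if "t \<le> 1" for t using e0[of "t - 1"] that by (simp add: h_def)
    show "h t = 1" if "2 \<le> t" for t using e0[of "2 - t"] pos[of t] that by (simp add: h_def)
  qed (use B Dh ch' bd out in auto)
qed

lemma C1_c_compose:
  assumes v: "v \<in> C1_c" and h: "\<And>t. DERIV h t :> h' t" "continuous_on UNIV h'" "h 0 = 0"
  shows "(\<lambda>x. h (v x)) \<in> C1_c" "grad (\<lambda>x. h (v x)) x = h' (v x) *\<^sub>R grad v x"
proof -
  obtain R where R: "\<And>x. x \<notin> cube R \<Longrightarrow> v x = 0"
    using C1_c_D(4)[OF v] compactly_supported_cube by blast
  have D: "GDERIV (\<lambda>x. h (v x)) x :> h' (v x) *\<^sub>R grad v x" for x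
    by (rule GDERIV_DERIV_compose[OF C1_c_D(1)[OF v] h(1)])
  have c: "continuous_on UNIV (\<lambda>x. h' (v x) *\<^sub>R grad v x)"
    by (intro continuous_intros continuous_on_compose2[OF h(2) C1_c_D(2)[OF v]] C1_c_D(3)[OF v]) auto
  have 0: "h (v x) = 0" if "x \<notin> cube R" for x using R[OF that] h(3) by simp
  show "(\<lambda>x. h (v x)) \<in> C1_c" by (rule C1_c_I(1)[OF D c 0])
  show "grad (\<lambda>x. h (v x)) x = h' (v x) *\<^sub>R grad v x" using C1_c_I(2)[OF D c 0] by simp
qed

text \<open>
  Only the values of \<open>s\<close> between \<open>v / 4\<close> and \<open>v / 2\<close> are used, on which the integrand is at least
  \<open>(v / 4) powr (k - 1)\<close>; the interval has the length \<open>v / 4\<close>.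
\<close>

lemma powr_layer_cake:
  assumes k: "k \<ge> 1" and v: "v > 0"
  shows "ennreal (v powr k) \<le> ennreal (4 powr k) *
    (\<integral>\<^sup>+s. ennreal (s powr (k - 1)) * indicator {s. 0 < s \<and> 2 * s \<le> v} s \<partial>lborel)"
proof -
  have "ennreal ((v / 4) powr k) = ennreal ((v / 4) powr (k - 1)) * emeasure lborel {v / 4..v / 2}"
    using v by (simp add: ennreal_mult'[symmetric] powr_diff field_simps)
  also have "\<dots> = (\<integral>\<^sup>+s. ennreal ((v / 4) powr (k - 1)) * indicator {v / 4..v / 2} s \<partial>lborel)"
    by (simp add: nn_integral_cmult_indicator)
  also have "\<dots> \<le> (\<integral>\<^sup>+s. ennreal (s powr (k - 1)) * indicator {s. 0 < s \<and> 2 * s \<le> v} s \<partial>lborel)"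
    by (intro nn_integral_mono) (use k v in \<open>auto simp: indicator_def intro!: ennreal_leI powr_mono2\<close>)
  finally have "ennreal (4 powr k) * ennreal ((v / 4) powr k) \<le> ennreal (4 powr k) *
      (\<integral>\<^sup>+s. ennreal (s powr (k - 1)) * indicator {s. 0 < s \<and> 2 * s \<le> v} s \<partial>lborel)"
    by (rule mult_left_mono) simp
  then show ?thesis using v by (simp add: ennreal_mult'[symmetric] powr_divide)
qed

text \<open>
  Each value \<open>v\<close> lies between \<open>s\<close> and \<open>2 s\<close> only for \<open>s\<close> in an interval of bounded logarithmic
  length. This is how the slices of a function between such levels add up to the whole.
\<close>

lemma nn_integral_inverse_dyadic:
  assumes "v \<ge> 0"
  shows "(\<integral>\<^sup>+s. ennreal (inverse s) * indicator {s. s < v \<and> v < 2 * s} s \<partial>lborel) \<le> 1"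
proof (cases "v = 0")
  case False
  then have v: "v > 0" using assms by simp
  have "(\<integral>\<^sup>+s. ennreal (inverse s) * indicator {s. s < v \<and> v < 2 * s} s \<partial>lborel)
      \<le> (\<integral>\<^sup>+s. ennreal (2 / v) * indicator {v / 2..v} s \<partial>lborel)"
    by (intro nn_integral_mono) (use v in \<open>auto simp: indicator_def field_simps intro!: ennreal_leI\<close>)
  also have "\<dots> = 1" using v by (simp add: nn_integral_cmult_indicator ennreal_mult'[symmetric] field_simps)
  finally show ?thesis .
next
  case True
  then have "{s. s < v \<and> v < 2 * s} = {}" by auto
  then show ?thesis by simp
qed

text \<open>
  Maz'ya's truncation argument. The function \<open>h (v / s)\<close>, where \<open>h\<close> climbs from \<open>0\<close> to \<open>1\<close> on the
  interval from \<open>1\<close> to \<open>2\<close>, is \<open>1\<close> where \<open>v \<ge> 2 s\<close>, and its gradient lives where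
  \<open>v\<close> is between \<open>s\<close> and \<open>2 s\<close>. The weak-type inequality for it bounds the measure of
  \<open>{v \<ge> 2 s}\<close> by the power \<open>k = D / (D - 1)\<close> of the integral \<open>a s\<close> of the gradient over this slice.
  The part \<open>k - 1\<close> of this power is estimated by the whole integral \<open>F\<close>. What remains is linear in
  the gradient, so that the slices add up when the levels are integrated.
\<close>

lemma strong_sobolev_L1:
  fixes A :: "real^'n"
  assumes A: "\<And>i. 0 \<le> A $ i" and D: "hom_dim A > 1"
  obtains C where "C > 0" "\<And>v F. v \<in> C1_c \<Longrightarrow> \<forall>x. 0 \<le> v x \<Longrightarrow> F \<ge> 0 \<Longrightarrow>
    (\<integral>\<^sup>+x. ennreal (monomial_weight A x) * ennreal (norm (grad v x)) \<partial>lborel) = ennreal F \<Longrightarrow>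
    (\<integral>\<^sup>+x. ennreal (monomial_weight A x) * ennreal (v x powr (hom_dim A / (hom_dim A - 1))) \<partial>lborel)
      \<le> ennreal (C * F powr (hom_dim A / (hom_dim A - 1)))"
proof -
  let ?D = "hom_dim A"
  let ?w = "\<lambda>x. ennreal (monomial_weight A x)"
  define k where "k = ?D / (?D - 1)"
  have k: "k > 1" using D by (simp add: k_def field_simps)
  obtain C where C: "C > 0" "\<And>u l F. u \<in> C1_c \<Longrightarrow> l > 0 \<Longrightarrow> F \<ge> 0 \<Longrightarrow>
    (\<integral>\<^sup>+x. ?w x * ennreal (norm (grad u x)) \<partial>lborel) = ennreal F \<Longrightarrow>
    (\<integral>\<^sup>+x. ?w x * indicator {x. l \<le> \<bar>u x\<bar>} x \<partial>lborel) \<le> ennreal (C * (F / l) powr k)"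
    by (rule weak_type_sobolev[OF A D, folded k_def]) (rule that)
  obtain h h' :: "real \<Rightarrow> real" and B where B: "B > 0" and h: "\<And>t. DERIV h t :> h' t" "continuous_on UNIV h'"
    "\<And>t. t \<le> 1 \<Longrightarrow> h t = 0" "\<And>t. 2 \<le> t \<Longrightarrow> h t = 1" "\<And>t. \<bar>h' t\<bar> \<le> B" "\<And>t. t \<le> 1 \<or> 2 \<le> t \<Longrightarrow> h' t = 0"
    by (rule smooth_step) (rule that)
  define C' where "C' = 4 powr k * (C * B powr k)"
  have C': "C' > 0" using C B by (simp add: C'_def)
  have "(\<integral>\<^sup>+x. ?w x * ennreal (v x powr k) \<partial>lborel) \<le> ennreal (C' * F powr k)"
    if v: "v \<in> C1_c" and v0': "\<forall>x. 0 \<le> v x" and F0: "F \<ge> 0"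
    and F: "(\<integral>\<^sup>+x. ?w x * ennreal (norm (grad v x)) \<partial>lborel) = ennreal F" for v F
  proof -
    note [measurable] = C1_c_measurable[OF v]
    have v0: "0 \<le> v x" for x using v0' by blast
    let ?f = "\<lambda>x. ennreal (norm (grad v x))"
    let ?K = "ennreal (C * B powr k * F powr (k - 1))"
    let ?H = "\<lambda>x s. ennreal (inverse s) * indicator {s. s < v x \<and> v x < 2 * s} s"
    let ?L = "\<lambda>s. \<integral>\<^sup>+x. ?w x * indicator {x. 2 * s \<le> v x} x \<partial>lborel"
    let ?V = "\<lambda>s. \<integral>\<^sup>+x. ?w x * ennreal (norm (grad (\<lambda>x. h (v x / s)) x)) \<partial>lborel"
    define a where "a s = (\<integral>\<^sup>+x. ?w x * ?f x * indicator {x. s < v x \<and> v x < 2 * s} x \<partial>lborel)" for s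
    have aF: "a s \<le> ennreal F" for s
      unfolding a_def F[symmetric] by (intro nn_integral_mono) (auto simp: indicator_def)
    have level: "?L s
        \<le> ennreal (C * B powr k * F powr (k - 1) * s powr (- k)) * a s" if s: "s > 0" for s
    proof -
      let ?g = "\<lambda>t. h (t / s)" and ?g' = "\<lambda>t. h' (t / s) / s"
      have Dg: "DERIV ?g t :> ?g' t" for t
      proof -
        have "DERIV (\<lambda>t. t / s) t :> 1 / s" using s by (auto intro!: derivative_eq_intros)
        from DERIV_chain2[OF h(1) this] show ?thesis by simp
      qed
      have cg: "continuous_on UNIV ?g'"
        by (intro continuous_intros continuous_on_compose2[OF h(2)]) (use s in auto)
      have vs1: "(\<lambda>x. h (v x / s)) \<in> C1_c" and vs2: "\<And>x. grad (\<lambda>x. h (v x / s)) x = (h' (v x / s) / s) *\<^sub>R grad v x"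
        using C1_c_compose[OF v Dg cg] h(3)[of "0 / s"] by auto
      have pw: "?w x * ennreal (norm (grad (\<lambda>x. h (v x / s)) x))
          \<le> ennreal (B / s) * (?w x * ?f x * indicator {x. s < v x \<and> v x < 2 * s} x)" for x
      proof (cases "s < v x \<and> v x < 2 * s")
        case True
        have "norm (grad (\<lambda>x. h (v x / s)) x) \<le> B / s * norm (grad v x)"
          unfolding vs2 using h(5)[of "v x / s"] s
          by (auto intro!: mult_right_mono divide_right_mono simp: abs_divide)
        then have "ennreal (norm (grad (\<lambda>x. h (v x / s)) x)) \<le> ennreal (B / s) * ?f x"
          using B s by (simp add: ennreal_mult'[symmetric] ennreal_leI)
        from mult_left_mono[OF this, of "?w x"] True show ?thesis by (simp add: mult_ac)
      next
        case False
        then have "v x / s \<le> 1 \<or> 2 \<le> v x / s" using s by (auto simp: field_simps)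
        then show ?thesis unfolding vs2 by (simp add: h(6))
      qed
      have I: "?V s \<le> ennreal (B / s) * a s"
        unfolding a_def by (subst nn_integral_cmult[symmetric]) (auto intro!: nn_integral_mono pw)
      also have "\<dots> \<le> ennreal (B / s) * ennreal F" by (intro mult_left_mono aF) auto
      also have "\<dots> = ennreal (B / s * F)" using B s F0 by (simp add: ennreal_mult'[symmetric])
      finally have I2: "?V s \<le> ennreal (B / s * F)" .
      then obtain G where G: "G \<ge> 0" "?V s = ennreal G"
        by (cases "?V s") (auto simp: top_unique)
      have GF: "G \<le> B / s * F" using I2 G F0 B s by (simp add: ennreal_le_iff)
      have "?L s
          \<le> (\<integral>\<^sup>+x. ?w x * indicator {x. 1 \<le> \<bar>h (v x / s)\<bar>} x \<partial>lborel)"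
        by (intro nn_integral_mono) (use s in \<open>auto simp: indicator_def h(4) field_simps\<close>)
      also have "\<dots> \<le> ennreal (C * (G / 1) powr k)"
        by (rule C(2)[OF vs1 _ G]) simp
      also have "\<dots> \<le> ennreal (C * ((B / s * F) powr (k - 1) * G))"
      proof -
        have "G powr k = G powr (k - 1) * G" using G by (simp add: powr_diff)
        also have "\<dots> \<le> (B / s * F) powr (k - 1) * G"
          using G GF k by (intro mult_right_mono powr_mono2) auto
        finally show ?thesis using C by (intro ennreal_leI) simp
      qed
      also have "\<dots> = ennreal (C * (B / s * F) powr (k - 1)) * ennreal G"
        using C by (simp add: ennreal_mult'[symmetric] mult.assoc)
      also have "\<dots> \<le> ennreal (C * (B / s * F) powr (k - 1)) * (ennreal (B / s) * a s)"
        using I G(2) by (intro mult_left_mono) auto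
      also have "\<dots> = ennreal (C * (B / s * F) powr (k - 1) * (B / s)) * a s"
        using C B s by (simp add: ennreal_mult'[symmetric] mult.assoc[symmetric])
      also have "C * (B / s * F) powr (k - 1) * (B / s) = C * B powr k * F powr (k - 1) * s powr (- k)"
      proof -
        have "(B / s * F) powr (k - 1) = (B / s) powr (k - 1) * F powr (k - 1)"
          by (rule powr_mult)
        then have "C * (B / s * F) powr (k - 1) * (B / s) = C * ((B / s) powr (k - 1) * (B / s)) * F powr (k - 1)"
          by (simp only: mult_ac)
        also have "(B / s) powr (k - 1) * (B / s) = (B / s) powr k"
          using B s by (simp add: powr_diff)
        also have "(B / s) powr k = B powr k * s powr (- k)"
          using B s by (simp add: powr_divide powr_minus_divide)
        finally show ?thesis by (simp only: mult_ac)
      qed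
      finally show ?thesis .
    qed
    let ?J = "\<lambda>x s. ?w x * (ennreal (s powr (k - 1)) * indicator {s. 0 < s \<and> 2 * s \<le> v x} s)"
    have "(\<integral>\<^sup>+x. ?w x * ennreal (v x powr k) \<partial>lborel)
        \<le> (\<integral>\<^sup>+x. ennreal (4 powr k) * (\<integral>\<^sup>+s. ?J x s \<partial>lborel) \<partial>lborel)"
    proof (rule nn_integral_mono)
      fix x
      show "?w x * ennreal (v x powr k) \<le> ennreal (4 powr k) * (\<integral>\<^sup>+s. ?J x s \<partial>lborel)"
      proof (cases "v x = 0")
        case False
        then have "0 < v x" using v0[of x] by simp
        from mult_left_mono[OF powr_layer_cake[OF _ this, of k], of "?w x"] k
        show ?thesis by (subst nn_integral_cmult) (auto simp: mult_ac)
      qed simp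
    qed
    also have "\<dots> = ennreal (4 powr k) * (\<integral>\<^sup>+x. (\<integral>\<^sup>+s. ?J x s \<partial>lborel) \<partial>lborel)"
      by (rule nn_integral_cmult) measurable
    also have "(\<integral>\<^sup>+x. (\<integral>\<^sup>+s. ?J x s \<partial>lborel) \<partial>lborel) = (\<integral>\<^sup>+s. (\<integral>\<^sup>+x. ?J x s \<partial>lborel) \<partial>lborel)"
      by (rule lborel_pair.Fubini'[symmetric]) measurable
    also have "\<dots> \<le> (\<integral>\<^sup>+s. ?K *
        (ennreal (inverse s) * indicator {0<..} s * a s) \<partial>lborel)"
    proof (rule nn_integral_mono)
      fix s :: real
      show "(\<integral>\<^sup>+x. ?J x s \<partial>lborel) \<le> ?K *
        (ennreal (inverse s) * indicator {0<..} s * a s)"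
      proof (cases "s > 0")
        case True
        have "(\<integral>\<^sup>+x. ?J x s \<partial>lborel) = (\<integral>\<^sup>+x. ennreal (s powr (k - 1)) * (?w x * indicator {x. 2 * s \<le> v x} x) \<partial>lborel)"
          using True by (intro nn_integral_cong) (auto simp: indicator_def mult_ac)
        also have "\<dots> = ennreal (s powr (k - 1)) * ?L s"
          by (rule nn_integral_cmult) measurable
        also have "\<dots> \<le> ennreal (s powr (k - 1)) * (ennreal (C * B powr k * F powr (k - 1) * s powr (- k)) * a s)"
          by (intro mult_left_mono level True) auto
        also have "\<dots> = ennreal (C * B powr k * F powr (k - 1) * (s powr (k - 1) * s powr (- k))) * a s"
          by (simp add: ennreal_mult'[symmetric] mult.assoc[symmetric]) (simp add: mult_ac)
        also have "s powr (k - 1) * s powr (- k) = inverse s"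
        proof -
          have "s powr (k - 1) * s powr (- k) = s powr ((k - 1) + (- k))" by (rule powr_add[symmetric])
          also have "\<dots> = inverse s" using True by (simp add: powr_minus)
          finally show ?thesis .
        qed
        also have "ennreal (C * B powr k * F powr (k - 1) * inverse s) = ?K * ennreal (inverse s)"
          using True by (simp add: ennreal_mult'')
        finally show ?thesis using True by (simp add: mult_ac)
      qed simp
    qed
    also have "\<dots> = (\<integral>\<^sup>+s. (\<integral>\<^sup>+x. ?K * (?w x * ?f x *
        ?H x s) \<partial>lborel) \<partial>lborel)"
    proof (rule nn_integral_cong)
      fix s :: real
      have "?K * (ennreal (inverse s) * indicator {0<..} s * a s)
        = (\<integral>\<^sup>+x. ?K * (ennreal (inverse s) * indicator {0<..} s *
            (?w x * ?f x * indicator {x. s < v x \<and> v x < 2 * s} x)) \<partial>lborel)"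
        unfolding a_def by (simp add: nn_integral_cmult)
      also have "\<dots> = (\<integral>\<^sup>+x. ?K * (?w x * ?f x *
        ?H x s) \<partial>lborel)"
        by (intro nn_integral_cong) (auto simp: indicator_def mult_ac)
      finally show "?K * (ennreal (inverse s) * indicator {0<..} s * a s)
        = (\<integral>\<^sup>+x. ?K * (?w x * ?f x *
        ?H x s) \<partial>lborel)" .
    qed
    also have "\<dots> = (\<integral>\<^sup>+x. (\<integral>\<^sup>+s. ?K * (?w x * ?f x *
        ?H x s) \<partial>lborel) \<partial>lborel)"
      by (rule lborel_pair.Fubini') measurable
    also have "\<dots> \<le> (\<integral>\<^sup>+x. ?K * (?w x * ?f x) \<partial>lborel)"
    proof (rule nn_integral_mono)
      fix x
      have "(\<integral>\<^sup>+s. ?K * (?w x * ?f x *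
        ?H x s) \<partial>lborel)
        = ?K * (?w x * ?f x *
        (\<integral>\<^sup>+s. ?H x s \<partial>lborel))"
        by (simp add: nn_integral_cmult)
      also have "\<dots> \<le> ?K * (?w x * ?f x * 1)"
        by (intro mult_left_mono nn_integral_inverse_dyadic v0) auto
      finally show "(\<integral>\<^sup>+s. ?K * (?w x * ?f x *
        ?H x s) \<partial>lborel)
        \<le> ?K * (?w x * ?f x)" by simp
    qed
    also have "\<dots> = ?K * ennreal F"
      unfolding F[symmetric] by (rule nn_integral_cmult) measurable
    also have "\<dots> = ennreal (C * B powr k * F powr k)"
      using C F0 by (simp add: ennreal_mult''[symmetric] powr_diff)
    finally have "(\<integral>\<^sup>+x. ?w x * ennreal (v x powr k) \<partial>lborel) \<le> ennreal (4 powr k) * ennreal (C * B powr k * F powr k)"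
      by (simp add: mult_left_mono)
    also have "\<dots> = ennreal (C' * F powr k)" by (simp add: C'_def ennreal_mult'[symmetric] mult.assoc)
    finally show ?thesis .
  qed
  with C' that show ?thesis unfolding k_def by blast
qed


section \<open>The Sobolev inequality for exponents greater than one\<close>

text \<open>
  The derivative is written with positive and negative parts, and not with the sign, to make its
  continuity at \<open>0\<close> evident.
\<close>

lemma abs_powr_deriv:
  fixes g :: real
  assumes g: "g > 1"
  shows "DERIV (\<lambda>t. \<bar>t\<bar> powr g) t :> g * (max 0 t powr (g - 1) - max 0 (- t) powr (g - 1))"
    and "continuous_on UNIV (\<lambda>t. g * (max 0 t powr (g - 1) - max 0 (- t) powr (g - 1)))"
    and "\<bar>g * (max 0 t powr (g - 1) - max 0 (- t) powr (g - 1))\<bar> = g * \<bar>t\<bar> powr (g - 1)"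
proof -
  let ?d = "\<lambda>t. g * (max 0 t powr (g - 1) - max 0 (- t) powr (g - 1))"
  show "continuous_on UNIV (\<lambda>t. ?d t)"
    using g by (intro continuous_intros continuous_on_powr') auto
  show "\<bar>?d t\<bar> = g * \<bar>t\<bar> powr (g - 1)"
    using g by (cases "t \<ge> 0") (auto simp: abs_mult max_def)
  consider "t > 0" | "t < 0" | "t = 0" by linarith
  then show "DERIV (\<lambda>t. \<bar>t\<bar> powr g) t :> ?d t"
  proof cases
    case 1
    then have "DERIV (\<lambda>t. t powr g) t :> ?d t"
      using has_real_derivative_powr[of t g] by (simp add: max_def)
    then show ?thesis
      by (rule has_field_derivative_transform_within_open[of _ _ _ "{0<..}"]) (use 1 in auto)
  next
    case 2
    have "DERIV (\<lambda>t. (- t) powr g) t :> g * (- t) powr (g - 1) * (- 1)"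
      by (rule DERIV_chain2[OF has_real_derivative_powr]) (use 2 in \<open>auto intro!: derivative_eq_intros\<close>)
    then have "DERIV (\<lambda>t. (- t) powr g) t :> ?d t"
      using 2 by (simp add: max_def)
    then show ?thesis
      by (rule has_field_derivative_transform_within_open[of _ _ _ "{..<0}"]) (use 2 in auto)
  next
    case 3
    have "((\<lambda>h::real. \<bar>h\<bar> powr (g - 1)) \<longlongrightarrow> \<bar>0\<bar> powr (g - 1)) (at 0)"
      using g by (intro tendsto_powr2 tendsto_intros) auto
    then have "((\<lambda>h::real. \<bar>h\<bar> powr (g - 1)) \<longlongrightarrow> 0) (at 0)" by simp
    then have "((\<lambda>h::real. \<bar>h\<bar> powr g / h) \<longlongrightarrow> 0) (at 0)"
    proof (rule Lim_null_comparison[rotated])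
      have "norm (\<bar>h\<bar> powr g / h) \<le> \<bar>h\<bar> powr (g - 1)" for h :: real
        by (cases "h = 0") (auto simp: powr_diff)
      then show "eventually (\<lambda>h::real. norm (\<bar>h\<bar> powr g / h) \<le> \<bar>h\<bar> powr (g - 1)) (at 0)" by simp
    qed
    then show ?thesis using 3 by (simp add: DERIV_def)
  qed
qed

lemma ennreal_linear_combination:
  "0 \<le> x \<Longrightarrow> 0 \<le> y \<Longrightarrow> 0 \<le> a \<Longrightarrow> 0 \<le> b \<Longrightarrow>
    ennreal (x * a + y * b) = ennreal x * ennreal a + ennreal y * ennreal b"
  by (simp add: ennreal_mult ennreal_plus)

text \<open>
  Young's inequality for the functions divided by their norms, integrated.
\<close>

lemma nn_integral_Holder:
  fixes f g :: "'a \<Rightarrow> real"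
  assumes [measurable]: "f \<in> borel_measurable M" "g \<in> borel_measurable M"
    and f: "\<And>x. 0 \<le> f x" and g: "\<And>x. 0 \<le> g x" and p: "p > 1" "q > 1" "1 / p + 1 / q = 1"
    and a: "(\<integral>\<^sup>+x. ennreal (f x powr p) \<partial>M) = ennreal a" "a \<ge> 0"
    and b: "(\<integral>\<^sup>+x. ennreal (g x powr q) \<partial>M) = ennreal b" "b \<ge> 0"
  shows "(\<integral>\<^sup>+x. ennreal (f x * g x) \<partial>M) \<le> ennreal (a powr (1 / p) * b powr (1 / q))"
proof (cases "a = 0 \<or> b = 0")
  case True
  have "AE x in M. f x * g x = 0"
  proof (cases "a = 0")
    case True
    then have "AE x in M. ennreal (f x powr p) = 0" using a nn_integral_0_iff_AE[of "\<lambda>x. ennreal (f x powr p)" M] by simp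
    then show ?thesis by eventually_elim (use f p in \<open>auto simp: ennreal_eq_0_iff order_class.antisym_conv\<close>)
  next
    case False
    then have "AE x in M. ennreal (g x powr q) = 0" using b \<open>a = 0 \<or> b = 0\<close> nn_integral_0_iff_AE[of "\<lambda>x. ennreal (g x powr q)" M] by simp
    then show ?thesis by eventually_elim (use g p in \<open>auto simp: ennreal_eq_0_iff order_class.antisym_conv\<close>)
  qed
  then have "(\<integral>\<^sup>+x. ennreal (f x * g x) \<partial>M) = (\<integral>\<^sup>+x. 0 \<partial>M)"
    by (rule nn_integral_cong_AE[OF eventually_mono]) auto
  then show ?thesis by simp
next
  case False
  then have ab: "a > 0" "b > 0" using a b by auto
  let ?c = "a powr (1 / p) * b powr (1 / q)"
  have c: "?c > 0" using ab by simp
  have pw: "f x * g x \<le> ?c / (p * a) * f x powr p + ?c / (q * b) * g x powr q" for x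
  proof -
    have "(f x / a powr (1 / p)) * (g x / b powr (1 / q))
        \<le> (f x / a powr (1 / p)) powr p / p + (g x / b powr (1 / q)) powr q / q"
      by (rule Youngs_inequality) (use p f g in auto)
    also have "(f x / a powr (1 / p)) powr p = f x powr p / a"
      using ab f p by (simp add: powr_divide powr_powr)
    also have "(g x / b powr (1 / q)) powr q = g x powr q / b"
      using ab g p by (simp add: powr_divide powr_powr)
    finally have "(f x * g x) / ?c \<le> f x powr p / a / p + g x powr q / b / q" by simp
    then have "f x * g x \<le> (f x powr p / a / p + g x powr q / b / q) * ?c"
      using c by (simp only: pos_divide_le_eq)
    then show ?thesis by (simp add: field_simps)
  qed
  have "(\<integral>\<^sup>+x. ennreal (f x * g x) \<partial>M)
      \<le> (\<integral>\<^sup>+x. ennreal (?c / (p * a)) * ennreal (f x powr p) + ennreal (?c / (q * b)) * ennreal (g x powr q) \<partial>M)"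
  proof (rule nn_integral_mono)
    fix x
    have "0 \<le> ?c / (p * a)" "0 \<le> ?c / (q * b)" using ab p by auto
    then show "ennreal (f x * g x) \<le> ennreal (?c / (p * a)) * ennreal (f x powr p) + ennreal (?c / (q * b)) * ennreal (g x powr q)"
      using ennreal_leI[OF pw[of x]] by (subst (asm) ennreal_linear_combination) auto
  qed
  also have "\<dots> = ennreal (?c / (p * a)) * ennreal a + ennreal (?c / (q * b)) * ennreal b"
    by (simp add: nn_integral_add nn_integral_cmult a b)
  also have "\<dots> = ennreal (?c / (p * a) * a + ?c / (q * b) * b)"
    using ab p by (simp add: ennreal_mult'[symmetric] ennreal_plus[symmetric] del: ennreal_plus)
  also have "?c / (p * a) * a + ?c / (q * b) * b = ?c * (1 / p + 1 / q)"
    using ab p by (simp add: field_simps)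
  finally show ?thesis using p(3) by simp
qed

text \<open>
  The strong inequality for \<open>p = 1\<close> is applied to \<open>v = \<bar>u\<bar> powr g\<close>. Its gradient is
  \<open>\<bar>u\<bar> powr (g - 1)\<close> times that of \<open>u\<close>, up to the factor \<open>g\<close> and a sign, and Hoelder's inequality separates the
  two factors. The exponent \<open>g\<close> is chosen so that the same integral \<open>J\<close> of \<open>\<bar>u\<bar> powr q\<close> appears
  on both sides. It is finite, and its power on the right is smaller than the one on the left, so that
  it can be cancelled.
\<close>

lemma monomial_sobolev_C1_c:
  fixes A :: "real^'n"
  assumes A: "\<And>i. 0 \<le> A $ i" and p: "1 < p" "p < hom_dim A"
  obtains C where "C > 0" "\<And>u. u \<in> C1_c \<Longrightarrow>
    lp_norm (monomial_measure A) (hom_dim A * p / (hom_dim A - p)) u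
      \<le> ennreal C * lp_norm (monomial_measure A) p (\<lambda>x. norm (grad u x))"
proof -
  let ?D = "hom_dim A" and ?M = "monomial_measure A"
  let ?w = "\<lambda>x. ennreal (monomial_weight A x)"
  have D: "?D > 1" using p by simp
  define k where "k = ?D / (?D - 1)"
  define q where "q = ?D * p / (?D - p)"
  define g where "g = p * (?D - 1) / (?D - p)"
  define p' where "p' = p / (p - 1)"
  have k: "k > 1" using D by (simp add: k_def field_simps)
  have g: "g > 1"
  proof -
    have "p * 1 < p * ?D" using p by (intro mult_strict_left_mono) auto
    have "?D * 1 < ?D * p" using p by (intro mult_strict_left_mono) auto
    then show ?thesis using p by (simp add: g_def field_simps)
  qed
  have q: "q > 0" using p by (simp add: q_def)
  have p': "p' > 1" "1 / p + 1 / p' = 1" using p by (auto simp: p'_def field_simps)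
  \<comment> \<open>The next three identities are the exponent arithmetic behind the choice of \<open>g\<close>: the first two produce \<open>J\<close> on the two sides, the third is the power of \<open>J\<close> that remains.\<close>
  have gk: "g * k = q" using D p by (simp add: g_def k_def q_def)
  have gp': "(g - 1) * p' = q"
  proof -
    have "g - 1 = ?D * (p - 1) / (?D - p)" using p by (simp add: g_def field_simps)
    then show ?thesis using p by (simp add: p'_def q_def)
  qed
  have kp: "1 - k / p' = k / q"
  proof -
    have "k / p' + k / q = 1"
    proof -
      have "k / p' = ?D * (p - 1) / ((?D - 1) * p)" using p by (simp add: k_def p'_def)
      moreover have "k / q = (?D - p) / ((?D - 1) * p)" using p by (simp add: k_def q_def)
      moreover have "?D * (p - 1) + (?D - p) = (?D - 1) * p" by (simp add: algebra_simps)
      ultimately show ?thesis using p by (simp add: add_divide_distrib[symmetric])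
    qed
    then show ?thesis by simp
  qed
  obtain C where C: "C > 0" "\<And>v F. v \<in> C1_c \<Longrightarrow> \<forall>x. 0 \<le> v x \<Longrightarrow> F \<ge> 0 \<Longrightarrow>
    (\<integral>\<^sup>+x. ?w x * ennreal (norm (grad v x)) \<partial>lborel) = ennreal F \<Longrightarrow>
    (\<integral>\<^sup>+x. ?w x * ennreal (v x powr k) \<partial>lborel) \<le> ennreal (C * F powr k)"
    by (rule strong_sobolev_L1[OF A D, folded k_def]) (rule that)
  define C' where "C' = C powr (1 / k) * g"
  have C': "C' > 0" using C g by (simp add: C'_def)
  have "lp_norm ?M q u \<le> ennreal C' * lp_norm ?M p (\<lambda>x. norm (grad u x))" if u: "u \<in> C1_c" for u
  proof -
    note [measurable] = C1_c_measurable[OF u]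
    let ?J = "\<integral>\<^sup>+x. ennreal (\<bar>u x\<bar> powr q) \<partial>?M" and ?P = "\<integral>\<^sup>+x. ennreal (\<bar>norm (grad u x)\<bar> powr p) \<partial>?M"
    obtain R B where R: "R > 0" "\<And>x. x \<notin> cube R \<Longrightarrow> u x = 0" "\<And>x. x \<notin> cube R \<Longrightarrow> grad u x = 0"
      and B: "\<And>x. \<bar>u x\<bar> \<le> B" "\<And>x. norm (grad u x) \<le> B"
      using C1_c_bounds[OF u] by metis
    have "?J < \<infinity>"
      by (rule lp_norm_finite(2)[OF A q R(1,2) B(1)])
    then obtain J where J: "J \<ge> 0" "?J = ennreal J"
      by (cases "?J") auto
    have "?P < \<infinity>"
      by (rule lp_norm_finite(2)[OF A _ R(1)]) (use p R B in auto)
    then obtain P where P: "P \<ge> 0" "?P = ennreal P"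
      by (cases "?P") auto
    define v where "v x = \<bar>u x\<bar> powr g" for x
    let ?V = "\<integral>\<^sup>+x. ?w x * ennreal (norm (grad v x)) \<partial>lborel" and ?X = "P powr (1 / p) * J powr (1 / p')"
    let ?h = "\<lambda>x. norm (grad u x) * \<bar>u x\<bar> powr (g - 1)"
    have v: "v \<in> C1_c" and gv: "norm (grad v x) = g * (?h x)" for x
    proof -
      note c = C1_c_compose[OF u abs_powr_deriv(1,2)[OF g]]
      show "v \<in> C1_c" using c(1) g by (simp add: v_def[abs_def])
      show "norm (grad v x) = g * (?h x)"
        using c(2)[of x] abs_powr_deriv(3)[OF g, of "u x"] g by (simp add: v_def[abs_def])
    qed
    have mu: "u \<in> borel_measurable ?M" "(\<lambda>x. norm (grad u x)) \<in> borel_measurable ?M"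
      by (intro borel_imp_monomial_measurable; measurable)+
    note [measurable] = mu
    have H: "(\<integral>\<^sup>+x. ennreal (?h x) \<partial>?M) \<le> ennreal ?X"
      by (rule nn_integral_Holder) (use mu p p' P J in \<open>auto simp: powr_powr gp'\<close>)
    have "?V
        = (\<integral>\<^sup>+x. ennreal g * (?w x * ennreal (?h x)) \<partial>lborel)"
      using g by (intro nn_integral_cong) (simp add: gv ennreal_mult' mult_ac)
    also have "\<dots> = ennreal g * (\<integral>\<^sup>+x. ?w x * ennreal (?h x) \<partial>lborel)"
      by (rule nn_integral_cmult) measurable
    also have "(\<integral>\<^sup>+x. ?w x * ennreal (?h x) \<partial>lborel)
        = (\<integral>\<^sup>+x. ennreal (?h x) \<partial>?M)"
      by (rule nn_integral_monomial_measure[symmetric]) measurable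
    also have "ennreal g * \<dots> \<le> ennreal g * ennreal ?X"
      by (intro mult_left_mono H) auto
    also have "\<dots> = ennreal (g * ?X)"
      using g by (simp add: ennreal_mult')
    finally have V: "?V \<le> ennreal (g * ?X)" .
    then obtain F where F: "F \<ge> 0" "?V = ennreal F"
      by (cases "?V") (auto simp: top_unique)
    have F': "F \<le> g * ?X" using V F g by (simp add: ennreal_le_iff)
    have "ennreal J = (\<integral>\<^sup>+x. ?w x * ennreal (\<bar>u x\<bar> powr q) \<partial>lborel)"
      unfolding J(2)[symmetric] by (rule nn_integral_monomial_measure) measurable
    also have "\<dots> = (\<integral>\<^sup>+x. ?w x * ennreal (v x powr k) \<partial>lborel)" by (simp add: v_def powr_powr gk)
    also have "\<dots> \<le> ennreal (C * F powr k)" by (rule C(2)[OF v _ F]) (simp add: v_def)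
    also have "\<dots> \<le> ennreal (C * (g * ?X) powr k)"
      using C F F' k by (intro ennreal_leI mult_left_mono powr_mono2) auto
    finally have J1: "J \<le> C * (g * ?X) powr k"
      using C by (simp add: ennreal_le_iff)
    have "J powr (1 / q) \<le> C' * P powr (1 / p)"
    proof (cases "J = 0")
      case False
      then have J0: "J > 0" using J by simp
      have "J = J powr (k / p') * J powr (k / q)" using J0 kp by (simp add: powr_add[symmetric] kp[symmetric])
      moreover have "(g * ?X) powr k = (g * P powr (1 / p)) powr k * J powr (k / p')"
        using g by (simp add: powr_mult powr_powr mult.assoc)
      ultimately have "J powr (k / p') * J powr (k / q) \<le> J powr (k / p') * (C * (g * P powr (1 / p)) powr k)"
        using J1 by (simp add: mult_ac)
      then have "J powr (k / q) \<le> C * (g * P powr (1 / p)) powr k" using J0 by simp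
      then have "(J powr (k / q)) powr (1 / k) \<le> (C * (g * P powr (1 / p)) powr k) powr (1 / k)"
        using k by (intro powr_mono2) auto
      then show ?thesis using k C g by (simp add: powr_powr powr_mult C'_def)
    qed (use C' in simp)
    then have "ennreal (J powr (1 / q)) \<le> ennreal C' * ennreal (P powr (1 / p))"
      using C' by (simp add: ennreal_mult'[symmetric] ennreal_leI)
    then show ?thesis
      using lp_norm_real[OF J(2,1)] lp_norm_real[OF P(2,1)] by simp
  qed
  with C' that show ?thesis unfolding q_def by blast
qed

theorem sobolev_const_finite:
  fixes A :: "real^'n"
  assumes A: "\<And>i. 0 \<le> A $ i" and p: "1 < p" "p < hom_dim A"
  shows "sobolev_const A p < \<infinity>"
proof -
  obtain C where C: "C > 0" "\<And>u. u \<in> C1_c \<Longrightarrow>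
    lp_norm (monomial_measure A) (hom_dim A * p / (hom_dim A - p)) u
      \<le> ennreal C * lp_norm (monomial_measure A) p (\<lambda>x. norm (grad u x))"
    by (rule monomial_sobolev_C1_c[OF A p]) (rule that)
  then have "sobolev_const A p \<le> ennreal C"
    unfolding sobolev_const_def using Cinf_c_subset_C1_c by (intro Inf_lower) auto
  then show ?thesis by (simp add: le_less_trans)
qed

section \<open>Uniqueness of the weak gradient\<close>

lemma Lp_convergence_powr:
  assumes p: "p > 0" and lim: "(\<lambda>n. lp_norm M p (d n)) \<longlonglongrightarrow> 0"
  shows "(\<lambda>n. \<integral>\<^sup>+x. ennreal (\<bar>d n x\<bar> powr p) \<partial>M) \<longlonglongrightarrow> 0"
proof (rule order_tendstoI)
  fix a :: ennreal assume "0 < a"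
  then obtain b where b: "0 < b" "b < a" using dense by blast
  then obtain e where e: "0 < e" "ennreal e < a" by (cases b) auto
  have "eventually (\<lambda>n. lp_norm M p (d n) < ennreal (e powr (1 / p))) sequentially"
    using lim e(1) by (intro order_tendstoD(2)) auto
  then show "eventually (\<lambda>n. (\<integral>\<^sup>+x. ennreal (\<bar>d n x\<bar> powr p) \<partial>M) < a) sequentially"
  proof eventually_elim
    case (elim n)
    then have "(\<integral>\<^sup>+x. ennreal (\<bar>d n x\<bar> powr p) \<partial>M) \<le> ennreal ((e powr (1 / p)) powr p)"
      using lp_norm_le_iff[OF p, of "e powr (1 / p)" M "d n"] by (simp add: less_imp_le)
    also have "\<dots> = ennreal e" using e p by (simp add: powr_powr)
    finally show ?case using e(2) by simp
  qed
qed simp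

text \<open>
  A compact set off the coordinate hyperplanes: the weight is bounded away from zero on it. With growing
  \<open>r\<close> these sets exhaust the complement of the hyperplanes.
\<close>

definition annulus :: "real \<Rightarrow> (real^'n) set" where
  "annulus r = {x. \<forall>i. inverse r \<le> \<bar>x $ i\<bar> \<and> \<bar>x $ i\<bar> \<le> r}"

lemma annulus_subset_cube: "annulus r \<subseteq> cube r"
  by (auto simp: annulus_def mem_cube)

lemma closed_annulus: "closed (annulus r :: (real^'n) set)"
proof -
  have "annulus r = (\<Inter>i. {x :: real^'n. inverse r \<le> \<bar>x $ i\<bar>} \<inter> {x. \<bar>x $ i\<bar> \<le> r})"
    by (auto simp: annulus_def)
  moreover have "closed \<dots>"
    by (intro closed_INT ballI closed_Int closed_Collect_le continuous_intros)
  ultimately show ?thesis by simp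
qed

lemma annulus_lebesgue [measurable]: "annulus r \<in> sets lebesgue"
  by (intro sets_completionI_sets) (simp add: borel_closed closed_annulus)

text \<open>
  On the annulus the weight is at least a positive constant, so that the unweighted integral of the
  power \<open>p\<close> tends to zero. The power \<open>1\<close> is compared with it by
  \<open>t \<le> \<epsilon> + \<epsilon> powr (1 - p) * t powr p\<close>, which distinguishes \<open>t \<le> \<epsilon>\<close> from \<open>t > \<epsilon>\<close>.
\<close>

lemma local_L1_convergence:
  fixes A :: "real^'n"
  assumes A: "\<And>i. 0 \<le> A $ i" and p: "p \<ge> 1" and r: "r > 0"
    and m: "\<And>n. d n \<in> borel_measurable lebesgue"
    and lim: "(\<lambda>n. lp_norm (monomial_measure A) p (d n)) \<longlonglongrightarrow> 0"
    and e: "e > 0"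
  shows "eventually (\<lambda>n. (\<integral>\<^sup>+x. ennreal \<bar>d n x\<bar> * indicator (annulus r) x \<partial>lebesgue) \<le> ennreal e) sequentially"
proof -
  let ?B = "annulus r :: (real^'n) set"
  define c where "c = monomial_weight A (vec (inverse r))"
  have c: "c > 0" unfolding c_def using r by (intro monomial_weight_pos) auto
  have "emeasure lebesgue ?B \<le> emeasure lebesgue (cube r :: (real^'n) set)"
    by (intro emeasure_mono annulus_subset_cube) (simp add: borel_closed closed_cube sets_completionI_sets)
  also have "\<dots> < \<infinity>"
    using emeasure_compact_finite[OF compact_cube] by (simp add: borel_closed closed_cube)
  finally obtain V where V: "V \<ge> 0" "emeasure lebesgue ?B = ennreal V"
    by (cases "emeasure lebesgue ?B") auto
  \<comment> \<open>Adding one to the volume avoids a division by zero.\<close>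
  define \<epsilon> where "\<epsilon> = e / (2 * (V + 1))"
  have \<epsilon>: "\<epsilon> > 0" using e V by (simp add: \<epsilon>_def)
  define K where "K = \<epsilon> powr (1 - p) / c"
  have K: "K > 0" using \<epsilon> c by (simp add: K_def)
  have "eventually (\<lambda>n. (\<integral>\<^sup>+x. ennreal (\<bar>d n x\<bar> powr p) \<partial>monomial_measure A) < ennreal (e / (2 * K))) sequentially"
    using Lp_convergence_powr[OF _ lim] p e K by (intro order_tendstoD(2)) auto
  then show ?thesis
  proof eventually_elim
    case (elim n)
    have [measurable]: "d n \<in> borel_measurable lebesgue" by (rule m)
    have [measurable]: "monomial_weight A \<in> borel_measurable lebesgue"
      by (rule borel_imp_lebesgue_measurable) measurable
    have pw: "ennreal \<bar>d n x\<bar> * indicator ?B x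
        \<le> ennreal \<epsilon> * indicator ?B x + ennreal K * (ennreal (monomial_weight A x) * ennreal (\<bar>d n x\<bar> powr p))" for x
    proof (cases "x \<in> ?B")
      case True
      let ?t = "\<bar>d n x\<bar>"
      have w: "c \<le> monomial_weight A x"
        unfolding c_def by (rule monomial_weight_mono[OF A]) (use True r in \<open>auto simp: annulus_def\<close>)
      have "?t \<le> \<epsilon> + \<epsilon> powr (1 - p) * ?t powr p"
      proof (cases "?t \<le> \<epsilon>")
        case False
        then have "1 \<le> (?t / \<epsilon>) powr (p - 1)" using \<epsilon> p by (intro ge_one_powr_ge_zero) auto
        then have "?t * 1 \<le> ?t * (?t / \<epsilon>) powr (p - 1)" by (intro mult_left_mono) auto
        also have "\<dots> = \<epsilon> powr (1 - p) * ?t powr p"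
          using False \<epsilon> by (simp add: powr_divide powr_diff)
        finally show ?thesis using \<epsilon> by simp
      qed (use \<epsilon> in \<open>simp add: add_increasing2\<close>)
      moreover have "\<epsilon> powr (1 - p) * ?t powr p \<le> K * (monomial_weight A x * ?t powr p)"
      proof -
        have "\<epsilon> powr (1 - p) * ?t powr p = K * (c * ?t powr p)" using c by (simp add: K_def)
        also have "\<dots> \<le> K * (monomial_weight A x * ?t powr p)"
          using K w by (intro mult_left_mono mult_right_mono) auto
        finally show ?thesis .
      qed
      ultimately have "ennreal ?t \<le> ennreal (\<epsilon> + K * (monomial_weight A x * ?t powr p))"
        by (intro ennreal_leI) linarith
      also have "\<dots> = ennreal \<epsilon> + ennreal K * (ennreal (monomial_weight A x) * ennreal (?t powr p))"
        using \<epsilon> K monomial_weight_nonneg[of A x] by (simp add: ennreal_plus ennreal_mult)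
      finally show ?thesis using True by simp
    qed simp
    have "(\<integral>\<^sup>+x. ennreal \<bar>d n x\<bar> * indicator ?B x \<partial>lebesgue)
        \<le> (\<integral>\<^sup>+x. ennreal \<epsilon> * indicator ?B x + ennreal K * (ennreal (monomial_weight A x) * ennreal (\<bar>d n x\<bar> powr p)) \<partial>lebesgue)"
      by (intro nn_integral_mono pw)
    also have "\<dots> = ennreal \<epsilon> * emeasure lebesgue ?B + ennreal K *
        (\<integral>\<^sup>+x. ennreal (monomial_weight A x) * ennreal (\<bar>d n x\<bar> powr p) \<partial>lebesgue)"
      by (subst nn_integral_add) (auto simp: nn_integral_cmult nn_integral_cmult_indicator)
    also have "(\<integral>\<^sup>+x. ennreal (monomial_weight A x) * ennreal (\<bar>d n x\<bar> powr p) \<partial>lebesgue)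
        = (\<integral>\<^sup>+x. ennreal (\<bar>d n x\<bar> powr p) \<partial>monomial_measure A)"
      by (rule nn_integral_monomial_measure_lebesgue[symmetric]) measurable
    also have "ennreal \<epsilon> * emeasure lebesgue ?B + ennreal K * (\<integral>\<^sup>+x. ennreal (\<bar>d n x\<bar> powr p) \<partial>monomial_measure A)
        \<le> ennreal \<epsilon> * ennreal V + ennreal K * ennreal (e / (2 * K))"
      using elim V by (intro add_mono mult_left_mono) (auto simp: less_imp_le)
    also have "\<dots> = ennreal (\<epsilon> * V + K * (e / (2 * K)))"
      using \<epsilon> K V e by (subst ennreal_linear_combination) auto
    also have "\<dots> \<le> ennreal e"
    proof (rule ennreal_leI)
      have "\<epsilon> * V \<le> \<epsilon> * (V + 1)" using \<epsilon> by simp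
      also have "\<dots> = e / 2" using V by (simp add: \<epsilon>_def field_simps)
      finally show "\<epsilon> * V + K * (e / (2 * K)) \<le> e" using K by simp
    qed
    finally show ?case .
  qed
qed

lemma C1_c_diff:
  assumes v: "v \<in> C1_c" and w: "w \<in> C1_c"
  shows "(\<lambda>x. v x - w x) \<in> C1_c" "grad (\<lambda>x. v x - w x) = (\<lambda>x. grad v x - grad w x)"
proof -
  obtain R where R: "\<And>x. x \<notin> cube R \<Longrightarrow> v x = 0"
    using C1_c_D(4)[OF v] compactly_supported_cube by blast
  obtain S where S: "\<And>x. x \<notin> cube S \<Longrightarrow> w x = 0"
    using C1_c_D(4)[OF w] compactly_supported_cube by blast
  have D: "GDERIV (\<lambda>x. v x - w x) x :> grad v x - grad w x" for x
    by (intro GDERIV_diff C1_c_D(1) v w)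
  have c: "continuous_on UNIV (\<lambda>x. grad v x - grad w x)"
    by (intro continuous_intros C1_c_D(3) v w)
  have 0: "v x - w x = 0" if "x \<notin> cube (max R S)" for x
  proof -
    have "x \<notin> cube R" "x \<notin> cube S"
      using that cube_mono[of R "max R S"] cube_mono[of S "max R S"] by auto
    then show ?thesis using R S by simp
  qed
  show "(\<lambda>x. v x - w x) \<in> C1_c" by (rule C1_c_I(1)[OF D c 0])
  show "grad (\<lambda>x. v x - w x) = (\<lambda>x. grad v x - grad w x)" by (rule C1_c_I(2)[OF D c 0])
qed

lemma has_sobolev_gradE:
  assumes "has_sobolev_grad A p u g"
  obtains v where "\<And>n. v n \<in> C1_c" "u \<in> borel_measurable lebesgue" "g \<in> borel_measurable lebesgue"
    "(\<lambda>n. lp_norm (monomial_measure A) p (\<lambda>x. v n x - u x)) \<longlonglongrightarrow> 0"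
    "(\<lambda>n. lp_norm (monomial_measure A) p (\<lambda>x. norm (grad (v n) x - g x))) \<longlonglongrightarrow> 0"
proof -
  obtain v where v: "\<forall>n::nat. v n \<in> C1_c" and lim: "(\<lambda>n. lp_norm (monomial_measure A) p (\<lambda>x. v n x - u x) +
               lp_norm (monomial_measure A) p (\<lambda>x. norm (grad (v n) x - g x))) \<longlonglongrightarrow> 0"
    and m: "u \<in> borel_measurable (monomial_measure A)" "g \<in> borel_measurable (monomial_measure A)"
    using assms unfolding has_sobolev_grad_def by blast
  have m': "u \<in> borel_measurable lebesgue" "g \<in> borel_measurable lebesgue"
    using m by (simp_all add: measurable_cong_sets[OF sets_monomial_measure refl])
  show ?thesis
  proof (rule that[OF _ m'])
    show "v n \<in> C1_c" for n using v by blast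
    show "(\<lambda>n. lp_norm (monomial_measure A) p (\<lambda>x. v n x - u x)) \<longlonglongrightarrow> 0"
      by (rule tendsto_sandwich[OF _ _ tendsto_const lim]) auto
    show "(\<lambda>n. lp_norm (monomial_measure A) p (\<lambda>x. norm (grad (v n) x - g x))) \<longlonglongrightarrow> 0"
      by (rule tendsto_sandwich[OF _ _ tendsto_const lim]) auto
  qed
qed

lemma borel_vec_nth:
  fixes f :: "'a \<Rightarrow> real^'n"
  shows "f \<in> borel_measurable M \<Longrightarrow> (\<lambda>x. f x $ i) \<in> borel_measurable M"
  by (rule measurable_compose) (auto intro!: borel_measurable_continuous_onI continuous_intros)

text \<open>
  Let \<open>v n\<close> and \<open>v' n\<close> be the two approximating sequences. Both converge to the same \<open>u\<close>, so that the
  difference \<open>w n\<close> tends to zero and its gradient to \<open>g - g'\<close>, in the mean on the annulus. Integrating by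
  parts against a test function supported in the annulus, the integral with the gradient of \<open>w n\<close> equals, up to the
  sign, an integral with \<open>w n\<close> itself, and this tends to zero.
\<close>

lemma sobolev_grad_difference_locally_null:
  fixes A :: "real^'n" and g g' :: "real^'n \<Rightarrow> real^'n"
  assumes A: "\<And>i. 0 \<le> A $ i" and p: "p \<ge> 1" "p' \<ge> 1" and r: "r > 0"
    and g: "has_sobolev_grad A p u g" and g': "has_sobolev_grad A p' u g'"
  shows "integrable lebesgue (\<lambda>x. indicator (annulus r) x * (g x $ i - g' x $ i))"
    and "\<And>\<phi>. \<phi> \<in> C1_c \<Longrightarrow> (\<And>x. x \<notin> annulus r \<Longrightarrow> \<phi> x = 0) \<Longrightarrow>
      (\<integral>x. \<phi> x * (indicator (annulus r) x * (g x $ i - g' x $ i)) \<partial>lebesgue) = 0"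
proof -
  let ?B = "annulus r :: (real^'n) set"
  let ?G = "\<lambda>x. indicator ?B x * (g x $ i - g' x $ i)"
  let ?N = "\<lambda>c. \<integral>\<^sup>+x. ennreal (c x) * indicator ?B x \<partial>lebesgue"
  obtain v where v: "\<And>n. v n \<in> C1_c" and mu: "u \<in> borel_measurable lebesgue" and mg: "g \<in> borel_measurable lebesgue"
    and lv: "(\<lambda>n. lp_norm (monomial_measure A) p (\<lambda>x. v n x - u x)) \<longlonglongrightarrow> 0"
    "(\<lambda>n. lp_norm (monomial_measure A) p (\<lambda>x. norm (grad (v n) x - g x))) \<longlonglongrightarrow> 0"
    by (rule has_sobolev_gradE[OF g]) (rule that)
  obtain v' where v': "\<And>n. v' n \<in> C1_c" and mg': "g' \<in> borel_measurable lebesgue"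
    and lv': "(\<lambda>n. lp_norm (monomial_measure A) p' (\<lambda>x. v' n x - u x)) \<longlonglongrightarrow> 0"
    "(\<lambda>n. lp_norm (monomial_measure A) p' (\<lambda>x. norm (grad (v' n) x - g' x))) \<longlonglongrightarrow> 0"
    by (rule has_sobolev_gradE[OF g']) (rule that)
  note [measurable] = mu mg mg'
  have [measurable]: "(indicator ?B :: _ \<Rightarrow> ennreal) \<in> borel_measurable lebesgue"
    "(indicator ?B :: _ \<Rightarrow> real) \<in> borel_measurable lebesgue"
    by (rule borel_measurable_indicator[OF annulus_lebesgue])+
  have [measurable]: "v n \<in> borel_measurable lebesgue" "v' n \<in> borel_measurable lebesgue"
    "grad (v n) \<in> borel_measurable lebesgue" "grad (v' n) \<in> borel_measurable lebesgue" for n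
    using C1_c_measurable[OF v] C1_c_measurable[OF v'] by (auto intro: borel_imp_lebesgue_measurable)
  define w where "w n x = v n x - v' n x" for n x
  have w: "w n \<in> C1_c" "grad (w n) x = grad (v n) x - grad (v' n) x" for n x
    using C1_c_diff[OF v v'] by (auto simp: w_def[abs_def])
  let ?W = "\<lambda>n x. indicator ?B x * grad (w n) x $ i"
  define a where "a n x = \<bar>v n x - u x\<bar> + \<bar>v' n x - u x\<bar>" for n x
  define b where "b n x = norm (grad (v n) x - g x) + norm (grad (v' n) x - g' x)" for n x
  have [measurable]: "a n \<in> borel_measurable lebesgue" "b n \<in> borel_measurable lebesgue" for n
    unfolding a_def[abs_def] b_def[abs_def] by measurable
  have ab0: "0 \<le> a n x" "0 \<le> b n x" for n x by (auto simp: a_def b_def)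
  have wa: "\<bar>w n x\<bar> \<le> a n x" for n x by (simp add: w_def a_def)
  have wb: "\<bar>grad (w n) x $ i - (g x $ i - g' x $ i)\<bar> \<le> b n x" for n x
  proof -
    have "\<bar>grad (w n) x $ i - (g x $ i - g' x $ i)\<bar> \<le> \<bar>(grad (v n) x - g x) $ i\<bar> + \<bar>(grad (v' n) x - g' x) $ i\<bar>"
      unfolding w(2) by simp
    also have "\<dots> \<le> b n x" unfolding b_def by (intro add_mono component_le_norm_cart)
    finally show ?thesis .
  qed
  have small: "\<exists>n. ?N (a n) \<le> ennreal (2 * e) \<and>
      ?N (b n) \<le> ennreal (2 * e)" if e: "e > 0" for e
  proof -
    have "eventually (\<lambda>n. ?N (\<lambda>x. \<bar>v n x - u x\<bar>) \<le> ennreal e) sequentially"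
      by (rule local_L1_convergence[OF A p(1) r _ lv(1) e]) measurable
    moreover have "eventually (\<lambda>n. ?N (\<lambda>x. \<bar>v' n x - u x\<bar>) \<le> ennreal e) sequentially"
      by (rule local_L1_convergence[OF A p(2) r _ lv'(1) e]) measurable
    moreover have "eventually (\<lambda>n. ?N (\<lambda>x. \<bar>norm (grad (v n) x - g x)\<bar>) \<le> ennreal e) sequentially"
      by (rule local_L1_convergence[OF A p(1) r _ lv(2) e]) measurable
    moreover have "eventually (\<lambda>n. ?N (\<lambda>x. \<bar>norm (grad (v' n) x - g' x)\<bar>) \<le> ennreal e) sequentially"
      by (rule local_L1_convergence[OF A p(2) r _ lv'(2) e]) measurable
    ultimately have "eventually (\<lambda>n. ?N (a n) \<le> ennreal (2 * e) \<and>
      ?N (b n) \<le> ennreal (2 * e)) sequentially"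
    proof eventually_elim
      case (elim n)
      have "?N (a n)
          = ?N (\<lambda>x. \<bar>v n x - u x\<bar>) + ?N (\<lambda>x. \<bar>v' n x - u x\<bar>)"
        by (subst nn_integral_add[symmetric]) (auto simp: a_def ennreal_plus distrib_right)
      moreover have "?N (b n)
          = ?N (\<lambda>x. \<bar>norm (grad (v n) x - g x)\<bar>)
            + ?N (\<lambda>x. \<bar>norm (grad (v' n) x - g' x)\<bar>)"
        by (subst nn_integral_add[symmetric]) (auto simp: b_def ennreal_plus distrib_right)
      moreover have "ennreal e + ennreal e = ennreal (2 * e)" using e by (simp add: ennreal_plus[symmetric] del: ennreal_plus)
      ultimately show ?case using add_mono[OF elim(1,2)] add_mono[OF elim(3,4)] by simp
    qed
    then show ?thesis using eventually_happens'[OF sequentially_bot] by blast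
  qed
  have igw: "integrable lebesgue (\<lambda>x. ?W n x)" for n
  proof -
    obtain R C where R: "\<And>x. x \<notin> cube R \<Longrightarrow> grad (w n) x = 0" using C1_c_bounds[OF w(1)] by metis
    have i: "integrable lborel (\<lambda>x. grad (w n) x $ i)"
      by (rule integral_cube(1)[of _ R]) (use R in \<open>auto intro!: continuous_on_component C1_c_D(3)[OF w(1)]\<close>)
    then have "integrable lebesgue (\<lambda>x. grad (w n) x $ i)"
      by (subst integrable_completion) (auto intro: borel_measurable_integrable)
    from integrable_mult_indicator[OF annulus_lebesgue[of r] this] show ?thesis by (simp only: real_scaleR_def)
  qed
  have diff_int: "integrable lebesgue (\<lambda>x. ?G x - ?W n x)"
    if "?N (b n) \<le> ennreal (2 * e)" for n e
  proof (rule integrableI_bounded)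
    show "(\<lambda>x. ?G x - ?W n x) \<in> borel_measurable lebesgue"
      by (intro borel_measurable_diff borel_measurable_times borel_measurable_indicator annulus_lebesgue
          borel_vec_nth mg mg' borel_measurable_integrable[OF igw])
    have "(\<integral>\<^sup>+x. ennreal (norm (?G x - ?W n x)) \<partial>lebesgue)
        \<le> ?N (b n)"
      using wb[of n] by (intro nn_integral_mono) (auto simp: indicator_def abs_minus_commute intro!: ennreal_leI)
    also have "\<dots> \<le> ennreal (2 * e)" by (rule that)
    finally show "(\<integral>\<^sup>+x. ennreal (norm (?G x - ?W n x)) \<partial>lebesgue) < \<infinity>"
      by (simp add: le_less_trans)
  qed
  show iG: "integrable lebesgue ?G"
  proof -
    obtain n where "?N (b n) \<le> ennreal (2 * 1)"
      using small[of 1] by auto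
    from Bochner_Integration.integrable_add[OF diff_int[OF this] igw[of n]] show ?thesis by simp
  qed
  fix \<phi> :: "real^'n \<Rightarrow> real"
  assume \<phi>: "\<phi> \<in> C1_c" and out: "\<And>x. x \<notin> ?B \<Longrightarrow> \<phi> x = 0"
  let ?I = "\<integral>x. \<phi> x * ?G x \<partial>lebesgue"
  have gout: "grad \<phi> x = 0" if "x \<notin> ?B" for x
    by (rule grad_eq_0_outside_closed[OF closed_annulus out that])
  obtain M where M: "M > 0" "\<And>x. \<bar>\<phi> x\<bar> \<le> M" "\<And>x. norm (grad \<phi> x) \<le> M"
    using C1_c_bounds[OF \<phi>] by metis
  have m\<phi>: "\<phi> \<in> borel_measurable lebesgue" "grad \<phi> \<in> borel_measurable lebesgue"
    using C1_c_measurable[OF \<phi>] by (auto intro: borel_imp_lebesgue_measurable)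
  have \<phi>_int: "integrable lebesgue (\<lambda>x. \<phi> x * f x)" if f: "integrable lebesgue f" for f
  proof (rule Bochner_Integration.integrable_bound)
    show "integrable lebesgue (\<lambda>x. M * norm (f x))" using f by (intro integrable_mult_right integrable_norm)
    show "(\<lambda>x. \<phi> x * f x) \<in> borel_measurable lebesgue"
      by (rule borel_measurable_times[OF m\<phi>(1) borel_measurable_integrable[OF f]])
    have "\<bar>\<phi> x\<bar> * \<bar>f x\<bar> \<le> M * \<bar>f x\<bar>" for x using M(2) by (intro mult_right_mono) auto
    then show "AE x in lebesgue. norm (\<phi> x * f x) \<le> norm (M * norm (f x))"
      using M(1) by (simp add: abs_mult)
  qed
  have bound: "\<bar>?I\<bar> \<le> 4 * M * e" if e: "e > 0" for e
  proof -
    obtain n where n: "?N (a n) \<le> ennreal (2 * e)"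
      "?N (b n) \<le> ennreal (2 * e)"
      using small[OF e] by blast
    have est: "\<bar>\<integral>x. F x \<partial>lebesgue\<bar> \<le> 2 * M * e"
      if F: "\<And>x. \<bar>F x\<bar> \<le> M * (c x * indicator ?B x)"
      and c: "?N c \<le> ennreal (2 * e)"
      and mc: "c \<in> borel_measurable lebesgue" and c0: "\<And>x. 0 \<le> c x" for F c :: "real^'n \<Rightarrow> real"
    proof (cases "integrable lebesgue F")
      case False
      then show ?thesis using M e by (simp add: not_integrable_integral_eq)
    next
      case True
      have "ennreal (norm (\<integral>x. F x \<partial>lebesgue)) \<le> (\<integral>\<^sup>+x. ennreal (norm (F x)) \<partial>lebesgue)"
        by (rule integral_norm_bound_ennreal[OF True])
      also have "\<dots> \<le> (\<integral>\<^sup>+x. ennreal M * (ennreal (c x) * indicator ?B x) \<partial>lebesgue)"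
      proof (rule nn_integral_mono)
        fix x
        have "ennreal (norm (F x)) \<le> ennreal (M * (c x * indicator ?B x))" using F by (intro ennreal_leI) simp
        also have "\<dots> = ennreal M * (ennreal (c x) * indicator ?B x)"
          using M c0 by (auto simp: ennreal_mult indicator_def)
        finally show "ennreal (norm (F x)) \<le> ennreal M * (ennreal (c x) * indicator ?B x)" .
      qed
      also have "\<dots> = ennreal M * ?N c"
        by (intro nn_integral_cmult borel_measurable_times_ennreal borel_measurable_indicator
            annulus_lebesgue measurable_compose[OF mc]) simp
      also have "\<dots> \<le> ennreal M * ennreal (2 * e)" by (intro mult_left_mono c) auto
      also have "\<dots> = ennreal (2 * M * e)" using M e by (simp add: ennreal_mult[symmetric])
      finally show ?thesis using M e by (simp add: ennreal_le_iff)
    qed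
    have i1: "integrable lebesgue (\<lambda>x. \<phi> x * (?G x - ?W n x))"
      "integrable lebesgue (\<lambda>x. \<phi> x * ?W n x)"
      by (intro \<phi>_int diff_int[OF n(2)] igw)+
    have "?I = (\<integral>x. \<phi> x * (?G x - ?W n x)
        + \<phi> x * ?W n x \<partial>lebesgue)"
      by (intro Bochner_Integration.integral_cong) (auto simp: algebra_simps)
    also have "\<dots> = (\<integral>x. \<phi> x * (?G x - ?W n x) \<partial>lebesgue)
        + (\<integral>x. \<phi> x * ?W n x \<partial>lebesgue)"
      by (rule Bochner_Integration.integral_add[OF i1])
    also have "(\<integral>x. \<phi> x * ?W n x \<partial>lebesgue) = (\<integral>x. \<phi> x * grad (w n) x $ i \<partial>lebesgue)"
      using out by (intro Bochner_Integration.integral_cong) (auto simp: indicator_def)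
    also have "\<dots> = (\<integral>x. \<phi> x * grad (w n) x $ i \<partial>lborel)"
      using C1_c_measurable[OF \<phi>] C1_c_measurable[OF w(1)]
      by (intro integral_completion borel_measurable_times borel_vec_nth) auto
    also have "\<dots> = - (\<integral>x. grad \<phi> x $ i * w n x \<partial>lborel)"
      by (rule integration_by_parts[OF \<phi>]) (use w(1) in \<open>simp add: C1_c_def del: Ck.simps One_nat_def\<close>)
    also have "(\<integral>x. grad \<phi> x $ i * w n x \<partial>lborel) = (\<integral>x. grad \<phi> x $ i * w n x \<partial>lebesgue)"
      using C1_c_measurable[OF \<phi>] C1_c_measurable[OF w(1)]
      by (intro integral_completion[symmetric] borel_measurable_times borel_vec_nth) auto
    finally have eq: "?I = (\<integral>x. \<phi> x * (?G x - ?W n x) \<partial>lebesgue)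
        + - (\<integral>x. grad \<phi> x $ i * w n x \<partial>lebesgue)" .
    have "\<bar>\<integral>x. \<phi> x * (?G x - ?W n x) \<partial>lebesgue\<bar> \<le> 2 * M * e"
    proof (rule est[OF _ n(2)])
      fix x
      show "\<bar>\<phi> x * (?G x - ?W n x)\<bar> \<le> M * (b n x * indicator ?B x)"
        using M(2)[of x] wb[of n x] ab0[of n x]
        by (auto simp: abs_mult indicator_def abs_minus_commute intro!: mult_mono)
    qed (use ab0 in auto)
    moreover have "\<bar>\<integral>x. grad \<phi> x $ i * w n x \<partial>lebesgue\<bar> \<le> 2 * M * e"
    proof (rule est[OF _ n(1)])
      fix x
      have "\<bar>grad \<phi> x $ i\<bar> \<le> M" using M(3) component_le_norm_cart order_trans by blast
      then show "\<bar>grad \<phi> x $ i * w n x\<bar> \<le> M * (a n x * indicator ?B x)"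
        using gout[of x] wa[of n x] ab0[of n x] M(1)
        by (cases "x \<in> ?B") (auto simp: abs_mult intro!: mult_mono)
    qed (use ab0 in auto)
    ultimately show ?thesis unfolding eq by linarith
  qed
  show "?I = 0"
  proof (rule ccontr)
    assume "?I \<noteq> 0"
    then have pos: "\<bar>?I\<bar> > 0" by simp
    then have "\<bar>?I\<bar> \<le> \<bar>?I\<bar> / 2"
      using bound[of "\<bar>?I\<bar> / (8 * M)"] M(1) by simp
    with pos show False by simp
  qed
qed

text \<open>
  The functions \<open>1 - exp (- k * bump a b)\<close> are admissible test functions. They are bounded by one and
  converge to the indicator of the open box.
\<close>

lemma sobolev_grad_difference_box:
  fixes A :: "real^'n" and g g' :: "real^'n \<Rightarrow> real^'n"
  assumes A: "\<And>i. 0 \<le> A $ i" and p: "p \<ge> 1" "p' \<ge> 1" and r: "r > 0"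
    and g: "has_sobolev_grad A p u g" and g': "has_sobolev_grad A p' u g'"
    and ab: "cbox a b \<subseteq> annulus r"
  shows "integral (cbox a b) (\<lambda>x. indicator (annulus r) x * (g x $ i - g' x $ i)) = 0"
proof -
  let ?G = "\<lambda>x. indicator (annulus r) x * (g x $ i - g' x $ i)"
  note N = sobolev_grad_difference_locally_null[OF A p r g g', where i = i]
  define \<phi> where "\<phi> k x = 1 - exp (- real k * bump a b x)" for k :: nat and x
  have v: "bump a b \<in> C1_c" using bump_Cinf_c Cinf_c_subset_C1_c by blast
  have \<phi>: "\<phi> k \<in> C1_c" for k
  proof -
    have "(\<lambda>x. (\<lambda>t. 1 - exp (- real k * t)) (bump a b x)) \<in> C1_c"
    proof (rule C1_c_compose(1)[OF v])
      show "DERIV (\<lambda>t. 1 - exp (- real k * t)) t :> real k * exp (- real k * t)" for t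
        by (auto intro!: derivative_eq_intros)
    qed (auto intro!: continuous_intros)
    then show ?thesis by (simp add: \<phi>_def[abs_def])
  qed
  have out: "\<phi> k x = 0" if "x \<notin> box a b" for k x using that by (simp add: \<phi>_def bump_eq_0)
  have zero: "(\<integral>x. \<phi> k x * ?G x \<partial>lebesgue) = 0" for k
  proof (rule N(2)[OF \<phi>])
    show "\<phi> k x = 0" if "x \<notin> annulus r" for x
      using that ab box_subset_cbox[of a b] by (intro out) auto
  qed
  have m\<phi>: "\<phi> k \<in> borel_measurable lebesgue" for k
    by (intro borel_imp_lebesgue_measurable C1_c_measurable(1) \<phi>)
  have mG: "?G \<in> borel_measurable lebesgue" using N(1) by (rule borel_measurable_integrable)
  have mb: "box a b \<in> sets lebesgue" by (simp add: sets_completionI_sets)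
  have "(\<lambda>k. \<integral>x. \<phi> k x * ?G x \<partial>lebesgue) \<longlonglongrightarrow> (\<integral>x. indicator (box a b) x * ?G x \<partial>lebesgue)"
  proof (rule integral_dominated_convergence[where w = "\<lambda>x. norm (?G x)"])
    show "(\<lambda>x. indicator (box a b) x * ?G x) \<in> borel_measurable lebesgue"
      by (rule borel_measurable_times[OF borel_measurable_indicator[OF mb] mG])
    show "(\<lambda>x. \<phi> k x * ?G x) \<in> borel_measurable lebesgue" for k
      by (rule borel_measurable_times[OF m\<phi> mG])
    show "integrable lebesgue (\<lambda>x. norm (?G x))" by (rule integrable_norm[OF N(1)])
    show "AE x in lebesgue. (\<lambda>k. \<phi> k x * ?G x) \<longlonglongrightarrow> indicator (box a b) x * ?G x"
    proof (intro AE_I2 tendsto_mult tendsto_const)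
      fix x
      show "(\<lambda>k. \<phi> k x) \<longlonglongrightarrow> indicator (box a b) x"
      proof (cases "x \<in> box a b")
        case True
        then have "filterlim (\<lambda>k. bump a b x * real k) at_top sequentially"
          using bump_pos_iff[of a b x]
          by (intro filterlim_tendsto_pos_mult_at_top[OF tendsto_const]) (auto intro: filterlim_real_sequentially)
        then have "filterlim (\<lambda>k. - (bump a b x * real k)) at_bot sequentially"
          by (simp add: filterlim_uminus_at_top)
        then have "(\<lambda>k. exp (- (bump a b x * real k))) \<longlonglongrightarrow> 0"
          by (rule filterlim_compose[OF exp_at_bot])
        then have "(\<lambda>k. 1 - exp (- (bump a b x * real k))) \<longlonglongrightarrow> 1 - 0" by (intro tendsto_intros)
        then show ?thesis using True by (simp add: \<phi>_def mult.commute)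
      qed (simp add: out)
    qed
    have "\<bar>\<phi> k x\<bar> \<le> 1" for k x
      using bump_nonneg[of a b x] by (simp add: \<phi>_def)
    then have "\<bar>\<phi> k x\<bar> * \<bar>?G x\<bar> \<le> 1 * \<bar>?G x\<bar>" for k x by (intro mult_right_mono) auto
    then show "AE x in lebesgue. norm (\<phi> k x * ?G x) \<le> norm (?G x)" for k by (simp add: abs_mult)
  qed
  then have "(\<integral>x. indicator (box a b) x * ?G x \<partial>lebesgue) = 0"
    unfolding zero by (simp add: LIMSEQ_const_iff)
  moreover have "set_integrable lebesgue (box a b) ?G"
    unfolding set_integrable_def by (rule integrable_mult_indicator[OF mb N(1)])
  ultimately have "integral (box a b) ?G = 0"
    using set_lebesgue_integral_eq_integral(2) unfolding set_lebesgue_integral_def by fastforce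
  then show ?thesis by (simp only: integral_open_interval)
qed

text \<open>
  The integrals of \<open>g - g'\<close> over all small boxes off the hyperplanes vanish, so that by Lebesgue's
  differentiation theorem \<open>g - g'\<close> vanishes almost everywhere in every annulus. Countably many annuli suffice, as
  the coordinates of a point that are all nonzero lie strictly between \<open>inverse m\<close> and \<open>m\<close> in absolute value for large \<open>m\<close>.
\<close>

lemma sobolev_grad_unique:
  fixes A :: "real^'n" and g g' :: "real^'n \<Rightarrow> real^'n"
  assumes A: "\<And>i. 0 \<le> A $ i" and p: "p \<ge> 1" "p' \<ge> 1"
    and g: "has_sobolev_grad A p u g" and g': "has_sobolev_grad A p' u g'"
  shows "AE x in lebesgue. g x = g' x"
proof -
  have local: "AE x in lebesgue. (\<forall>j. inverse r < \<bar>x $ j\<bar> \<and> \<bar>x $ j\<bar> < r) \<longrightarrow> g x $ i = g' x $ i" if r: "r > 0" for r i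
  proof -
    let ?G = "\<lambda>x. indicator (annulus r) x * (g x $ i - g' x $ i)"
    let ?U = "{x::real^'n. \<forall>j. inverse r < \<bar>x $ j\<bar> \<and> \<bar>x $ j\<bar> < r}"
    have U: "open ?U"
    proof -
      have "?U = (\<Inter>j. {x. inverse r < \<bar>x $ j\<bar>} \<inter> {x. \<bar>x $ j\<bar> < r})" by auto
      moreover have "open \<dots>"
        by (intro open_INT ballI open_Int open_Collect_less continuous_intros) auto
      ultimately show ?thesis by simp
    qed
    have "?G integrable_on UNIV"
      by (rule integrable_on_lebesgue[OF sobolev_grad_difference_locally_null(1)[OF A p r g g']])
    then have "?G integrable_on cbox a b" for a b by (rule integrable_on_subcbox) simp
    then obtain N where N: "negligible N" "\<And>x e. x \<notin> N \<Longrightarrow> 0 < e \<Longrightarrow> \<exists>d>0. \<forall>h. 0 < h \<and> h < d \<longrightarrow>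
        norm (integral (cbox x (x + h *\<^sub>R One)) ?G /\<^sub>R h ^ DIM(real^'n) - ?G x) < e"
      by (rule integrable_ccontinuous_explicit) (rule that)
    have zero: "g x $ i = g' x $ i" if x: "x \<notin> N" "x \<in> ?U" for x
    proof (rule ccontr)
      assume "g x $ i \<noteq> g' x $ i"
      then have "?G x \<noteq> 0" using x(2) by (auto simp: annulus_def less_imp_le)
      then have "norm (?G x) > 0" by simp
      from N(2)[OF x(1) this] obtain d where d: "d > 0" "\<And>h. 0 < h \<Longrightarrow> h < d \<Longrightarrow>
        norm (integral (cbox x (x + h *\<^sub>R One)) ?G /\<^sub>R h ^ DIM(real^'n) - ?G x) < norm (?G x)" by blast
      obtain e where e: "e > 0" "ball x e \<subseteq> ?U" using U x(2) open_contains_ball by blast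
      define h where "h = min (d / 2) (e / (2 * DIM(real^'n)))"
      have h: "h > 0" "h < d" "DIM(real^'n) * h < e"
        using d e by (auto simp: h_def min_def field_simps)
      have "cbox x (x + h *\<^sub>R One) \<subseteq> annulus r"
      proof
        fix y assume y: "y \<in> cbox x (x + h *\<^sub>R One)"
        have "norm (y - x) \<le> (\<Sum>b\<in>(Basis :: (real^'n) set). \<bar>(y - x) \<bullet> b\<bar>)" by (rule norm_le_l1)
        also have "\<dots> \<le> (\<Sum>b\<in>(Basis :: (real^'n) set). h)"
        proof (rule sum_mono)
          fix b :: "real^'n" assume b: "b \<in> Basis"
          then have "x \<bullet> b \<le> y \<bullet> b" "y \<bullet> b \<le> x \<bullet> b + h"
            using y by (auto simp: mem_box inner_add_left)
          then show "\<bar>(y - x) \<bullet> b\<bar> \<le> h" by (simp add: inner_diff_left)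
        qed
        also have "\<dots> < e" using h by simp
        finally have "y \<in> ball x e" by (simp add: dist_norm norm_minus_commute)
        then show "y \<in> annulus r" using e(2) by (auto simp: annulus_def less_imp_le)
      qed
      from sobolev_grad_difference_box[OF A p r g g' this, of i] d(2)[OF h(1,2)]
      show False by simp
    qed
    have "N \<in> null_sets lebesgue" using N(1) negligible_iff_null_sets by blast
    then have "AE x in lebesgue. x \<notin> N" by (rule AE_not_in)
    then show ?thesis by eventually_elim (use zero in auto)
  qed
  have "AE x in lebesgue. \<forall>i. \<forall>m::nat. (\<forall>j. inverse (real (Suc m)) < \<bar>x $ j\<bar> \<and> \<bar>x $ j\<bar> < real (Suc m)) \<longrightarrow> g x $ i = g' x $ i"
    unfolding AE_all_countable by (intro allI local) auto
  with AE_components_nonzero show ?thesis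
  proof eventually_elim
    case (elim x)
    have "\<forall>j. \<exists>k::nat. 1 / \<bar>x $ j\<bar> < real k \<and> \<bar>x $ j\<bar> < real k"
    proof
      fix j
      obtain k :: nat where "max (1 / \<bar>x $ j\<bar>) \<bar>x $ j\<bar> < real k" using reals_Archimedean2 by blast
      then show "\<exists>k::nat. 1 / \<bar>x $ j\<bar> < real k \<and> \<bar>x $ j\<bar> < real k" by auto
    qed
    then obtain k :: "'n \<Rightarrow> nat" where k: "\<And>j. 1 / \<bar>x $ j\<bar> < real (k j) \<and> \<bar>x $ j\<bar> < real (k j)" by metis
    define m where "m = Max (range k)"
    have "inverse (real (Suc m)) < \<bar>x $ j\<bar> \<and> \<bar>x $ j\<bar> < real (Suc m)" for j
    proof -
      have "k j \<le> m" unfolding m_def by (rule Max_ge) auto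
      then have le: "real (k j) \<le> real (Suc m)" by simp
      have "1 / \<bar>x $ j\<bar> < real (Suc m)" "\<bar>x $ j\<bar> < real (Suc m)" using k[of j] le by linarith+
      moreover have "\<bar>x $ j\<bar> > 0" using elim(1) by simp
      ultimately show ?thesis by (simp add: field_simps)
    qed
    then show ?case using elim(2) by (auto simp: vec_eq_iff)
  qed
qed

section \<open>Extension of the Sobolev inequality to the closure\<close>

lemma sobolev_inequality_C1_c:
  fixes A :: "real^'n"
  assumes A: "\<And>i. 0 \<le> A $ i" and p: "p > 0" and q: "q > 0" and c: "c \<ge> 0"
    and ineq: "\<And>u. u \<in> Cinf_c \<Longrightarrow> lp_norm (monomial_measure A) q u
        \<le> ennreal c * lp_norm (monomial_measure A) p (\<lambda>x. norm (grad u x))"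
    and v: "v \<in> C1_c"
  shows "lp_norm (monomial_measure A) q v \<le> ennreal c * lp_norm (monomial_measure A) p (\<lambda>x. norm (grad v x))"
proof -
  let ?M = "monomial_measure A"
  obtain \<phi> R B where \<phi>: "\<And>k::nat. \<phi> k \<in> Cinf_c" "R > 0"
    and out: "\<And>k x. x \<notin> cube R \<Longrightarrow> \<phi> k x = 0" "\<And>k x. x \<notin> cube R \<Longrightarrow> grad (\<phi> k) x = 0"
    and B: "\<And>k x. \<bar>\<phi> k x\<bar> \<le> B" "\<And>k x. norm (grad (\<phi> k) x) \<le> B"
    and lim: "\<And>x. (\<lambda>k. \<phi> k x) \<longlonglongrightarrow> v x" "\<And>x. (\<lambda>k. grad (\<phi> k) x) \<longlonglongrightarrow> grad v x"
    by (rule C1_c_smooth_approximation[OF v]) (rule that)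
  have \<phi>1: "\<phi> k \<in> C1_c" for k using \<phi>(1) Cinf_c_subset_C1_c by blast
  have mg: "(\<lambda>x. norm (grad u x)) \<in> borel_measurable borel" if "u \<in> C1_c" for u :: "real^'n \<Rightarrow> real"
    by (rule measurable_compose[OF C1_c_measurable(2)[OF that] borel_measurable_norm])
  obtain R' B' where R': "R' > 0" "\<And>x. x \<notin> cube R' \<Longrightarrow> grad v x = 0" "\<And>x. norm (grad v x) \<le> B'"
    using C1_c_bounds[OF v] by metis
  have fin: "lp_norm ?M p (\<lambda>x. norm (grad v x)) < \<infinity>"
    by (rule lp_norm_finite(1)[OF A p R'(1)]) (use R' in auto)
  have I: "(\<lambda>k. \<integral>\<^sup>+x. ennreal (\<bar>norm (grad (\<phi> k) x)\<bar> powr p) \<partial>?M) \<longlonglongrightarrow> (\<integral>\<^sup>+x. ennreal (\<bar>norm (grad v x)\<bar> powr p) \<partial>?M)"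
  proof (rule nn_integral_powr_tendsto[OF A \<phi>(2) mg[OF \<phi>1] mg[OF v], where B = B])
    show "(\<lambda>k. \<bar>norm (grad (\<phi> k) x)\<bar> powr p) \<longlonglongrightarrow> \<bar>norm (grad v x)\<bar> powr p" for x
      using p by (intro tendsto_powr2 tendsto_rabs tendsto_norm lim tendsto_const) auto
  qed (use B out p in auto)
  show ?thesis
  proof (rule lp_norm_limit_inequality[OF q p c _ _ _ fin])
    show "\<phi> k \<in> borel_measurable ?M" for k by (intro borel_imp_monomial_measurable C1_c_measurable(1) \<phi>1)
    show "AE x in ?M. (\<lambda>k. \<phi> k x) \<longlonglongrightarrow> v x" using lim by simp
    show "lp_norm ?M q (\<phi> k) \<le> ennreal c * lp_norm ?M p (\<lambda>x. norm (grad (\<phi> k) x))" for k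
      by (rule ineq[OF \<phi>(1)])
    fix L assume L: "lp_norm ?M p (\<lambda>x. norm (grad v x)) < ennreal L" "0 < L"
    then obtain l where l: "l \<ge> 0" "lp_norm ?M p (\<lambda>x. norm (grad v x)) = ennreal l" "l < L"
      by (cases "lp_norm ?M p (\<lambda>x. norm (grad v x))") (auto simp: ennreal_less_iff)
    have "(\<integral>\<^sup>+x. ennreal (\<bar>norm (grad v x)\<bar> powr p) \<partial>?M) \<le> ennreal (l powr p)"
      using l lp_norm_le_iff[OF p l(1), of ?M "\<lambda>x. norm (grad v x)"] by simp
    also have "\<dots> < ennreal (L powr p)" using l p by (auto simp: ennreal_less_iff intro!: powr_less_mono2)
    finally have "eventually (\<lambda>k. (\<integral>\<^sup>+x. ennreal (\<bar>norm (grad (\<phi> k) x)\<bar> powr p) \<partial>?M) < ennreal (L powr p)) sequentially"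
      by (rule order_tendstoD(2)[OF I])
    then show "eventually (\<lambda>k. lp_norm ?M p (\<lambda>x. norm (grad (\<phi> k) x)) \<le> ennreal L) sequentially"
    proof eventually_elim
      case (elim k)
      then show ?case using L(2) lp_norm_le_iff[OF p, of L ?M "\<lambda>x. norm (grad (\<phi> k) x)"] by (simp add: less_imp_le)
    qed
  qed
qed

lemma Lp_convergence_AE_subsequence:
  assumes p: "p > 0" and m: "\<And>n. d n \<in> borel_measurable M"
    and lim: "(\<lambda>n. lp_norm M p (d n)) \<longlonglongrightarrow> 0"
  obtains s :: "nat \<Rightarrow> nat" where "strict_mono s" "AE x in M. (\<lambda>n. d (s n) x) \<longlonglongrightarrow> 0"
proof -
  note I = Lp_convergence_powr[OF p lim]
  have "eventually (\<lambda>n. (\<integral>\<^sup>+x. ennreal (\<bar>d n x\<bar> powr p) \<partial>M) < \<infinity>) sequentially"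
    using I by (rule order_tendstoD) simp
  then obtain N where N: "\<And>n. n \<ge> N \<Longrightarrow> (\<integral>\<^sup>+x. ennreal (\<bar>d n x\<bar> powr p) \<partial>M) < \<infinity>"
    by (auto simp: eventually_sequentially)
  define U where "U n x = \<bar>d (n + N) x\<bar> powr p" for n x
  have mU: "U n \<in> borel_measurable M" for n
    unfolding U_def[abs_def] using m[of "n + N"] by measurable
  have iU: "integrable M (U n)" for n
    by (rule integrableI_bounded[OF mU]) (use N[of "n + N"] in \<open>simp add: U_def\<close>)
  have "(\<lambda>n. \<integral>x. norm (U n x) \<partial>M) \<longlonglongrightarrow> 0"
  proof -
    have "(\<lambda>n. \<integral>\<^sup>+x. ennreal (\<bar>d (n + N) x\<bar> powr p) \<partial>M) \<longlonglongrightarrow> ennreal 0"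
      using LIMSEQ_ignore_initial_segment[OF I, of N] by simp
    then have "(\<lambda>n. enn2real (\<integral>\<^sup>+x. ennreal (\<bar>d (n + N) x\<bar> powr p) \<partial>M)) \<longlonglongrightarrow> 0"
      by (rule tendsto_enn2real) simp
    moreover have "enn2real (\<integral>\<^sup>+x. ennreal (\<bar>d (n + N) x\<bar> powr p) \<partial>M) = (\<integral>x. norm (U n x) \<partial>M)" for n
      using integral_eq_nn_integral[of "U n" M] mU[of n] by (simp add: U_def[abs_def])
    ultimately show ?thesis by simp
  qed
  from tendsto_L1_AE_subseq[OF iU this] obtain s :: "nat \<Rightarrow> nat" where s: "strict_mono s" "AE x in M. (\<lambda>n. U (s n) x) \<longlonglongrightarrow> 0"
    by blast
  show ?thesis
  proof (rule that[of "\<lambda>n. s n + N"])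
    show "strict_mono (\<lambda>n. s n + N)" using s(1) by (auto simp: strict_mono_def)
    show "AE x in M. (\<lambda>n. d (s n + N) x) \<longlonglongrightarrow> 0"
      using s(2)
    proof eventually_elim
      case (elim x)
      then have "(\<lambda>n. U (s n) x powr (1 / p)) \<longlonglongrightarrow> 0 powr (1 / p)"
        using p by (intro tendsto_powr2 tendsto_const) (auto simp: U_def)
      then have "(\<lambda>n. \<bar>d (s n + N) x\<bar>) \<longlonglongrightarrow> 0" using p by (simp add: U_def powr_powr)
      then show ?case by (rule tendsto_rabs_zero_cancel)
    qed
  qed
qed

lemma sobolev_inequality_W1:
  fixes A :: "real^'n"
  assumes A: "\<And>i. 0 \<le> A $ i" and p: "p \<ge> 1" and q: "q > 0" and c: "c > 0"
    and ineq: "\<And>v. v \<in> C1_c \<Longrightarrow> lp_norm (monomial_measure A) q v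
        \<le> ennreal c * lp_norm (monomial_measure A) p (\<lambda>x. norm (grad v x))"
    and g: "has_sobolev_grad A p u g"
  shows "lp_norm (monomial_measure A) q u \<le> ennreal c * lp_norm (monomial_measure A) p (\<lambda>x. norm (g x))"
proof (cases "lp_norm (monomial_measure A) p (\<lambda>x. norm (g x)) = \<infinity>")
  case True
  then show ?thesis using c by (simp add: ennreal_mult_top)
next
  case False
  let ?M = "monomial_measure A"
  have p0: "p > 0" using p by simp
  obtain v where v: "\<And>n. v n \<in> C1_c" and mu: "u \<in> borel_measurable lebesgue" and mg: "g \<in> borel_measurable lebesgue"
    and lv: "(\<lambda>n. lp_norm ?M p (\<lambda>x. v n x - u x)) \<longlonglongrightarrow> 0"
    "(\<lambda>n. lp_norm ?M p (\<lambda>x. norm (grad (v n) x - g x))) \<longlonglongrightarrow> 0"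
    by (rule has_sobolev_gradE[OF g]) (rule that)
  have toM: "f \<in> borel_measurable ?M" if "f \<in> borel_measurable lebesgue" for f :: "real^'n \<Rightarrow> real"
    using that by (simp add: measurable_cong_sets[OF sets_monomial_measure refl])
  have mv: "v n \<in> borel_measurable lebesgue" "grad (v n) \<in> borel_measurable lebesgue" for n
    using C1_c_measurable[OF v] by (auto intro: borel_imp_lebesgue_measurable)
  have "(\<lambda>x. v n x - u x) \<in> borel_measurable ?M" for n
    by (intro toM borel_measurable_diff mv mu)
  from Lp_convergence_AE_subsequence[OF p0 this lv(1)] obtain s :: "nat \<Rightarrow> nat"
    where s: "strict_mono s" "AE x in ?M. (\<lambda>n. v (s n) x - u x) \<longlonglongrightarrow> 0" by blast
  show ?thesis
  proof (rule lp_norm_limit_inequality[OF q p0 less_imp_le[OF c]])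
    show "v (s n) \<in> borel_measurable ?M" for n by (intro toM mv)
    show "AE x in ?M. (\<lambda>n. v (s n) x) \<longlonglongrightarrow> u x"
      using s(2) by eventually_elim (simp add: LIM_zero_iff)
    show "lp_norm ?M q (v (s n)) \<le> ennreal c * lp_norm ?M p (\<lambda>x. norm (grad (v (s n)) x))" for n
      by (rule ineq[OF v])
    show "lp_norm ?M p (\<lambda>x. norm (g x)) < \<infinity>" using False by (simp add: less_top)
    fix L assume L: "lp_norm ?M p (\<lambda>x. norm (g x)) < ennreal L" "0 < L"
    show "eventually (\<lambda>n. lp_norm ?M p (\<lambda>x. norm (grad (v (s n)) x)) \<le> ennreal L) sequentially"
    proof (rule lp_norm_limsup_of_Lp_convergence[OF p _ _ _ _ _ L])
      show "(\<lambda>n. lp_norm ?M p (\<lambda>x. norm (grad (v (s n)) x - g x))) \<longlonglongrightarrow> 0"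
        using LIMSEQ_subseq_LIMSEQ[OF lv(2) s(1)] by (simp add: o_def)
      show "(\<lambda>x. norm (grad (v (s n)) x)) \<in> borel_measurable ?M" "(\<lambda>x. norm (g x)) \<in> borel_measurable ?M"
        "(\<lambda>x. norm (grad (v (s n)) x - g x)) \<in> borel_measurable ?M" for n
        by (intro toM measurable_compose[OF _ borel_measurable_norm] borel_measurable_diff mv mg)+
      show "\<bar>norm (grad (v (s n)) x)\<bar> \<le> \<bar>norm (g x)\<bar> + \<bar>norm (grad (v (s n)) x - g x)\<bar>" for n x
        using norm_triangle_ineq[of "g x" "grad (v (s n)) x - g x"] by simp
    qed
  qed
qed

section \<open>The exact Sobolev constant\<close>

text \<open>
  The exact constant is defined as an infimum, which is attained: for each \<open>u\<close> the admissible constants form a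
  closed condition, and the norm of the gradient of \<open>u\<close> is finite. If that norm is zero, some finite admissible
  constant is needed to conclude that \<open>u\<close> has norm zero.
\<close>

lemma sobolev_const_inequality:
  fixes A :: "real^'n"
  assumes A: "\<And>i. 0 \<le> A $ i" and p: "1 < p" "p < hom_dim A" and u: "u \<in> Cinf_c"
  shows "lp_norm (monomial_measure A) (hom_dim A * p / (hom_dim A - p)) u
      \<le> sobolev_const A p * lp_norm (monomial_measure A) p (\<lambda>x. norm (grad u x))"
proof -
  let ?a = "lp_norm (monomial_measure A) (hom_dim A * p / (hom_dim A - p)) u"
  let ?K = "lp_norm (monomial_measure A) p (\<lambda>x. norm (grad u x))"
  let ?S = "{c. \<forall>u\<in>Cinf_c.
            lp_norm (monomial_measure A) (hom_dim A * p / (hom_dim A - p)) u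
              \<le> c * lp_norm (monomial_measure A) p (\<lambda>x. norm (grad u x))}"
  have S: "?a \<le> c * ?K" if "c \<in> ?S" for c using that u by blast
  have Inf: "sobolev_const A p = Inf ?S" by (simp add: sobolev_const_def)
  have "?S \<noteq> {}"
    using sobolev_const_finite[OF A p] unfolding Inf by (metis Inf_empty infinity_ennreal_def less_irrefl top_ennreal_def)
  then obtain c0 where c0: "c0 \<in> ?S" by blast
  have "u \<in> C1_c" using u Cinf_c_subset_C1_c by blast
  then obtain R B where R: "R > 0" "\<And>x. x \<notin> cube R \<Longrightarrow> grad u x = 0" "\<And>x. norm (grad u x) \<le> B"
    using C1_c_bounds by metis
  have fin: "?K < \<infinity>"
    by (rule lp_norm_finite(1)[OF A _ R(1), where B = B]) (use R p in auto)
  show ?thesis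
  proof (cases "?K = 0")
    case True
    then show ?thesis using S[OF c0] by simp
  next
    case False
    have "?a / ?K \<le> sobolev_const A p"
      unfolding Inf
    proof (rule Inf_greatest)
      fix c assume "c \<in> ?S"
      from S[OF this] show "?a / ?K \<le> c"
        using False fin by (intro divide_le_posI_ennreal) (auto simp: mult.commute zero_less_iff_neq_zero)
    qed
    then have "?a / ?K * ?K \<le> sobolev_const A p * ?K" by (intro mult_right_mono) auto
    moreover have "?a / ?K * ?K = ?a"
      using False fin by (simp add: ennreal_divide_times)
    ultimately show ?thesis by simp
  qed
qed

text \<open>
  With the constant zero the Sobolev inequality would make a bump function vanish almost everywhere.
\<close>

lemma sobolev_const_pos:
  fixes A :: "real^'n"
  assumes A: "\<And>i. 0 \<le> A $ i" and p: "1 < p" "p < hom_dim A"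
  shows "0 < sobolev_const A p"
proof (rule ccontr)
  assume "\<not> 0 < sobolev_const A p"
  then have zero: "sobolev_const A p = 0" by simp
  let ?b = "bump (vec 0) (vec 1) :: real^'n \<Rightarrow> real"
  let ?M = "monomial_measure A" and ?q = "hom_dim A * p / (hom_dim A - p)"
  have q: "?q > 0" using p by simp
  have b: "?b \<in> Cinf_c" by (rule bump_Cinf_c)
  then have mb: "?b \<in> borel_measurable borel" using C1_c_measurable(1) Cinf_c_subset_C1_c by blast
  have "lp_norm ?M ?q ?b \<le> 0"
    using sobolev_const_inequality[OF A p b] unfolding zero by simp
  then have "lp_norm ?M ?q ?b = 0" by simp
  then have "(\<integral>\<^sup>+x. ennreal (\<bar>?b x\<bar> powr ?q) \<partial>?M) = 0" unfolding lp_norm_eq_0_iff[OF q] .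
  then have "AE x in ?M. ennreal (\<bar>?b x\<bar> powr ?q) = 0"
  proof (subst (asm) nn_integral_0_iff_AE)
    show "(\<lambda>x. ennreal (\<bar>?b x\<bar> powr ?q)) \<in> borel_measurable ?M"
      using mb by (intro borel_imp_monomial_measurable) measurable
  qed
  then have "AE x in lebesgue. ?b x = 0"
    unfolding AE_monomial_measure by eventually_elim (simp add: ennreal_eq_0_iff powr_eq_0_iff order_class.antisym_conv)
  then have "AE x in lborel. ?b x = 0" by (simp add: AE_completion_iff)
  then have "(\<integral>x. ?b x \<partial>lborel) = 0" by (rule integral_eq_zero_AE)
  moreover have "0 < (\<integral>x. ?b x \<partial>lborel)"
  proof (rule bump_integral_pos)
    have "vec (1 / 2) \<in> box (vec 0) (vec 1 :: real^'n)" unfolding mem_box_cart by simp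
    then show "box (vec 0) (vec 1 :: real^'n) \<noteq> {}" by blast
  qed
  ultimately show False by simp
qed

lemma Cinf_c_has_sobolev_grad:
  assumes "u \<in> Cinf_c" "p > 0"
  shows "has_sobolev_grad A p u (grad u)"
proof -
  have u: "u \<in> C1_c" using assms Cinf_c_subset_C1_c by blast
  note m = C1_c_measurable[OF u, THEN borel_imp_monomial_measurable]
  have "lp_norm (monomial_measure A) p (\<lambda>x. 0) = 0" by (simp add: lp_norm_eq_0_iff assms)
  then show ?thesis
    unfolding has_sobolev_grad_def using m u by (intro conjI exI[of _ "\<lambda>n. u"]) auto
qed

text \<open>
  The gradient is selected for some exponent that need not be \<open>p\<close>; uniqueness across exponents makes
  the selection immaterial.
\<close>

lemma sobolev_grad_eq_AE:
  fixes A :: "real^'n"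
  assumes A: "\<And>i. 0 \<le> A $ i" and p: "p \<ge> 1" and g: "has_sobolev_grad A p u g"
  shows "AE x in monomial_measure A. sobolev_grad A u x = g x"
proof -
  have "\<exists>g. \<exists>p\<ge>1. has_sobolev_grad A p u g" using p g by blast
  from someI_ex[OF this] obtain p' where p': "p' \<ge> 1" "has_sobolev_grad A p' u (sobolev_grad A u)"
    unfolding sobolev_grad_def by blast
  show ?thesis
    unfolding AE_monomial_measure by (rule sobolev_grad_unique[OF A p'(1) p p'(2) g])
qed

section \<open>Grand Lebesgue norms\<close>

text \<open>
  The norms of a bounded function with bounded support depend continuously on the exponent, by dominated
  convergence. The continuity holds on the closed interval from \<open>1\<close> to \<open>D\<close>, where a positive
  continuous function attains its minimum; hence the infimum over the open interval is positive.
\<close>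

lemma lp_norm_in_GPsi:
  fixes A :: "real^'n" and f :: "real^'n \<Rightarrow> real"
  assumes A: "\<And>i. 0 \<le> A $ i" and D: "D > 1" and R: "R > 0"
    and mf: "f \<in> borel_measurable borel"
    and f: "\<And>x. x \<notin> cube R \<Longrightarrow> f x = 0" "\<And>x. \<bar>f x\<bar> \<le> B"
    and ne: "\<And>p. p > 0 \<Longrightarrow> lp_norm (monomial_measure A) p f \<noteq> 0"
  shows "(\<lambda>p. enn2real (lp_norm (monomial_measure A) p f)) \<in> GPsi {1<..<D}"
    and "\<And>p. p > 0 \<Longrightarrow> ennreal (enn2real (lp_norm (monomial_measure A) p f)) = lp_norm (monomial_measure A) p f"
proof -
  let ?M = "monomial_measure A"
  let ?N = "\<lambda>p. enn2real (lp_norm ?M p f)"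
  define I where "I p = (\<integral>\<^sup>+x. ennreal (\<bar>f x\<bar> powr p) \<partial>?M)" for p
  have fin: "I p < \<infinity>" "lp_norm ?M p f < \<infinity>" if "p > 0" for p
    unfolding I_def using lp_norm_finite[OF A that R f] by auto
  show "ennreal (?N p) = lp_norm ?M p f" if "p > 0" for p using fin(2)[OF that] by (simp add: less_top)
  have pos: "?N p > 0" if "p > 0" for p
    using fin(2)[OF that] ne[OF that] by (simp add: enn2real_positive_iff zero_less_iff_neq_zero less_top)
  have I0: "I p \<noteq> 0" if "p > 0" for p using ne[OF that] lp_norm_eq_0_iff[OF that, of ?M f] by (simp add: I_def)
  have N: "?N p = enn2real (I p) powr (1 / p)" if "p > 0" for p
  proof -
    have "I p = ennreal (enn2real (I p))" using fin(1)[OF that] by (simp add: less_top)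
    then have "lp_norm ?M p f = ennreal (enn2real (I p) powr (1 / p))"
      by (intro lp_norm_real) (simp_all add: I_def)
    then show ?thesis by simp
  qed
  have cont: "continuous_on {1..D} ?N"
  proof (rule continuous_on_sequentiallyI)
    fix s :: "nat \<Rightarrow> real" and a assume s: "\<forall>n. s n \<in> {1..D}" "a \<in> {1..D}" "s \<longlonglongrightarrow> a"
    have s1: "s n \<ge> 1" "s n \<le> D" for n using s(1) by auto
    have a: "a > 0" using s(2) by auto
    have "(\<lambda>n. I (s n)) \<longlonglongrightarrow> I a"
      unfolding I_def
    proof (rule nn_integral_powr_tendsto[OF A R mf mf, where B = B and D = D])
      show "(\<lambda>n. \<bar>f x\<bar> powr s n) \<longlonglongrightarrow> \<bar>f x\<bar> powr a" for x
      proof (cases "f x = 0")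
        case False
        then show ?thesis by (intro tendsto_powr tendsto_const s(3)) simp
      qed simp
      show "0 \<le> s n" for n using s1(1)[of n] by simp
    qed (use f s1(2) in auto)
    moreover have "I a = ennreal (enn2real (I a))" using fin(1)[OF a] by (simp add: less_top)
    ultimately have lim: "(\<lambda>n. enn2real (I (s n))) \<longlonglongrightarrow> enn2real (I a)"
      by (intro tendsto_enn2real) auto
    have "enn2real (I a) \<noteq> 0" using I0[OF a] fin(1)[OF a] by (auto simp: enn2real_eq_0_iff)
    then have "(\<lambda>n. enn2real (I (s n)) powr (1 / s n)) \<longlonglongrightarrow> enn2real (I a) powr (1 / a)"
      using a by (intro tendsto_powr lim tendsto_divide tendsto_const s(3)) auto
    moreover have "?N (s n) = enn2real (I (s n)) powr (1 / s n)" for n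
      using s1[of n] by (intro N) auto
    ultimately show "(\<lambda>n. ?N (s n)) \<longlonglongrightarrow> ?N a" using N[OF a] by simp
  qed
  obtain p0 where p0: "p0 \<in> {1..D}" "\<And>p. p \<in> {1..D} \<Longrightarrow> ?N p0 \<le> ?N p"
    using continuous_attains_inf[OF compact_Icc _ cont] D by (metis atLeastAtMost_iff empty_iff less_imp_le order_refl)
  have "?N p0 \<le> (INF p\<in>{1<..<D}. ?N p)"
    using D p0(2) by (intro cINF_greatest) auto
  then have "0 < (INF p\<in>{1<..<D}. ?N p)" using pos[of p0] p0(1) by auto
  then show "?N \<in> GPsi {1<..<D}"
    unfolding GPsi_def using pos continuous_on_subset[OF cont greaterThanLessThan_subseteq_atLeastAtMost_iff[THEN iffD2]]
    by auto
qed

lemma sobolev_exponents: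
  fixes D p q :: real
  assumes "D > 1"
  shows "q > D / (D - 1) \<Longrightarrow> 1 < D * q / (D + q) \<and> D * q / (D + q) < D
      \<and> D * (D * q / (D + q)) / (D - D * q / (D + q)) = q"
    and "1 < p \<Longrightarrow> p < D \<Longrightarrow> D * p / (D - p) > D / (D - 1)
      \<and> D * (D * p / (D - p)) / (D + D * p / (D - p)) = p"
proof -
  assume q: "q > D / (D - 1)"
  have q0: "q > 0" using assms q by (smt (verit) divide_pos_pos)
  have "D < q * (D - 1)" using q assms by (simp add: pos_divide_less_eq)
  then have 1: "1 < D * q / (D + q)" using q0 assms by (simp add: field_simps)
  have 2: "D * q / (D + q) < D" using q0 assms by (simp add: field_simps)
  have "D - D * q / (D + q) = D * D / (D + q)" using q0 assms by (simp add: field_simps)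
  moreover have "D * (D * q / (D + q)) = q * (D * D / (D + q))" by simp
  moreover have "D * D / (D + q) \<noteq> 0" using q0 assms by simp
  ultimately have 3: "D * (D * q / (D + q)) / (D - D * q / (D + q)) = q"
    by (simp only: nonzero_mult_div_cancel_right not_False_eq_True)
  show "1 < D * q / (D + q) \<and> D * q / (D + q) < D
      \<and> D * (D * q / (D + q)) / (D - D * q / (D + q)) = q" using 1 2 3 by blast
next
  assume p: "1 < p" "p < D"
  have "(p - 1) * D > 0" using p assms by simp
  then have 1: "D * p / (D - p) > D / (D - 1)" using p assms by (simp add: divide_simps) (simp add: algebra_simps)
  have "D + D * p / (D - p) = D * D / (D - p)" using p by (simp add: field_simps)
  then have 2: "D * (D * p / (D - p)) / (D + D * p / (D - p)) = p" using p assms by (simp add: field_simps)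
  show "D * p / (D - p) > D / (D - 1)
      \<and> D * (D * p / (D - p)) / (D + D * p / (D - p)) = p" using 1 2 by blast
qed

lemma gls_norm_sobolev:
  fixes A :: "real^'n"
  assumes A: "\<And>i. 0 \<le> A $ i" and D: "hom_dim A > 1"
    and \<psi>: "\<psi> \<in> GPsi {1<..<hom_dim A}"
    and u: "\<And>p. p \<in> {1<..<hom_dim A} \<Longrightarrow> u \<in> W1 A p"
  shows "gls_norm (monomial_measure A) {hom_dim A / (hom_dim A - 1)<..} (zeta A \<psi>) u
      \<le> gls_norm (monomial_measure A) {1<..<hom_dim A} (\<lambda>p. ennreal (\<psi> p)) (\<lambda>x. norm (sobolev_grad A u x))"
  unfolding gls_norm_def
proof (rule SUP_least)
  let ?L = "\<lambda>p. lp_norm (monomial_measure A) p (\<lambda>x. norm (sobolev_grad A u x))"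
  let ?D = "hom_dim A" and ?M = "monomial_measure A"
  fix q assume "q \<in> {?D / (?D - 1)<..}"
  then have q: "q > ?D / (?D - 1)" by simp
  define p where "p = ?D * q / (?D + q)"
  have p: "1 < p" "p < ?D" and pq: "?D * p / (?D - p) = q"
    using sobolev_exponents(1)[OF D q] by (auto simp: p_def)
  have q0: "q > 0" using q D by (smt (verit) divide_pos_pos)
  let ?C = "sobolev_const A p"
  obtain c where c: "c > 0" "?C = ennreal c"
    using sobolev_const_pos[OF A p] sobolev_const_finite[OF A p] by (cases ?C) auto
  obtain g where g: "has_sobolev_grad A p u g" using u[of p] p by (auto simp: W1_def)
  have sg: "?L p = lp_norm ?M p (\<lambda>x. norm (g x))"
    by (rule lp_norm_cong_AE) (use sobolev_grad_eq_AE[OF A _ g] p in \<open>auto elim: eventually_mono\<close>)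
  have "lp_norm ?M q v \<le> ennreal c * lp_norm ?M p (\<lambda>x. norm (grad v x))" if "v \<in> C1_c" for v
  proof (rule sobolev_inequality_C1_c[OF A _ q0 _ _ that])
    show "lp_norm ?M q w \<le> ennreal c * lp_norm ?M p (\<lambda>x. norm (grad w x))" if "w \<in> Cinf_c" for w
      using sobolev_const_inequality[OF A p that] by (simp add: c pq)
  qed (use p c in auto)
  then have "lp_norm ?M q u \<le> ennreal c * lp_norm ?M p (\<lambda>x. norm (g x))"
    using p by (intro sobolev_inequality_W1[OF A _ q0 c(1) _ g]) auto
  then have ineq: "lp_norm ?M q u \<le> ennreal c * ?L p"
    by (simp add: sg)
  have \<psi>p: "\<psi> p > 0" using \<psi> p by (auto simp: GPsi_def)
  have z: "zeta A \<psi> q = ennreal c * ennreal (\<psi> p)" by (simp add: zeta_def p_def[symmetric] Let_def c)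
  have "lp_norm ?M q u / zeta A \<psi> q \<le> ?L p / ennreal (\<psi> p)"
  proof (rule divide_le_posI_ennreal)
    show "0 < zeta A \<psi> q" using c \<psi>p unfolding z by (simp add: ennreal_zero_less_mult_iff)
    have "?L p / ennreal (\<psi> p) * ennreal (\<psi> p) = ?L p"
      using \<psi>p by (simp add: ennreal_divide_times)
    then have "zeta A \<psi> q * (?L p / ennreal (\<psi> p)) = ennreal c * ?L p"
      unfolding z by (metis mult.assoc mult.commute)
    then show "lp_norm ?M q u \<le> zeta A \<psi> q * (?L p / ennreal (\<psi> p))"
      using ineq by simp
  qed
  also have "\<dots> \<le> (SUP p\<in>{1<..<?D}. ?L p / ennreal (\<psi> p))"
    by (rule SUP_upper) (use p in auto)
  finally show "lp_norm ?M q u / zeta A \<psi> q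
      \<le> (SUP p\<in>{1<..<?D}. ?L p / ennreal (\<psi> p))" .
qed

text \<open>
  The inequality is tested with the function \<open>\<psi>\<close> that assigns to each exponent the norm of the gradient of
  \<open>w\<close>. All the quotients in the norm of the gradient are then \<open>1\<close>, and on the left the single exponent
  belonging to \<open>p\<close> is kept. If the gradient of \<open>w\<close> vanishes, this \<open>\<psi>\<close> is not
  positive, but then \<open>w\<close> has norm zero.
\<close>

lemma gls_constant_transfers:
  fixes A :: "real^'n"
  assumes A: "\<And>i. 0 \<le> A $ i" and D: "hom_dim A > 1" and p: "1 < p" "p < hom_dim A"
    and c: "\<And>\<psi> u. \<psi> \<in> GPsi {1<..<hom_dim A} \<Longrightarrow> u \<in> (\<Inter>p\<in>{1<..<hom_dim A}. W1 A p) \<Longrightarrow>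
      gls_norm (monomial_measure A) {1<..<hom_dim A} (\<lambda>p. ennreal (\<psi> p)) (\<lambda>x. norm (sobolev_grad A u x)) < \<infinity> \<Longrightarrow>
      gls_norm (monomial_measure A) {hom_dim A / (hom_dim A - 1)<..} (zeta A \<psi>) u
        \<le> c * gls_norm (monomial_measure A) {1<..<hom_dim A} (\<lambda>p. ennreal (\<psi> p)) (\<lambda>x. norm (sobolev_grad A u x))"
    and w: "w \<in> Cinf_c"
  shows "lp_norm (monomial_measure A) (hom_dim A * p / (hom_dim A - p)) w
      \<le> c * sobolev_const A p * lp_norm (monomial_measure A) p (\<lambda>x. norm (grad w x))"
proof (cases "lp_norm (monomial_measure A) p (\<lambda>x. norm (grad w x)) = 0")
  case True
  then show ?thesis using sobolev_const_inequality[OF A p w] by simp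
next
  case False
  let ?D = "hom_dim A" and ?M = "monomial_measure A" and ?f = "\<lambda>x. norm (grad w x)"
  let ?C = "sobolev_const A p" and ?q = "?D * p / (?D - p)"
  have w1: "w \<in> C1_c" using w Cinf_c_subset_C1_c by blast
  obtain R B where R: "R > 0" "\<And>x. x \<notin> cube R \<Longrightarrow> grad w x = 0" "\<And>x. norm (grad w x) \<le> B"
    using C1_c_bounds[OF w1] by metis
  have mf: "?f \<in> borel_measurable borel"
    using measurable_compose[OF C1_c_measurable(2)[OF w1] borel_measurable_norm] by simp
  have "(\<lambda>t::real. ennreal (\<bar>t\<bar> powr s)) \<in> borel_measurable borel" for s by measurable
  then have mfM: "(\<lambda>x. ennreal (\<bar>?f x\<bar> powr s)) \<in> borel_measurable ?M" for s
    by (intro borel_imp_monomial_measurable measurable_compose[OF mf])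
  have zero_iff: "lp_norm ?M s ?f = 0 \<longleftrightarrow> (AE x in ?M. ?f x = 0)" if s: "s > 0" for s
    unfolding lp_norm_eq_0_iff[OF s] nn_integral_0_iff_AE[OF mfM]
    by (intro AE_cong) (simp add: ennreal_eq_0_iff)
  have ne: "lp_norm ?M s ?f \<noteq> 0" if "s > 0" for s
    using False zero_iff[OF that] zero_iff[of p] p by auto
  define \<psi> where "\<psi> = (\<lambda>s. enn2real (lp_norm ?M s ?f))"
  have \<psi>: "\<psi> \<in> GPsi {1<..<?D}" "\<And>s. s > 0 \<Longrightarrow> ennreal (\<psi> s) = lp_norm ?M s ?f"
    unfolding \<psi>_def
    using lp_norm_in_GPsi[OF A D R(1) mf, where B = B] R(2,3) ne by auto
  have uW: "w \<in> (\<Inter>p\<in>{1<..<?D}. W1 A p)"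
  proof (rule INT_I)
    fix s assume "s \<in> {1<..<?D}"
    then show "w \<in> W1 A s" unfolding W1_def using Cinf_c_has_sobolev_grad[OF w, of s A] by auto
  qed
  have sg: "lp_norm ?M s (\<lambda>x. norm (sobolev_grad A w x)) = ennreal (\<psi> s)" if "s > 0" for s
  proof -
    have "AE x in ?M. sobolev_grad A w x = grad w x"
      by (rule sobolev_grad_eq_AE[OF A order_refl Cinf_c_has_sobolev_grad[OF w]]) simp
    then have "lp_norm ?M s (\<lambda>x. norm (sobolev_grad A w x)) = lp_norm ?M s ?f"
      by (intro lp_norm_cong_AE) (auto elim: eventually_mono)
    then show ?thesis using \<psi>(2)[OF that] by simp
  qed
  have pos: "\<psi> s > 0" if "s \<in> {1<..<?D}" for s using \<psi>(1) that by (auto simp: GPsi_def)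
  have one: "gls_norm ?M {1<..<?D} (\<lambda>p. ennreal (\<psi> p)) (\<lambda>x. norm (sobolev_grad A w x)) = 1"
  proof -
    have "(SUP s\<in>{1<..<?D}. lp_norm ?M s (\<lambda>x. norm (sobolev_grad A w x)) / ennreal (\<psi> s)) = (SUP s\<in>{1<..<?D}. 1)"
    proof (rule SUP_cong[OF refl])
      fix s assume s: "s \<in> {1<..<?D}"
      have "ennreal (\<psi> s) \<noteq> 0" using pos[OF s] by simp
      then show "lp_norm ?M s (\<lambda>x. norm (sobolev_grad A w x)) / ennreal (\<psi> s) = 1"
        using s by (subst sg) auto
    qed
    also have "\<dots> = 1" using D by (intro SUP_const) auto
    finally show ?thesis by (simp add: gls_norm_def)
  qed
  have q: "?q > ?D / (?D - 1)" "?D * ?q / (?D + ?q) = p"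
    using sobolev_exponents(2)[OF D p] by auto
  have z: "zeta A \<psi> ?q = ?C * ennreal (\<psi> p)" using q(2) by (simp add: zeta_def)
  have z0: "zeta A \<psi> ?q \<noteq> 0" "zeta A \<psi> ?q < top"
    using sobolev_const_pos[OF A p] sobolev_const_finite[OF A p] pos[of p] p
    unfolding z by (auto simp: ennreal_mult_less_top)
  have "lp_norm ?M ?q w / zeta A \<psi> ?q \<le> gls_norm ?M {?D / (?D - 1)<..} (zeta A \<psi>) w"
    unfolding gls_norm_def by (rule SUP_upper) (use q in simp)
  also have "\<dots> \<le> c * 1" using c[OF \<psi>(1) uW] unfolding one by simp
  finally have "lp_norm ?M ?q w / zeta A \<psi> ?q * zeta A \<psi> ?q \<le> c * zeta A \<psi> ?q"
    by (intro mult_right_mono) auto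
  moreover have "lp_norm ?M ?q w / zeta A \<psi> ?q * zeta A \<psi> ?q = lp_norm ?M ?q w"
    using z0 by (simp add: ennreal_divide_times)
  ultimately show ?thesis using \<psi>(2)[of p] p by (simp add: z mult.assoc)
qed

theorem theorem5p1:
  fixes A :: "real^'n"
  assumes A_nonneg: "\<And>i. 0 \<le> A $ i"
    and D_gt_1: "hom_dim A > 1"
  shows
    "(\<forall>\<psi>\<in>GPsi {1<..<hom_dim A}. \<forall>u\<in>(\<Inter>p\<in>{1<..<hom_dim A}. W1 A p).
        gls_norm (monomial_measure A) {1<..<hom_dim A} (\<lambda>p. ennreal (\<psi> p))
          (\<lambda>x. norm (sobolev_grad A u x)) < \<infinity> \<longrightarrow>
        gls_norm (monomial_measure A) {hom_dim A / (hom_dim A - 1)<..} (zeta A \<psi>) u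
          \<le> 1 * gls_norm (monomial_measure A) {1<..<hom_dim A} (\<lambda>p. ennreal (\<psi> p))
                (\<lambda>x. norm (sobolev_grad A u x)))
     \<and>
     \<not> (\<exists>c::ennreal. c < 1 \<and>
        (\<forall>\<psi>\<in>GPsi {1<..<hom_dim A}. \<forall>u\<in>(\<Inter>p\<in>{1<..<hom_dim A}. W1 A p).
          gls_norm (monomial_measure A) {1<..<hom_dim A} (\<lambda>p. ennreal (\<psi> p))
            (\<lambda>x. norm (sobolev_grad A u x)) < \<infinity> \<longrightarrow>
          gls_norm (monomial_measure A) {hom_dim A / (hom_dim A - 1)<..} (zeta A \<psi>) u
            \<le> c * gls_norm (monomial_measure A) {1<..<hom_dim A} (\<lambda>p. ennreal (\<psi> p))
                  (\<lambda>x. norm (sobolev_grad A u x))))"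
proof (intro conjI notI ballI impI, goal_cases)
  case (1 \<psi> u)
  then show ?case using gls_norm_sobolev[OF A_nonneg D_gt_1] by simp
next
  case 2
  \<comment> \<open>One exponent at which the Sobolev constant is finite and positive is enough; the midpoint is as good as any.\<close>
  define p where "p = (1 + hom_dim A) / 2"
  have p: "1 < p" "p < hom_dim A" using D_gt_1 by (auto simp: p_def)
  let ?C = "sobolev_const A p"
  from 2 show False
  proof (elim exE conjE, goal_cases)
    case (1 c)
    have "lp_norm (monomial_measure A) (hom_dim A * p / (hom_dim A - p)) w
      \<le> c * ?C * lp_norm (monomial_measure A) p (\<lambda>x. norm (grad w x))" if "w \<in> Cinf_c" for w
      using 1(2) by (intro gls_constant_transfers[OF A_nonneg D_gt_1 p _ that]) blast
    then have "?C \<le> c * ?C"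
      unfolding sobolev_const_def[of A p] by (intro Inf_lower) simp
    moreover have "c * ?C < 1 * ?C"
      using 1(1) sobolev_const_pos[OF A_nonneg p] sobolev_const_finite[OF A_nonneg p]
      by (intro ennreal_mult_strict_right_mono) auto
    ultimately show False by simp
  qed
qed

end
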